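(* Let $\Sigma$ be a linear compartment model with at least one input ($\mathrm{In}\neq\varnothing$) and whose graph $G$ is strongly connected. Then the field of all identifiable functions of $\Sigma$ is generated, over $\mathbb{C}$, by the coefficients of the entries of the transfer function matrix of $\Sigma$.
   Context: **Linear compartment models.** Let $G$ be a simple directed graph with vertex set $V=\{1,\ldots,n\}$ and edge set $E$, and let $\mathrm{In},\mathrm{Out},\mathrm{Leak}\subset V$ with, without loss of generality, $\mathrm{Out}=\{1,\ldots,m\}$, $m\ge1$. The parameters $\bm{\mu}=(\mu_1,\ldots,\mu_\lambda)$ are indeterminates consisting of all $a_{ji}$ for edges $i\to j$ in $E$, all $a_{0i}$ for $i\in\mathrm{Leak}$, and possibly some additional parameters. Let $b_i\in\mathbb{C}(\bm{\mu})\setminus\{0\}$ for $i\in\mathrm{In}$ and $c_i\in\mathbb{C}(\bm{\mu})\setminus\{0\}$ for $i\in\mathrm{Out}$. The matrix $A(G)$ is the $n\times n$ matrix with $A(G)_{ii}=-a_{0i}-\sum_{k:\,i\to k\in E}a_{ki}$ if $i\in\mathrm{Leak}$, $A(G)_{ii}=-\sum_{k:\,i\to k\in E}a_{ki}$ if $i\notin\mathrm{Leak}$, $A(G)_{ij}=a_{ij}$ if $j\to i\in E$, and $A(G)_{ij}=0$ otherwise. The associated *linear compartment model* is the system $\Sigma$: $\mathbf{x}'=A(G)\mathbf{x}+\mathbf{v}$, $y_i=c_i(\bm{\mu})x_i$ for $i\in\mathrm{Out}$, $\mathbf{x}(0)=\mathbf{x}^\ast$, where $\mathbf{v}$ is the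 column whose $i$-th entry is $b_i(\bm{\mu})u_i$ if $i\in\mathrm{In}$ and $0$ otherwise. So the states are $\mathbf{x}=(x_1,\ldots,x_n)$, outputs $\mathbf{y}=(y_1,\ldots,y_m)$, inputs $\mathbf{u}=(u_i\mid i\in\mathrm{In})$, $\kappa=|\mathrm{In}|$. **Transfer function matrix.** For a linear system $\mathbf{x}'=A(\bm{\mu})\mathbf{x}+B(\bm{\mu})\mathbf{u}$, $\mathbf{y}=C(\bm{\mu})\mathbf{x}$, the transfer function matrix is $H(\bm{\mu},s):=C(\bm{\mu})(sI-A(\bm{\mu}))^{-1}B(\bm{\mu})$, where $s$ is a new variable and $I$ is the identity matrix. For a linear compartment model, $A=A(G)$, $B$ is the $n\times|\mathrm{In}|$ matrix whose column indexed by $j\in\mathrm{In}$ has $b_j$ in row $j$ and zeros elsewhere, and $C$ is the $m\times n$ matrix whose $i$-th row has $c_i$ in column $i$ and zeros elsewhere. For $f\in\mathbb{C}(\bm{\mu})(s)$, the *coefficients of $f$* are the union of the coefficients (in $\mathbb{C}(\bm{\mu})$) of the numerator and denominator, as polynomials in $s$, of the reduced form of $f$ with monic denominator. **Identifiability.** $\mathbb{C}^\infty(0)$ is the set of all functions complex analytic in some neighborhood of $t=0$. $\Omega\subset\mathbb{C}^\lambda$ is the complement of the set where at least one of the denominators of the coefficients (in $\mathbb{C}(\bm{\mu})$) of $\Sigma$ vanishes. For $h\in\mathbb{C}(\bm{\mu})$ put $\Omega_h:=\mathbb{C}^n\times\{\hat{\bm{\mu}}\in\Omega\mid h(\hat{\bm{\mu}})\text{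 well-defined}\}\times(\mathbb{C}^\infty(0))^\kappa$. For $(\hat{\mathbf{x}}^\ast,\hat{\bm{\mu}},\hat{\mathbf{u}})$ with $\hat{\bm{\mu}}\in\Omega$, $Y(\hat{\mathbf{x}}^\ast,\hat{\bm{\mu}},\hat{\mathbf{u}})$ denotes the $\mathbf{y}$-component of the unique solution over $\mathbb{C}^\infty(0)$ of $\Sigma$ with $\mathbf{x}^\ast=\hat{\mathbf{x}}^\ast$, $\bm{\mu}=\hat{\bm{\mu}}$, $\mathbf{u}=\hat{\mathbf{u}}$. A subset of $\mathbb{C}^s$ is Zariski open if it is the complement of the zero set of some polynomial $P$ on $\mathbb{C}^s$; a subset $U\subset(\mathbb{C}^\infty(0))^s$ is Zariski open if there is a polynomial $P$ in $z_1,\ldots,z_s$ and their derivatives with $U=\{\hat{\mathbf z}\in(\mathbb{C}^\infty(0))^s\mid P(\hat{\mathbf z})|_{t=0}\neq0\}$. $\tau(X)$ denotes the set of nonempty Zariski open subsets of $X$. A function $h\in\mathbb{C}(\bm{\mu})$ is *identifiable* if there exist $\Theta\in\tau(\mathbb{C}^n\times\mathbb{C}^\lambda)$ and $U\in\tau((\mathbb{C}^\infty(0))^\kappa)$ such that for all $(\hat{\mathbf{x}}^\ast,\hat{\bm{\mu}},\hat{\mathbf{u}})\in(\Theta\times U)\cap\Omega_h$ one has $|S_h(\hat{\mathbf{x}}^\ast,\hat{\bm{\mu}},\hat{\mathbf{u}})|=1$, where $$S_h(\hat{\mathbf{x}}^\ast,\hat{\bm{\mu}},\hat{\mathbf{u}})=\{h(\tilde{\bm{\mu}})\mid\exists(\tilde{\mathbf{x}}^\ast,\tilde{\bm{\mu}},\hat{\mathbf{u}})\in\Omega_h\text{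 with }Y(\hat{\mathbf{x}}^\ast,\hat{\bm{\mu}},\hat{\mathbf{u}})=Y(\tilde{\mathbf{x}}^\ast,\tilde{\bm{\mu}},\hat{\mathbf{u}})\}.$$ The *field of identifiable functions* is $\{h\in\mathbb{C}(\bm{\mu})\mid h\text{ is identifiable}\}$. *)

theory Defs
  imports
    "HOL-Analysis.Analysis"
    "HOL-Library.Poly_Mapping"
    "HOL-Computational_Algebra.Computational_Algebra"
begin

section \<open>Polynomials and rational functions over the complex numbers\<close>

text \<open>
  A multivariate polynomial with indeterminates in \<open>'v\<close> is a finitely supported map from
  monomials (themselves finitely supported exponent maps) to coefficients.
\<close>

type_synonym 'v cpoly = "('v \<Rightarrow>\<^sub>0 nat) \<Rightarrow>\<^sub>0 complex"

definition polys_in :: "'v set \<Rightarrow> 'v cpoly set" where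
  "polys_in V = {p. \<forall>m \<in> Poly_Mapping.keys p. Poly_Mapping.keys m \<subseteq> V}"

definition poly_eval :: "('v \<Rightarrow> complex) \<Rightarrow> 'v cpoly \<Rightarrow> complex" where
  "poly_eval z p = (\<Sum>m \<in> Poly_Mapping.keys p. Poly_Mapping.lookup p m *
     (\<Prod>v \<in> Poly_Mapping.keys m. z v ^ Poly_Mapping.lookup m v))"

definition poly_const :: "complex \<Rightarrow> 'v cpoly" where
  "poly_const a = Poly_Mapping.single 0 a"

definition poly_var :: "'v \<Rightarrow> 'v cpoly" where
  "poly_var v = Poly_Mapping.single (Poly_Mapping.single v 1) 1"

text \<open>
  The parameters are indexed by \<open>{..<l}\<close>. The type \<open>ratfun\<close> has infinitely many
  indeterminates; the field of rational functions in the \<open>l\<close> parameters is its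
  subfield \<open>ratfuns l\<close>.
\<close>

type_synonym ratfun = "nat cpoly fract"

definition ratfuns :: "nat \<Rightarrow> ratfun set" where
  "ratfuns l = {Fract p q | p q. p \<in> polys_in {..<l} \<and> q \<in> polys_in {..<l} \<and> q \<noteq> 0}"

text \<open>
  A rational function is well-defined at a point if the denominator of some fraction
  representing it does not vanish there; as polynomials have unique factorization, this says
  that the denominator of its reduced form does not vanish.
\<close>

definition ratfun_defined_at :: "ratfun \<Rightarrow> (nat \<Rightarrow> complex) \<Rightarrow> bool" where
  "ratfun_defined_at f z \<longleftrightarrow> (\<exists>p q. f = Fract p q \<and> poly_eval z q \<noteq> 0)"

definition ratfun_eval :: "ratfun \<Rightarrow> (nat \<Rightarrow> complex) \<Rightarrow> complex" where
  "ratfun_eval f z =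
     (THE w. \<exists>p q. f = Fract p q \<and> poly_eval z q \<noteq> 0 \<and> w = poly_eval z p / poly_eval z q)"

definition is_subfield :: "'a :: field set \<Rightarrow> bool" where
  "is_subfield K \<longleftrightarrow> 0 \<in> K \<and> 1 \<in> K \<and>
     (\<forall>x \<in> K. \<forall>y \<in> K. x + y \<in> K \<and> x * y \<in> K) \<and> (\<forall>x \<in> K. - x \<in> K \<and> inverse x \<in> K)"

definition field_generated_over_complex :: "ratfun set \<Rightarrow> ratfun set" where
  "field_generated_over_complex S =
     is_subfield hull (range (\<lambda>a. to_fract (poly_const a)) \<union> S)"

text \<open>The coefficients of the reduced form, with monic denominator, of a function of \<open>s\<close>.\<close>

definition fract_coeffs :: "'a :: field poly fract \<Rightarrow> 'a set" where
  "fract_coeffs f = {a. \<exists>p q. f = Fract p q \<and> coprime p q \<and> lead_coeff q = 1 \<and>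
     (a \<in> set (coeffs p) \<or> a \<in> set (coeffs q))}"


section \<open>Linear compartment models\<close>

text \<open>
  The vertices are the elements of the finite type \<open>'n\<close>. The pair \<open>(i, j) \<in> edges M\<close> is the
  edge from \<open>i\<close> to \<open>j\<close>, and \<open>edge_par M (i, j)\<close> is the index of the parameter written
  \<open>a\<^sub>j\<^sub>i\<close>; \<open>leak_par M i\<close> is the index of the parameter written \<open>a\<^sub>0\<^sub>i\<close>. Indices below
  \<open>num_pars M\<close> that are not of this form are the additional parameters.
\<close>

record 'n compartment_model =
  edges :: "('n \<times> 'n) set"
  inputs :: "'n set"
  outputs :: "'n set"
  leaks :: "'n set"
  num_pars :: nat
  edge_par :: "'n \<times> 'n \<Rightarrow> nat"
  leak_par :: "'n \<Rightarrow> nat"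
  in_coeff :: "'n \<Rightarrow> ratfun"
  out_coeff :: "'n \<Rightarrow> ratfun"

definition linear_compartment_model :: "'n :: finite compartment_model \<Rightarrow> bool" where
  "linear_compartment_model M \<longleftrightarrow>
     irrefl (edges M) \<and>
     outputs M \<noteq> {} \<and>
     edge_par M ` edges M \<subseteq> {..<num_pars M} \<and>
     leak_par M ` leaks M \<subseteq> {..<num_pars M} \<and>
     inj_on (edge_par M) (edges M) \<and>
     inj_on (leak_par M) (leaks M) \<and>
     edge_par M ` edges M \<inter> leak_par M ` leaks M = {} \<and>
     (\<forall>i \<in> inputs M. in_coeff M i \<in> ratfuns (num_pars M) - {0}) \<and>
     (\<forall>i \<in> outputs M. out_coeff M i \<in> ratfuns (num_pars M) - {0})"

definition strongly_connected :: "('n \<times> 'n) set \<Rightarrow> bool" where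
  "strongly_connected E \<longleftrightarrow> (\<forall>i j. (i, j) \<in> E\<^sup>*)"

definition par :: "nat \<Rightarrow> ratfun" where
  "par k = to_fract (poly_var k)"

definition comp_matrix :: "'n :: finite compartment_model \<Rightarrow> ratfun^'n^'n" where
  "comp_matrix M = (\<chi> i j.
     if i = j then
       (if i \<in> leaks M then - par (leak_par M i) else 0)
         - (\<Sum>k | (i, k) \<in> edges M. par (edge_par M (i, k)))
     else if (j, i) \<in> edges M then par (edge_par M (j, i))
     else 0)"


section \<open>Transfer function matrix\<close>

text \<open>
  The matrices below are padded to size \<open>'n \<times> 'n\<close>: the columns of \<open>in_matrix\<close> outside
  \<open>inputs M\<close> and the rows of \<open>out_matrix\<close> outside \<open>outputs M\<close> are zero and are not part of
  the model, so only the entries of the product with row in \<open>outputs M\<close> and column in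
  \<open>inputs M\<close> are entries of the transfer function matrix.
\<close>

definition in_matrix :: "'n :: finite compartment_model \<Rightarrow> ratfun^'n^'n" where
  "in_matrix M = (\<chi> i j. if i = j \<and> j \<in> inputs M then in_coeff M j else 0)"

definition out_matrix :: "'n :: finite compartment_model \<Rightarrow> ratfun^'n^'n" where
  "out_matrix M = (\<chi> i j. if i = j \<and> i \<in> outputs M then out_coeff M i else 0)"

definition const_in_s :: "ratfun^'n^'m \<Rightarrow> ratfun poly fract^'n^'m" where
  "const_in_s X = (\<chi> i j. to_fract [:X $ i $ j:])"

definition transfer_matrix :: "'n :: finite compartment_model \<Rightarrow> ratfun poly fract^'n^'n" where
  "transfer_matrix M =
     const_in_s (out_matrix M)
       ** matrix_inv (mat (to_fract [:0, 1:]) - const_in_s (comp_matrix M))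
       ** const_in_s (in_matrix M)"

definition transfer_coeffs :: "'n :: finite compartment_model \<Rightarrow> ratfun set" where
  "transfer_coeffs M =
     (\<Union>i \<in> outputs M. \<Union>j \<in> inputs M. fract_coeffs (transfer_matrix M $ i $ j))"


section \<open>Solutions and outputs\<close>

text \<open>
  Elements of \<open>analytic_at_0\<close> represent germs: all notions below depend on such functions only
  through their values near \<open>0\<close>, and equality of outputs is equality near \<open>0\<close>.
\<close>

definition analytic_at_0 :: "(complex \<Rightarrow> complex) set" where
  "analytic_at_0 = {f. f analytic_on {0}}"

definition points :: "'n compartment_model \<Rightarrow> (nat \<Rightarrow> complex) set" where
  "points M = {..<num_pars M} \<rightarrow>\<^sub>E UNIV"

definition input_tuples :: "'n compartment_model \<Rightarrow> ('n \<Rightarrow> complex \<Rightarrow> complex) set" where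
  "input_tuples M = inputs M \<rightarrow>\<^sub>E analytic_at_0"

text \<open>The entries of the compartmental matrix are polynomials, hence defined everywhere.\<close>

definition Omega :: "'n compartment_model \<Rightarrow> (nat \<Rightarrow> complex) set" where
  "Omega M = {\<mu> \<in> points M.
     (\<forall>i \<in> inputs M. ratfun_defined_at (in_coeff M i) \<mu>) \<and>
     (\<forall>i \<in> outputs M. ratfun_defined_at (out_coeff M i) \<mu>)}"

definition Omega_of :: "'n compartment_model \<Rightarrow> ratfun \<Rightarrow>
    (('n \<Rightarrow> complex) \<times> (nat \<Rightarrow> complex) \<times> ('n \<Rightarrow> complex \<Rightarrow> complex)) set" where
  "Omega_of M h = UNIV \<times> {\<mu> \<in> Omega M. ratfun_defined_at h \<mu>} \<times> input_tuples M"

definition is_solution :: "'n :: finite compartment_model \<Rightarrow> ('n \<Rightarrow> complex) \<Rightarrow>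
    (nat \<Rightarrow> complex) \<Rightarrow> ('n \<Rightarrow> complex \<Rightarrow> complex) \<Rightarrow> ('n \<Rightarrow> complex \<Rightarrow> complex) \<Rightarrow> bool" where
  "is_solution M x0 \<mu> u x \<longleftrightarrow>
     (\<forall>i. x i \<in> analytic_at_0) \<and>
     (\<forall>i. \<forall>\<^sub>F t in nhds 0. (x i has_field_derivative
        (\<Sum>j\<in>UNIV. ratfun_eval (comp_matrix M $ i $ j) \<mu> * x j t)
          + (if i \<in> inputs M then ratfun_eval (in_coeff M i) \<mu> * u i t else 0)) (at t)) \<and>
     (\<forall>i. x i 0 = x0 i)"

text \<open>The solution is unique up to equality near \<open>0\<close>, so the choice below is harmless.\<close>

definition system_output :: "'n :: finite compartment_model \<Rightarrow> ('n \<Rightarrow> complex) \<Rightarrow>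
    (nat \<Rightarrow> complex) \<Rightarrow> ('n \<Rightarrow> complex \<Rightarrow> complex) \<Rightarrow> ('n \<Rightarrow> complex \<Rightarrow> complex)" where
  "system_output M x0 \<mu> u i t =
     ratfun_eval (out_coeff M i) \<mu> * (SOME x. is_solution M x0 \<mu> u x) i t"

definition same_output :: "'n compartment_model \<Rightarrow>
    ('n \<Rightarrow> complex \<Rightarrow> complex) \<Rightarrow> ('n \<Rightarrow> complex \<Rightarrow> complex) \<Rightarrow> bool" where
  "same_output M y y' \<longleftrightarrow> (\<forall>i \<in> outputs M. \<forall>\<^sub>F t in nhds 0. y i t = y' i t)"


section \<open>Identifiability\<close>

definition zariski_open_points :: "'n compartment_model \<Rightarrow>
    (('n \<Rightarrow> complex) \<times> (nat \<Rightarrow> complex)) set \<Rightarrow> bool" where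
  "zariski_open_points M T \<longleftrightarrow> (\<exists>P \<in> polys_in (UNIV <+> {..<num_pars M}).
     T = {(x, \<mu>) \<in> UNIV \<times> points M. poly_eval (case_sum x \<mu>) P \<noteq> 0})"

text \<open>The indeterminate \<open>(i, k)\<close> stands for the \<open>k\<close>-th derivative of the \<open>i\<close>-th input.\<close>

definition zariski_open_inputs :: "'n compartment_model \<Rightarrow>
    ('n \<Rightarrow> complex \<Rightarrow> complex) set \<Rightarrow> bool" where
  "zariski_open_inputs M U \<longleftrightarrow> (\<exists>P \<in> polys_in (inputs M \<times> (UNIV :: nat set)).
     U = {u \<in> input_tuples M. poly_eval (\<lambda>(i, k). (deriv ^^ k) (u i) 0) P \<noteq> 0})"

definition values_with_same_output :: "'n :: finite compartment_model \<Rightarrow> ratfun \<Rightarrow>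
    ('n \<Rightarrow> complex) \<Rightarrow> (nat \<Rightarrow> complex) \<Rightarrow> ('n \<Rightarrow> complex \<Rightarrow> complex) \<Rightarrow> complex set" where
  "values_with_same_output M h x \<mu> u =
     {ratfun_eval h \<mu>' | x' \<mu>'. (x', \<mu>', u) \<in> Omega_of M h \<and>
        same_output M (system_output M x \<mu> u) (system_output M x' \<mu>' u)}"

definition identifiable :: "'n :: finite compartment_model \<Rightarrow> ratfun \<Rightarrow> bool" where
  "identifiable M h \<longleftrightarrow>
     (\<exists>T U. zariski_open_points M T \<and> T \<noteq> {} \<and> zariski_open_inputs M U \<and> U \<noteq> {} \<and>
        (\<forall>x \<mu> u. (x, \<mu>) \<in> T \<and> u \<in> U \<and> (x, \<mu>, u) \<in> Omega_of M h \<longrightarrow>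
           card (values_with_same_output M h x \<mu> u) = 1))"

definition identifiable_functions :: "'n :: finite compartment_model \<Rightarrow> ratfun set" where
  "identifiable_functions M = {h \<in> ratfuns (num_pars M). identifiable M h}"

end

theory Submission
  imports Defs "HOL-Complex_Analysis.Complex_Analysis"
begin

text \<open>
  Strong connectivity makes the model generically observable from each vertex (by specializing to
  an in-tree) and controllable from each vertex (by time reversal), so the characteristic polynomial
  \<open>\<chi>\<close> of the compartmental matrix and the corresponding entry of the adjugate are coprime and every
  entry of the transfer function matrix has denominator \<open>\<chi>\<close> in reduced form.

  For an input whose derivatives at \<open>0\<close> have a nonvanishing Wronskian, equality of the outputs at two
  points, with any initial states, forces \<open>\<chi>' N = \<chi> N'\<close> for the numerators, hence equality of all
  transfer coefficients; so the field they generate consists of identifiable functions. Conversely,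
  let \<open>h\<close> lie outside this field. Evaluation at a generic point \<open>\<mu>\<close> embeds a countable subfield
  containing the transfer coefficients into \<open>\<complex>\<close>, and this embedding extends to \<open>h\<close> and the
  parameters so that the image of \<open>h\<close> is not its value at \<open>\<mu>\<close>. The images of the parameters form a
  second point with the same transfer functions but a different value of \<open>h\<close>; by controllability
  at \<open>\<mu>\<close> an initial state can be chosen there giving the same output.
\<close>

unbundle no Formal_Power_Series.fps_syntax

section \<open>Polynomial evaluation\<close>

text \<open>The second parameter point must be an honest complex point, and no embedding of a
  nonconstant function field into \<open>complex\<close> fixes all constants. So only finitely many
  constants, those occurring in chosen fractions for the functions that matter, enter the base
  field. Its countability is used twice: a point can avoid the zeros of countably many denominators,
  and a transcendental element can be sent outside countably many roots. Initial states may differ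
  between the two points. They drop out of the input-output equations, which is why genericity of
  the input alone suffices in one direction; in the other they are the freedom that controllability
  exploits. Analysis is confined to the existence of solutions and to derivatives at 0. A germ is
  its sequence of derivatives there, so a solution becomes a discrete recursion and a polynomial in
  d/dt a polynomial in the shift. The constant \<open>2 * CARD('n)\<close> exceeds the degrees of
  the cross differences \<chi>' N - \<chi> N', since \<chi> has degree n and N smaller
  degree.\<close>

definition mono_eval :: "('v \<Rightarrow> complex) \<Rightarrow> ('v \<Rightarrow>\<^sub>0 nat) \<Rightarrow> complex" where
  "mono_eval z m = (\<Prod>v \<in> Poly_Mapping.keys m. z v ^ Poly_Mapping.lookup m v)"

lemma mono_eval_superset:
  assumes "finite V" "Poly_Mapping.keys m \<subseteq> V"
  shows "mono_eval z m = (\<Prod>v\<in>V. z v ^ Poly_Mapping.lookup m v)"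
  unfolding mono_eval_def
  by (rule prod.mono_neutral_left) (use assms in \<open>auto simp: in_keys_iff\<close>)

lemma mono_eval_0 [simp]: "mono_eval z 0 = 1"
  by (simp add: mono_eval_def)

lemma mono_eval_add: "mono_eval z (m + n) = mono_eval z m * mono_eval z n"
proof -
  let ?V = "Poly_Mapping.keys m \<union> Poly_Mapping.keys n"
  have "Poly_Mapping.keys (m + n) \<subseteq> ?V"
    by (rule keys_add)
  then show ?thesis
    by (simp add: mono_eval_superset[of ?V] lookup_add power_add prod.distrib)
qed

lemma poly_eval_superset:
  assumes "finite K" "Poly_Mapping.keys p \<subseteq> K"
  shows "poly_eval z p = (\<Sum>m\<in>K. Poly_Mapping.lookup p m * mono_eval z m)"
  unfolding poly_eval_def mono_eval_def
  by (rule sum.mono_neutral_left) (use assms in \<open>auto simp: in_keys_iff\<close>)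

lemma poly_eval_0 [simp]: "poly_eval z 0 = 0"
  by (simp add: poly_eval_def)

lemma poly_eval_single [simp]: "poly_eval z (Poly_Mapping.single m a) = a * mono_eval z m"
  by (subst poly_eval_superset[of "{m}"]) auto

lemma poly_eval_add [simp]: "poly_eval z (p + q) = poly_eval z p + poly_eval z q"
proof -
  let ?K = "Poly_Mapping.keys p \<union> Poly_Mapping.keys q"
  have "Poly_Mapping.keys (p + q) \<subseteq> ?K"
    by (rule keys_add)
  then show ?thesis
    by (simp add: poly_eval_superset[of ?K] lookup_add sum.distrib algebra_simps)
qed

lemma poly_eval_const [simp]: "poly_eval z (poly_const a) = a"
  by (simp add: poly_const_def)

lemma poly_eval_1 [simp]: "poly_eval z 1 = 1"
  using poly_eval_const[of z 1] by (simp add: poly_const_def)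

lemma poly_eval_var [simp]: "poly_eval z (poly_var v) = z v"
  by (simp add: poly_var_def mono_eval_def)

lemma poly_mapping_single_induct [case_names zero single add]:
  fixes p :: "'a \<Rightarrow>\<^sub>0 'b :: comm_monoid_add"
  assumes "P 0" "\<And>m a. P (Poly_Mapping.single m a)" "\<And>p q. P p \<Longrightarrow> P q \<Longrightarrow> P (p + q)"
  shows "P p"
proof -
  have "P (\<Sum>m\<in>K. Poly_Mapping.single m (Poly_Mapping.lookup p m))" if "finite K" for K
    using that by (induction K rule: finite_induct) (use assms in auto)
  from this[of "Poly_Mapping.keys p"]
  have "P (\<Sum>m\<in>Poly_Mapping.keys p. Poly_Mapping.single m (Poly_Mapping.lookup p m))" by simp
  moreover have "(\<Sum>m\<in>Poly_Mapping.keys p. Poly_Mapping.single m (Poly_Mapping.lookup p m)) = p"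
    by (intro poly_mapping_eqI) (auto simp: lookup_sum lookup_single when_def in_keys_iff)
  ultimately show ?thesis
    by simp
qed

lemma poly_eval_mult [simp]: "poly_eval z (p * q) = poly_eval z p * poly_eval z q"
proof (induction p rule: poly_mapping_single_induct)
  case (single m a)
  show ?case
    by (induction q rule: poly_mapping_single_induct)
       (auto simp: mult_single mono_eval_add algebra_simps)
qed (auto simp: algebra_simps)

lemma polys_in_0 [simp]: "0 \<in> polys_in V"
  by (auto simp: polys_in_def)

lemma polys_in_add: "p \<in> polys_in V \<Longrightarrow> q \<in> polys_in V \<Longrightarrow> p + q \<in> polys_in V"
  using keys_add[of p q] by (force simp: polys_in_def)

lemma polys_in_mult: "p \<in> polys_in V \<Longrightarrow> q \<in> polys_in V \<Longrightarrow> p * q \<in> polys_in V"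
proof -
  assume p: "p \<in> polys_in V" and q: "q \<in> polys_in V"
  show ?thesis
    unfolding polys_in_def
  proof (intro CollectI ballI)
    fix m assume "m \<in> Poly_Mapping.keys (p * q)"
    then obtain a b where "m = a + b" "a \<in> Poly_Mapping.keys p" "b \<in> Poly_Mapping.keys q"
      using keys_mult[of p q] by auto
    then show "Poly_Mapping.keys m \<subseteq> V"
      using p q keys_add[of a b] by (force simp: polys_in_def)
  qed
qed

lemma polys_in_const [simp]: "poly_const a \<in> polys_in V"
  by (auto simp: polys_in_def poly_const_def)

lemma polys_in_1 [simp]: "1 \<in> polys_in V"
  by (auto simp: polys_in_def)

lemma polys_in_var [simp]: "v \<in> V \<Longrightarrow> poly_var v \<in> polys_in V"
  by (auto simp: polys_in_def poly_var_def)

lemma polys_in_minus: "p \<in> polys_in V \<Longrightarrow> - p \<in> polys_in V"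
  by (auto simp: polys_in_def)

lemma poly_eval_cong:
  assumes "p \<in> polys_in V" "\<And>v. v \<in> V \<Longrightarrow> z v = z' v"
  shows "poly_eval z p = poly_eval z' p"
  unfolding poly_eval_def
proof (intro sum.cong refl arg_cong2[of _ _ _ _ "(*)"] prod.cong)
  fix m v assume "m \<in> Poly_Mapping.keys p" "v \<in> Poly_Mapping.keys m"
  then have "v \<in> V" using assms(1) by (auto simp: polys_in_def)
  then show "z v ^ Poly_Mapping.lookup m v = z' v ^ Poly_Mapping.lookup m v"
    using assms(2) by simp
qed

text \<open>Closure properties of this predicate supply the polynomials demanded by Zariski open
  sets, so that determinants never have to be written out as elements of
  \<open>cpoly\<close>.\<close>

definition polyfun :: "'v set \<Rightarrow> (('v \<Rightarrow> complex) \<Rightarrow> complex) \<Rightarrow> bool" where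
  "polyfun V f \<longleftrightarrow> (\<exists>p \<in> polys_in V. \<forall>z. poly_eval z p = f z)"

lemma polyfun_const: "polyfun V (\<lambda>_. a)"
  unfolding polyfun_def by (rule bexI[of _ "poly_const a"]) auto

lemma polyfun_var: "v \<in> V \<Longrightarrow> polyfun V (\<lambda>z. z v)"
  unfolding polyfun_def by (rule bexI[of _ "poly_var v"]) auto

lemma polyfun_add: "polyfun V f \<Longrightarrow> polyfun V g \<Longrightarrow> polyfun V (\<lambda>z. f z + g z)"
  unfolding polyfun_def by (metis poly_eval_add polys_in_add)

lemma polyfun_mult: "polyfun V f \<Longrightarrow> polyfun V g \<Longrightarrow> polyfun V (\<lambda>z. f z * g z)"
  unfolding polyfun_def by (metis poly_eval_mult polys_in_mult)

lemma polyfun_sum: "(\<And>i. i \<in> I \<Longrightarrow> polyfun V (f i)) \<Longrightarrow> polyfun V (\<lambda>z. \<Sum>i\<in>I. f i z)"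
  by (induction I rule: infinite_finite_induct) (auto intro: polyfun_const polyfun_add)

lemma polyfun_prod: "(\<And>i. i \<in> I \<Longrightarrow> polyfun V (f i)) \<Longrightarrow> polyfun V (\<lambda>z. \<Prod>i\<in>I. f i z)"
  by (induction I rule: infinite_finite_induct) (auto intro: polyfun_const polyfun_mult)

lemma polyfun_power: "polyfun V f \<Longrightarrow> polyfun V (\<lambda>z. f z ^ n)"
  by (induction n) (auto intro: polyfun_const polyfun_mult)

lemma polyfun_subst:
  assumes "p \<in> polys_in V" "\<And>v. v \<in> V \<Longrightarrow> polyfun W (\<lambda>z. g z v)"
  shows "polyfun W (\<lambda>z. poly_eval (g z) p)"
  unfolding poly_eval_def using assms
  by (intro polyfun_sum polyfun_mult polyfun_const polyfun_prod polyfun_power)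
     (auto simp: polys_in_def)

lemma polyfun_det:
  fixes F :: "('v \<Rightarrow> complex) \<Rightarrow> complex^'n^'n"
  assumes "\<And>i j. polyfun V (\<lambda>z. F z $ i $ j)"
  shows "polyfun V (\<lambda>z. det (F z))"
  unfolding det_def
  by (intro polyfun_sum polyfun_mult polyfun_const polyfun_prod assms)

section \<open>Generic points\<close>

text \<open>
  Induction on the set of variables: as a polynomial in a single variable, the sum has
  coefficients of the same shape in the remaining variables.
\<close>

lemma monomials_independent:
  fixes c :: "('v \<Rightarrow> nat) \<Rightarrow> complex"
  assumes "finite V" "finite M" "inj_on (\<lambda>m. restrict m V) M"
    and "\<And>z. (\<Sum>m\<in>M. c m * (\<Prod>v\<in>V. z v ^ m v)) = 0"
    and "m \<in> M"
  shows "c m = 0"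
  using assms
proof (induction V arbitrary: M m rule: finite_induct)
  case empty
  then have "M = {m}"
    by (auto simp: inj_on_def)
  with empty(3)[of undefined] show ?case by simp
next
  case (insert x V)
  define k where "k = m x"
  define Mk where "Mk = (\<lambda>k. {m \<in> M. m x = k})"
  have fin: "finite (Mk k)" for k
    using insert by (auto simp: Mk_def)
  have inj: "inj_on (\<lambda>m. restrict m V) (Mk k)"
  proof (rule inj_onI)
    fix m m' assume *: "m \<in> Mk k" "m' \<in> Mk k" "restrict m V = restrict m' V"
    then have "restrict m (insert x V) = restrict m' (insert x V)"
      unfolding Mk_def restrict_def fun_eq_iff by (metis (mono_tags, lifting) insert_iff mem_Collect_eq)
    then show "m = m'"
      using * inj_onD[OF insert.prems(2), of m m'] by (auto simp: Mk_def)
  qed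
  have zero: "(\<Sum>m\<in>Mk k. c m * (\<Prod>v\<in>V. z v ^ m v)) = 0" for z
  proof -
    define a where "a = (\<lambda>k. \<Sum>m\<in>Mk k. c m * (\<Prod>v\<in>V. z v ^ m v))"
    define p where "p = (\<Sum>k\<in>(\<lambda>m. m x) ` M. monom (a k) k)"
    have "poly p t = 0" for t
    proof -
      have "poly p t = (\<Sum>k\<in>(\<lambda>m. m x) ` M. \<Sum>m\<in>{m\<in>M. m x = k}. c m * (\<Prod>v\<in>V. z v ^ m v) * t ^ m x)"
        by (auto simp: p_def poly_sum poly_monom a_def Mk_def sum_distrib_right intro!: sum.cong)
      also have "\<dots> = (\<Sum>m\<in>M. c m * (\<Prod>v\<in>V. z v ^ m v) * t ^ m x)"
        using insert by (subst sum.image_gen[of M _ "\<lambda>m. m x"]) auto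
      also have "\<dots> = (\<Sum>m\<in>M. c m * (\<Prod>v\<in>insert x V. (z(x := t)) v ^ m v))"
      proof (intro sum.cong refl)
        fix m
        have "(\<Prod>v\<in>V. z v ^ m v) = (\<Prod>v\<in>V. (z(x := t)) v ^ m v)"
          using insert.hyps by (intro prod.cong) auto
        then show "c m * (\<Prod>v\<in>V. z v ^ m v) * t ^ m x =
            c m * (\<Prod>v\<in>insert x V. (z(x := t)) v ^ m v)"
          using insert.hyps by (simp add: algebra_simps)
      qed
      finally show ?thesis using insert.prems(3) by simp
    qed
    then have "p = 0"
      using poly_all_0_iff_0 by blast
    moreover have "coeff p k = a k"
      using insert.prems unfolding p_def k_def coeff_sum
      by (subst sum.remove[of _ "m x"]) (auto intro!: sum.neutral)
    ultimately show ?thesis by (simp add: a_def)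
  qed
  have "m \<in> Mk k"
    using insert.prems by (simp add: Mk_def k_def)
  from insert.IH[OF fin inj zero this] show ?case .
qed

text \<open>Reduction to \<open>monomials_independent\<close>: exponents outside the finite set
  \<open>V\<close> of occurring variables are 0, so distinct monomials stay distinct after
  restriction to \<open>V\<close>.\<close>

lemma poly_nonvanishing_point:
  assumes "(p :: 'v cpoly) \<noteq> 0"
  shows "\<exists>z. poly_eval z p \<noteq> 0"
proof (rule ccontr)
  assume *: "\<not> ?thesis"
  define V where "V = (\<Union>m\<in>Poly_Mapping.keys p. Poly_Mapping.keys m)"
  define M where "M = Poly_Mapping.lookup ` Poly_Mapping.keys p"
  define c where "c = (\<lambda>m. Poly_Mapping.lookup p (Abs_poly_mapping m))"
  have V: "finite V" by (auto simp: V_def)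
  have inj: "inj_on (\<lambda>m. restrict m V) M"
  proof (rule inj_onI)
    fix m m' assume "m \<in> M" "m' \<in> M" and eq: "restrict m V = restrict m' V"
    then obtain a b where ab: "a \<in> Poly_Mapping.keys p" "b \<in> Poly_Mapping.keys p"
      "m = Poly_Mapping.lookup a" "m' = Poly_Mapping.lookup b"
      by (auto simp: M_def)
    have "m v = m' v" for v
    proof (cases "v \<in> V")
      case True then show ?thesis using fun_cong[OF eq, of v] by simp
    next
      case False
      then have "v \<notin> Poly_Mapping.keys a" "v \<notin> Poly_Mapping.keys b"
        using ab by (auto simp: V_def)
      then show ?thesis using ab by (simp add: in_keys_iff)
    qed
    then show "m = m'" by auto
  qed
  obtain m where m: "m \<in> Poly_Mapping.keys p"
    using assms by (metis all_not_in_conv keys_eq_empty)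
  have zero: "(\<Sum>m\<in>M. c m * (\<Prod>v\<in>V. z v ^ m v)) = 0" for z
  proof -
    have "inj_on Poly_Mapping.lookup (Poly_Mapping.keys p)"
      by (auto intro!: inj_onI poly_mapping_eqI)
    then have "(\<Sum>m\<in>M. c m * (\<Prod>v\<in>V. z v ^ m v)) =
        (\<Sum>m\<in>Poly_Mapping.keys p. Poly_Mapping.lookup p m * (\<Prod>v\<in>V. z v ^ Poly_Mapping.lookup m v))"
      unfolding M_def by (subst sum.reindex) (auto simp: c_def lookup_inverse)
    also have "\<dots> = (\<Sum>m\<in>Poly_Mapping.keys p. Poly_Mapping.lookup p m * mono_eval z m)"
      using V by (intro sum.cong refl) (subst mono_eval_superset[of V], auto simp: V_def)
    also have "\<dots> = poly_eval z p"
      by (simp add: poly_eval_def mono_eval_def)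
    finally show ?thesis using * by auto
  qed
  have "finite M" by (auto simp: M_def)
  from monomials_independent[OF V this inj zero, of "Poly_Mapping.lookup m"] m
  have "c (Poly_Mapping.lookup m) = 0" by (auto simp: M_def)
  with m show False by (simp add: c_def in_keys_iff lookup_inverse)
qed

lemma poly_eval_univariate: "\<exists>r :: complex poly. \<forall>t. poly r t = poly_eval (z(v := t)) p"
proof (intro exI allI)
  fix t
  show "poly (\<Sum>m\<in>Poly_Mapping.keys p. smult (Poly_Mapping.lookup p m)
      (\<Prod>u\<in>Poly_Mapping.keys m. (if u = v then [:0, 1:] else [:z u:]) ^ Poly_Mapping.lookup m u)) t =
    poly_eval (z(v := t)) p"
    unfolding poly_eval_def poly_sum poly_smult poly_prod poly_power
    by (intro sum.cong prod.cong arg_cong2[of _ _ _ _ "(*)"] refl) auto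
qed

lemma generic_point:
  fixes Q :: "nat cpoly set"
  assumes "countable Q" "0 \<notin> Q" "Q \<subseteq> polys_in {..<l}"
  shows "\<exists>\<mu> \<in> {..<l} \<rightarrow>\<^sub>E UNIV. \<forall>q\<in>Q. poly_eval \<mu> q \<noteq> 0"
proof -
  \<comment> \<open>The coordinates are chosen one at a time, keeping every polynomial of the family nonzero
    as a function of the remaining ones.\<close>
  have "\<exists>\<mu>. \<forall>q\<in>Q. \<exists>z. (\<forall>i<k. z i = \<mu> i) \<and> poly_eval z q \<noteq> 0" for k
  proof (induction k)
    case 0
    then show ?case using poly_nonvanishing_point assms by (metis less_nat_zero_code)
  next
    case (Suc k)
    then obtain \<mu> where \<mu>: "\<forall>q\<in>Q. \<exists>z. (\<forall>i<k. z i = \<mu> i) \<and> poly_eval z q \<noteq> 0" by auto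
    then obtain Z where Z: "\<And>q. q \<in> Q \<Longrightarrow> (\<forall>i<k. Z q i = \<mu> i) \<and> poly_eval (Z q) q \<noteq> 0" by metis
    define B where "B = (\<Union>q\<in>Q. {t. poly_eval ((Z q)(k := t)) q = 0})"
    have "finite {t. poly_eval ((Z q)(k := t)) q = 0}" if q: "q \<in> Q" for q
    proof -
      obtain r where r: "\<And>t. poly r t = poly_eval ((Z q)(k := t)) q"
        using poly_eval_univariate by metis
      \<comment> \<open>At t = \<open>Z q k\<close> the update changes nothing, so the old witness
        shows that this univariate polynomial is nonzero and excludes only finitely many values of
        t.\<close>
      from r[of "Z q k"] Z[OF q] have "r \<noteq> 0" by auto
      from poly_roots_finite[OF this] r show ?thesis by simp
    qed
    then have "countable B"
      unfolding B_def using assms(1) by (auto intro: countable_finite)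
    then have "B \<noteq> UNIV"
      using uncountable_UNIV_complex by auto
    then obtain t where t: "t \<notin> B" by auto
    have "\<forall>q\<in>Q. \<exists>z. (\<forall>i<Suc k. z i = (\<mu>(k := t)) i) \<and> poly_eval z q \<noteq> 0"
    proof
      fix q assume q: "q \<in> Q"
      show "\<exists>z. (\<forall>i<Suc k. z i = (\<mu>(k := t)) i) \<and> poly_eval z q \<noteq> 0"
        using Z[OF q] t q by (intro exI[of _ "(Z q)(k := t)"]) (auto simp: B_def less_Suc_eq)
    qed
    then show ?case by (rule exI[where x = "\<mu>(k := t)"])
  qed
  from this[of l] obtain \<mu> where \<mu>: "\<forall>q\<in>Q. \<exists>z. (\<forall>i<l. z i = \<mu> i) \<and> poly_eval z q \<noteq> 0" by auto
  show ?thesis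
  proof (intro bexI[of _ "restrict \<mu> {..<l}"] ballI)
    fix q assume q: "q \<in> Q"
    with \<mu> obtain z where z: "\<forall>i<l. z i = \<mu> i" "poly_eval z q \<noteq> 0" by auto
    have "poly_eval z q = poly_eval (restrict \<mu> {..<l}) q"
      using z q assms by (intro poly_eval_cong[of _ "{..<l}"]) auto
    with z show "poly_eval (restrict \<mu> {..<l}) q \<noteq> 0" by simp
  qed auto
qed

section \<open>Evaluation of rational functions\<close>

text \<open>Relational evaluation: it records definedness and value together and composes under
  field operations, whereas \<open>ratfun_eval\<close> is a \<open>THE\<close> that means nothing
  where the function is undefined.\<close>

definition ratval :: "(nat \<Rightarrow> complex) \<Rightarrow> ratfun \<Rightarrow> complex \<Rightarrow> bool" where
  "ratval z f w \<longleftrightarrow> (\<exists>p q. f = Fract p q \<and> poly_eval z q \<noteq> 0 \<and> w = poly_eval z p / poly_eval z q)"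

lemma ratvalI: "poly_eval z q \<noteq> 0 \<Longrightarrow> ratval z (Fract p q) (poly_eval z p / poly_eval z q)"
  by (auto simp: ratval_def)

lemma ratvalE:
  assumes "ratval z f w"
  obtains p q where "f = Fract p q" "q \<noteq> 0" "poly_eval z q \<noteq> 0" "w = poly_eval z p / poly_eval z q"
  using assms unfolding ratval_def by (metis poly_eval_0)

lemma ratval_unique:
  assumes "ratval z f w" "ratval z f w'"
  shows "w = w'"
proof -
  obtain p q where pq: "f = Fract p q" "q \<noteq> 0" "poly_eval z q \<noteq> 0" "w = poly_eval z p / poly_eval z q"
    using assms(1) by (rule ratvalE)
  obtain p' q' where pq': "f = Fract p' q'" "q' \<noteq> 0" "poly_eval z q' \<noteq> 0" "w' = poly_eval z p' / poly_eval z q'"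
    using assms(2) by (rule ratvalE)
  then have "p * q' = p' * q" using pq by (simp add: eq_fract)
  then have "poly_eval z (p * q') = poly_eval z (p' * q)" by simp
  with pq pq' show ?thesis by (simp add: frac_eq_eq)
qed

lemma ratfun_eval_eqI: "ratval z f w \<Longrightarrow> ratfun_eval f z = w"
  unfolding ratfun_eval_def ratval_def[symmetric]
  using ratval_unique by blast

lemma ratfun_defined_at_iff: "ratfun_defined_at f z \<longleftrightarrow> (\<exists>w. ratval z f w)"
  by (auto simp: ratfun_defined_at_def ratval_def)

lemma ratval_eval: "ratfun_defined_at f z \<Longrightarrow> ratval z f (ratfun_eval f z)"
  using ratfun_defined_at_iff ratfun_eval_eqI by metis

lemma ratval_poly: "ratval z (to_fract p) (poly_eval z p)"
  using ratvalI[of z 1 p] by (simp add: to_fract_def)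

lemma ratval_const: "ratval z (to_fract (poly_const a)) a"
  using ratval_poly[of z "poly_const a"] by simp

lemma ratval_par: "ratval z (par k) (z k)"
  using ratval_poly[of z "poly_var k"] by (simp add: par_def)

lemma ratval_0: "ratval z 0 0"
  using ratval_poly[of z 0] by simp

lemma ratval_1: "ratval z 1 1"
  using ratval_poly[of z 1] by simp

lemma ratval_add: "ratval z f v \<Longrightarrow> ratval z g w \<Longrightarrow> ratval z (f + g) (v + w)"
  by (elim ratvalE, unfold ratval_def, rule_tac x = "p * qa + pa * q" in exI, rule_tac x = "q * qa" in exI)
     (auto simp: add_frac_eq)

lemma ratval_mult: "ratval z f v \<Longrightarrow> ratval z g w \<Longrightarrow> ratval z (f * g) (v * w)"
  by (elim ratvalE, unfold ratval_def, rule_tac x = "p * pa" in exI, rule_tac x = "q * qa" in exI) auto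

lemma ratval_uminus: "ratval z f v \<Longrightarrow> ratval z (- f) (- v)"
  using ratval_mult[OF ratval_const[of z "-1"], of f v]
  by (simp add: poly_const_def single_uminus to_fract_uminus)

lemma ratval_diff: "ratval z f v \<Longrightarrow> ratval z g w \<Longrightarrow> ratval z (f - g) (v - w)"
  using ratval_add[OF _ ratval_uminus, of z f v g w] by simp

lemma ratval_sum: "(\<And>i. i \<in> I \<Longrightarrow> ratval z (f i) (v i)) \<Longrightarrow> ratval z (sum f I) (sum v I)"
  by (induction I rule: infinite_finite_induct) (auto intro: ratval_0 ratval_add)

lemma ratval_prod: "(\<And>i. i \<in> I \<Longrightarrow> ratval z (f i) (v i)) \<Longrightarrow> ratval z (prod f I) (prod v I)"
  by (induction I rule: infinite_finite_induct) (auto intro: ratval_1 ratval_mult)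

lemma ratval_of_int: "ratval z (of_int k) (of_int k)"
proof (induction k rule: int_induct[of _ 0])
  case (step1 i) then show ?case using ratval_add[OF step1(2) ratval_1] by simp
next
  case (step2 i) then show ?case using ratval_diff[OF step2(2) ratval_1] by simp
qed (simp add: ratval_0)

lemma ratval_det:
  fixes F :: "ratfun^'n^'n"
  assumes "\<And>i j. ratval z (F $ i $ j) (G $ i $ j)"
  shows "ratval z (det F) (det G)"
  unfolding det_def by (intro ratval_sum ratval_mult ratval_of_int ratval_prod assms)

text \<open>The given denominator \<open>q\<close> may vanish at \<open>z\<close>; cross
  multiplication with a fraction that is defined at \<open>z\<close> still settles the matter. Hence
  a numerator alone can serve as the polynomial of a Zariski open condition.\<close>

lemma ratval_Fract_nonzero:
  assumes f: "f = Fract p q" "q \<noteq> 0" "poly_eval z p \<noteq> 0" "ratval z f w"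
  shows "w \<noteq> 0"
proof
  assume "w = 0"
  with f(4) obtain p' q' where *: "f = Fract p' q'" "poly_eval z q' \<noteq> 0" "poly_eval z p' = 0"
    by (auto simp: ratval_def)
  then have "q' \<noteq> 0" by auto
  with * f have "p * q' = p' * q" by (simp add: eq_fract)
  then have "poly_eval z (p * q') = poly_eval z (p' * q)" by simp
  with * f show False by simp
qed

lemma ratfunsE:
  assumes "f \<in> ratfuns l"
  obtains p q where "f = Fract p q" "p \<in> polys_in {..<l}" "q \<in> polys_in {..<l}" "q \<noteq> 0"
  using assms by (auto simp: ratfuns_def)

lemma ratfuns_poly: "p \<in> polys_in {..<l} \<Longrightarrow> to_fract p \<in> ratfuns l"
  unfolding ratfuns_def to_fract_def by force

lemma ratfuns_const: "to_fract (poly_const a) \<in> ratfuns l"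
  by (rule ratfuns_poly) auto

lemma ratfuns_par: "k < l \<Longrightarrow> par k \<in> ratfuns l"
  unfolding par_def by (rule ratfuns_poly) auto

lemma is_subfield_ratfuns: "is_subfield (ratfuns l)"
  unfolding is_subfield_def
proof (intro conjI ballI)
  show "0 \<in> ratfuns l" "1 \<in> ratfuns l" using ratfuns_poly[of 0 l] ratfuns_poly[of 1 l] by simp_all
  fix x assume x: "x \<in> ratfuns l"
  then obtain p q where pq: "x = Fract p q" "p \<in> polys_in {..<l}" "q \<in> polys_in {..<l}" "q \<noteq> 0"
    by (rule ratfunsE)
  then show "- x \<in> ratfuns l"
    unfolding ratfuns_def using polys_in_minus[of p] by (intro CollectI exI[of _ "- p"] exI[of _ q]) auto
  show "inverse x \<in> ratfuns l"
  proof (cases "p = 0")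
    case True
    then have "inverse x = 0" using pq by (simp add: fract_collapse)
    then show ?thesis using \<open>0 \<in> ratfuns l\<close> by simp
  next
    case False
    then show ?thesis using pq by (auto simp: ratfuns_def)
  qed
  fix y assume "y \<in> ratfuns l"
  then obtain p' q' where pq': "y = Fract p' q'" "p' \<in> polys_in {..<l}" "q' \<in> polys_in {..<l}" "q' \<noteq> 0"
    by (rule ratfunsE)
  show "x + y \<in> ratfuns l"
    unfolding ratfuns_def using pq pq'
    by (intro CollectI exI[of _ "p * q' + p' * q"] exI[of _ "q * q'"])
       (auto intro: polys_in_add polys_in_mult)
  show "x * y \<in> ratfuns l"
    unfolding ratfuns_def using pq pq'
    by (intro CollectI exI[of _ "p * p'"] exI[of _ "q * q'"]) (auto intro: polys_in_mult)
qed

section \<open>Subfields\<close>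

lemma is_subfieldD:
  assumes "is_subfield K"
  shows subfield_0: "0 \<in> K" and subfield_1: "1 \<in> K"
    and subfield_add: "x \<in> K \<Longrightarrow> y \<in> K \<Longrightarrow> x + y \<in> K"
    and subfield_mult: "x \<in> K \<Longrightarrow> y \<in> K \<Longrightarrow> x * y \<in> K"
    and subfield_uminus: "x \<in> K \<Longrightarrow> - x \<in> K"
    and subfield_inverse: "x \<in> K \<Longrightarrow> inverse x \<in> K"
  using assms by (auto simp: is_subfield_def)

lemma subfield_diff: "is_subfield K \<Longrightarrow> x \<in> K \<Longrightarrow> y \<in> K \<Longrightarrow> x - y \<in> K"
  using subfield_add[of K x "- y"] subfield_uminus[of K y] by simp

lemma subfield_divide: "is_subfield K \<Longrightarrow> x \<in> K \<Longrightarrow> y \<in> K \<Longrightarrow> x / y \<in> K"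
  using subfield_mult[of K x "inverse y"] subfield_inverse[of K y] by (simp add: divide_inverse)

lemma subfield_sum: "is_subfield K \<Longrightarrow> (\<And>i. i \<in> I \<Longrightarrow> f i \<in> K) \<Longrightarrow> sum f I \<in> K"
  by (induction I rule: infinite_finite_induct) (auto intro: subfield_0 subfield_add)

lemma subfield_prod: "is_subfield K \<Longrightarrow> (\<And>i. i \<in> I \<Longrightarrow> f i \<in> K) \<Longrightarrow> prod f I \<in> K"
  by (induction I rule: infinite_finite_induct) (auto intro: subfield_1 subfield_mult)

lemma subfield_power: "is_subfield K \<Longrightarrow> x \<in> K \<Longrightarrow> x ^ n \<in> K"
  by (induction n) (auto intro: subfield_1 subfield_mult)

lemma subfield_of_int: "is_subfield K \<Longrightarrow> of_int k \<in> K"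
  by (induction k rule: int_induct[of _ 0]) (auto intro: subfield_0 subfield_1 subfield_add subfield_diff)

lemma is_subfield_hull: "is_subfield (is_subfield hull S)"
proof (rule hull_in)
  fix T :: "'a set set" assume "Ball T is_subfield"
  then show "is_subfield (\<Inter>T)"
    by (auto simp: is_subfield_def)
qed

text \<open>Countably many rounds of closing under the field operations, each preserving
  countability, already reach a subfield.\<close>

lemma countable_subfield_hull:
  fixes S :: "'a :: field set"
  assumes "countable S"
  shows "countable (is_subfield hull S)"
proof -
  define step where "step = (\<lambda>X :: 'a set. X \<union> (\<lambda>(x, y). x + y) ` (X \<times> X) \<union> (\<lambda>(x, y). x * y) ` (X \<times> X)
      \<union> uminus ` X \<union> inverse ` X)"
  define L where "L = (\<lambda>n. (step ^^ n) (S \<union> {0, 1}))"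
  have countable: "countable (L n)" for n
  proof (induction n)
    case 0 then show ?case using assms by (simp add: L_def)
  next
    case (Suc n)
    then have "countable (step (L n))" unfolding step_def by auto
    then show ?case by (simp add: L_def)
  qed
  have Suc: "L (Suc n) = step (L n)" for n by (simp add: L_def)
  have "L n \<subseteq> L (Suc n)" for n unfolding Suc step_def by auto
  then have mono: "L m \<subseteq> L n" if "m \<le> n" for m n
    using that lift_Suc_mono_le by blast
  have "is_subfield (\<Union>n. L n)"
    unfolding is_subfield_def
  proof (intro conjI ballI)
    show "0 \<in> (\<Union>n. L n)" "1 \<in> (\<Union>n. L n)" by (auto simp: L_def intro: exI[of _ 0])
    fix x assume "x \<in> (\<Union>n. L n)"
    then obtain n where n: "x \<in> L n" by auto
    then have "- x \<in> L (Suc n)" "inverse x \<in> L (Suc n)" unfolding Suc step_def by auto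
    then show "- x \<in> (\<Union>n. L n)" "inverse x \<in> (\<Union>n. L n)" by blast+
    fix y assume "y \<in> (\<Union>n. L n)"
    then obtain m where m: "y \<in> L m" by auto
    have xy: "x \<in> L (max m n)" "y \<in> L (max m n)"
      using n m mono[of n "max m n"] mono[of m "max m n"] by auto
    have "x + y \<in> L (Suc (max m n))" unfolding Suc step_def using xy by force
    moreover have "x * y \<in> L (Suc (max m n))" unfolding Suc step_def using xy by force
    ultimately show "x + y \<in> (\<Union>n. L n)" "x * y \<in> (\<Union>n. L n)" by blast+
  qed
  moreover have "S \<subseteq> L 0" by (auto simp: L_def)
  then have "S \<subseteq> (\<Union>n. L n)" by blast
  ultimately have "is_subfield hull S \<subseteq> (\<Union>n. L n)" by (intro hull_minimal)
  moreover have "countable (\<Union>n. L n)" using countable by auto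
  ultimately show ?thesis by (rule countable_subset)
qed

text \<open>Expresses a polynomial through constants and parameters, the elements on which subfields
  and embeddings are controlled.\<close>

lemma to_fract_expansion:
  "to_fract p = (\<Sum>m\<in>Poly_Mapping.keys p. to_fract (poly_const (Poly_Mapping.lookup p m))
      * (\<Prod>v\<in>Poly_Mapping.keys m. par v ^ Poly_Mapping.lookup m v))"
proof -
  have var: "to_fract (Poly_Mapping.single m 1) = (\<Prod>v\<in>Poly_Mapping.keys m. par v ^ Poly_Mapping.lookup m v)" for m
  proof -
    have "Poly_Mapping.single (Poly_Mapping.single v k) 1 = poly_var v ^ k" for v k
    proof (induction k)
      case (Suc k)
      have "Poly_Mapping.single v (Suc k) = Poly_Mapping.single v 1 + Poly_Mapping.single v k"
        by (simp flip: single_add)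
      then have "Poly_Mapping.single (Poly_Mapping.single v (Suc k)) 1 =
          poly_var v * Poly_Mapping.single (Poly_Mapping.single v k) 1"
        by (simp add: poly_var_def mult_single)
      then show ?case by (simp add: Suc)
    qed simp
    note pow = this
    have "Poly_Mapping.single (\<Sum>v\<in>V. Poly_Mapping.single v (Poly_Mapping.lookup m v)) 1 =
        (\<Prod>v\<in>V. poly_var v ^ Poly_Mapping.lookup m v)" if "finite V" for V
      using that
    proof (induction V rule: finite_induct)
      case (insert v V)
      have "Poly_Mapping.single (\<Sum>v\<in>insert v V. Poly_Mapping.single v (Poly_Mapping.lookup m v)) 1 =
          Poly_Mapping.single (Poly_Mapping.single v (Poly_Mapping.lookup m v)) 1 *
          Poly_Mapping.single (\<Sum>v\<in>V. Poly_Mapping.single v (Poly_Mapping.lookup m v)) (1 :: complex)"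
        using insert.hyps by (simp add: mult_single)
      then show ?case using insert by (simp add: pow)
    qed simp
    from this[of "Poly_Mapping.keys m"]
    have "Poly_Mapping.single (\<Sum>v\<in>Poly_Mapping.keys m. Poly_Mapping.single v (Poly_Mapping.lookup m v)) 1 =
        (\<Prod>v\<in>Poly_Mapping.keys m. poly_var v ^ Poly_Mapping.lookup m v)" by simp
    moreover have "(\<Sum>v\<in>Poly_Mapping.keys m. Poly_Mapping.single v (Poly_Mapping.lookup m v)) = m"
      by (intro poly_mapping_eqI) (auto simp: lookup_sum lookup_single when_def in_keys_iff)
    moreover have "to_fract (\<Prod>v\<in>V. poly_var v ^ Poly_Mapping.lookup m v) =
        (\<Prod>v\<in>V. par v ^ Poly_Mapping.lookup m v)" for V
    proof (induction V rule: infinite_finite_induct)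
      case (insert v V)
      have "to_fract (poly_var v ^ k) = par v ^ k" for k
        by (induction k) (auto simp: par_def)
      with insert show ?case by simp
    qed auto
    ultimately show ?thesis by simp
  qed
  have "p = (\<Sum>m\<in>Poly_Mapping.keys p. poly_const (Poly_Mapping.lookup p m) * Poly_Mapping.single m 1)"
    by (intro poly_mapping_eqI)
       (auto simp: poly_const_def mult_single lookup_sum lookup_single when_def in_keys_iff)
  moreover have "to_fract (\<Sum>m\<in>M. poly_const (Poly_Mapping.lookup p m) * Poly_Mapping.single m 1) =
    (\<Sum>m\<in>M. to_fract (poly_const (Poly_Mapping.lookup p m)) * (\<Prod>v\<in>Poly_Mapping.keys m. par v ^ Poly_Mapping.lookup m v))" for M
    by (induction M rule: infinite_finite_induct) (auto simp: var)
  ultimately show ?thesis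
    by metis
qed

lemma poly_in_subfield:
  assumes K: "is_subfield K"
    and "\<And>m. m \<in> Poly_Mapping.keys p \<Longrightarrow> to_fract (poly_const (Poly_Mapping.lookup p m)) \<in> K"
    and "\<And>k. k < l \<Longrightarrow> par k \<in> K" and "p \<in> polys_in {..<l}"
  shows "to_fract p \<in> K"
  unfolding to_fract_expansion[of p] using assms
  by (intro subfield_sum[OF K] subfield_mult[OF K] subfield_prod[OF K] subfield_power[OF K])
     (auto simp: polys_in_def)

section \<open>Extending embeddings of countable fields into the complex numbers\<close>

definition poly_over :: "'a :: field set \<Rightarrow> 'a poly set" where
  "poly_over L = {p. \<forall>k. coeff p k \<in> L}"

text \<open>A total function of which only the values on \<open>L\<close> matter. Injectivity on
  \<open>L\<close> is automatic for a field, see \<open>emb_eq_0\<close>. Constants in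
  \<open>L\<close> need not be fixed.\<close>

definition embedding_on :: "'a :: field set \<Rightarrow> ('a \<Rightarrow> complex) \<Rightarrow> bool" where
  "embedding_on L \<tau> \<longleftrightarrow> is_subfield L \<and> \<tau> 0 = 0 \<and> \<tau> 1 = 1 \<and>
     (\<forall>x\<in>L. \<forall>y\<in>L. \<tau> (x + y) = \<tau> x + \<tau> y \<and> \<tau> (x * y) = \<tau> x * \<tau> y)"

lemma poly_over_add: "is_subfield L \<Longrightarrow> p \<in> poly_over L \<Longrightarrow> q \<in> poly_over L \<Longrightarrow> p + q \<in> poly_over L"
  by (auto simp: poly_over_def intro: subfield_add)

lemma poly_over_uminus: "is_subfield L \<Longrightarrow> p \<in> poly_over L \<Longrightarrow> - p \<in> poly_over L"
  by (auto simp: poly_over_def intro: subfield_uminus)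

lemma poly_over_mult: "is_subfield L \<Longrightarrow> p \<in> poly_over L \<Longrightarrow> q \<in> poly_over L \<Longrightarrow> p * q \<in> poly_over L"
  by (auto simp: poly_over_def coeff_mult intro!: subfield_sum subfield_mult)

lemma poly_over_0: "is_subfield L \<Longrightarrow> 0 \<in> poly_over L"
  by (auto simp: poly_over_def intro: subfield_0)

lemma poly_over_pCons: "a \<in> L \<Longrightarrow> p \<in> poly_over L \<Longrightarrow> pCons a p \<in> poly_over L"
  by (auto simp: poly_over_def coeff_pCons split: nat.splits)

lemma poly_over_monom: "is_subfield L \<Longrightarrow> a \<in> L \<Longrightarrow> monom a n \<in> poly_over L"
  by (auto simp: poly_over_def intro: subfield_0)

lemma poly_over_const: "is_subfield L \<Longrightarrow> a \<in> L \<Longrightarrow> [:a:] \<in> poly_over L"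
  by (intro poly_over_pCons poly_over_0)

lemma poly_in_poly_over: "is_subfield L \<Longrightarrow> p \<in> poly_over L \<Longrightarrow> x \<in> L \<Longrightarrow> poly p x \<in> L"
  unfolding poly_altdef
  by (intro subfield_sum subfield_mult subfield_power) (auto simp: poly_over_def)

lemma countable_poly_over:
  assumes "countable L"
  shows "countable (poly_over L)"
proof (rule countable_subset)
  show "poly_over L \<subseteq> Poly ` lists L"
  proof
    fix p assume "p \<in> poly_over L"
    then have "coeffs p \<in> lists L" by (auto simp: poly_over_def coeffs_def split: if_splits)
    then show "p \<in> Poly ` lists L" using Poly_coeffs[of p] by (metis image_eqI)
  qed
  show "countable (Poly ` lists L)" using assms by auto
qed

text \<open>Long division by cancelling leading terms; what matters is that quotient and remainder
  keep their coefficients in \<open>L\<close>, so that an embedding of \<open>L\<close> can be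
  applied to them.\<close>

lemma poly_over_division:
  assumes L: "is_subfield L" and q: "q \<in> poly_over L" "q \<noteq> 0"
  shows "p \<in> poly_over L \<Longrightarrow> \<exists>s \<in> poly_over L. \<exists>r \<in> poly_over L. p = q * s + r \<and> (r = 0 \<or> degree r < degree q)"
proof -
  have "\<exists>s \<in> poly_over L. \<exists>r \<in> poly_over L. p = q * s + r \<and> (r = 0 \<or> degree r < degree q)"
    if "p \<in> poly_over L" "p = 0 \<or> degree p < m" for p m
    using that
  proof (induction m arbitrary: p)
    case 0
    then show ?case using poly_over_0[OF L] by (intro bexI[of _ 0]) auto
  next
    case (Suc m)
    show ?case
    proof (cases "p = 0 \<or> degree p < degree q")
      case True
      then show ?thesis using Suc.prems poly_over_0[OF L] by (intro bexI[of _ 0] bexI[of _ p]) auto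
    next
      case False
      define c where "c = lead_coeff p / lead_coeff q"
      define u where "u = monom c (degree p - degree q)"
      have c: "c \<in> L" "c \<noteq> 0"
        using Suc.prems(1) q False by (auto simp: c_def poly_over_def intro: subfield_divide[OF L])
      have u: "u \<in> poly_over L" unfolding u_def by (intro poly_over_monom L c)
      define p' where "p' = p - q * u"
      have p': "p' \<in> poly_over L"
        using Suc.prems(1) poly_over_add[OF L _ poly_over_uminus[OF L poly_over_mult[OF L q(1) u]], of p]
        by (simp add: p'_def)
      have "degree u = degree p - degree q" using c by (simp add: u_def degree_monom_eq)
      then have "degree (q * u) = degree p"
        using c False q by (subst degree_mult_eq) (auto simp: u_def)
      moreover have "coeff (q * u) (degree p) = lead_coeff p"
      proof -
        have "coeff (q * u) (degree q + degree u) = lead_coeff q * lead_coeff u"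
          by (rule coeff_mult_degree_sum)
        then show ?thesis using \<open>degree u = _\<close> False q c by (simp add: c_def u_def degree_monom_eq)
      qed
      ultimately have "coeff p' (degree p) = 0" "degree p' \<le> degree p"
        unfolding p'_def using degree_diff_le[of p "degree p" "q * u"] by auto
      then have "p' = 0 \<or> degree p' < degree p"
        by (metis le_neq_implies_less leading_coeff_0_iff)
      then have "p' = 0 \<or> degree p' < m" using Suc.prems(2) False by auto
      from Suc.IH[OF p' this] obtain s r where sr: "s \<in> poly_over L" "r \<in> poly_over L"
        "p' = q * s + r" "r = 0 \<or> degree r < degree q" by auto
      then have "p = q * (s + u) + r" by (simp add: p'_def algebra_simps)
      with sr u show ?thesis by (intro bexI[of _ "s + u"] bexI[of _ r] poly_over_add[OF L]) auto
    qed
  qed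
  from this[of p "Suc (degree p)"] show "p \<in> poly_over L \<Longrightarrow> ?thesis" by auto
qed

context
  fixes L :: "'a :: field set" and \<tau> :: "'a \<Rightarrow> complex"
  assumes emb: "embedding_on L \<tau>"
begin

lemma emb_subfield: "is_subfield L"
  using emb by (simp add: embedding_on_def)

lemma emb_0: "\<tau> 0 = 0" and emb_1: "\<tau> 1 = 1"
  using emb by (simp_all add: embedding_on_def)

lemma emb_add: "x \<in> L \<Longrightarrow> y \<in> L \<Longrightarrow> \<tau> (x + y) = \<tau> x + \<tau> y"
  and emb_mult: "x \<in> L \<Longrightarrow> y \<in> L \<Longrightarrow> \<tau> (x * y) = \<tau> x * \<tau> y"
  using emb by (simp_all add: embedding_on_def)

lemma emb_uminus: "x \<in> L \<Longrightarrow> \<tau> (- x) = - \<tau> x"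
  using emb_add[of x "- x"] subfield_uminus[OF emb_subfield] by (simp add: emb_0 eq_neg_iff_add_eq_0 add.commute)

lemma emb_eq_0: "x \<in> L \<Longrightarrow> \<tau> x = 0 \<longleftrightarrow> x = 0"
  using emb_mult[of x "inverse x"] subfield_inverse[OF emb_subfield, of x]
  by (cases "x = 0") (auto simp: emb_0 emb_1)

lemma emb_inverse: "x \<in> L \<Longrightarrow> \<tau> (inverse x) = inverse (\<tau> x)"
  using emb_mult[of x "inverse x"] subfield_inverse[OF emb_subfield, of x]
  by (cases "x = 0") (auto simp: emb_0 emb_1 emb_eq_0 intro!: inverse_unique[symmetric])

lemma emb_sum: "(\<And>i. i \<in> I \<Longrightarrow> f i \<in> L) \<Longrightarrow> \<tau> (sum f I) = (\<Sum>i\<in>I. \<tau> (f i))"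
proof (induction I rule: infinite_finite_induct)
  case (insert i I)
  then show ?case using subfield_sum[OF emb_subfield, of I f] by (simp add: emb_add)
qed (simp_all add: emb_0)

lemma emb_of_nat: "\<tau> (of_nat n) = of_nat n"
proof (induction n)
  case (Suc n)
  have "of_nat n \<in> L" using subfield_of_int[OF emb_subfield, of "int n"] by simp
  with Suc show ?case using subfield_1[OF emb_subfield] by (simp add: emb_add emb_1)
qed (simp add: emb_0)

lemma coeff_emb: "coeff (map_poly \<tau> p) k = \<tau> (coeff p k)"
  by (simp add: coeff_map_poly emb_0)

lemma emb_poly_add: "p \<in> poly_over L \<Longrightarrow> q \<in> poly_over L \<Longrightarrow> map_poly \<tau> (p + q) = map_poly \<tau> p + map_poly \<tau> q"
  by (intro poly_eqI) (auto simp: coeff_emb emb_add poly_over_def)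

lemma emb_poly_uminus: "p \<in> poly_over L \<Longrightarrow> map_poly \<tau> (- p) = - map_poly \<tau> p"
  by (intro poly_eqI) (auto simp: coeff_emb emb_uminus poly_over_def)

lemma emb_poly_mult: "p \<in> poly_over L \<Longrightarrow> q \<in> poly_over L \<Longrightarrow> map_poly \<tau> (p * q) = map_poly \<tau> p * map_poly \<tau> q"
  by (intro poly_eqI)
     (auto simp: coeff_emb emb_mult poly_over_def coeff_mult emb_sum subfield_mult[OF emb_subfield] intro!: sum.cong)

lemma emb_poly_eq_0: "p \<in> poly_over L \<Longrightarrow> map_poly \<tau> p = 0 \<longleftrightarrow> p = 0"
  by (auto simp: poly_eq_iff coeff_emb emb_eq_0 poly_over_def)

lemma emb_degree: "p \<in> poly_over L \<Longrightarrow> degree (map_poly \<tau> p) = degree p"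
proof -
  assume "p \<in> poly_over L"
  then have "coeff (map_poly \<tau> p) k = 0 \<longleftrightarrow> coeff p k = 0" for k
    by (simp add: coeff_emb emb_eq_0 poly_over_def)
  then show ?thesis by (intro antisym degree_le) (metis coeff_eq_0)+
qed

lemma emb_poly: "p \<in> poly_over L \<Longrightarrow> x \<in> L \<Longrightarrow> poly (map_poly \<tau> p) (\<tau> x) = \<tau> (poly p x)"
proof (induction p rule: pCons_induct)
  case (pCons a p)
  have *: "coeff (pCons a p) k \<in> L" for k
    using pCons.prems(1) by (simp add: poly_over_def)
  have a: "a \<in> L" using *[of 0] by simp
  have p: "p \<in> poly_over L" using *[of "Suc _"] by (simp add: poly_over_def)
  have "poly p x \<in> L" by (intro poly_in_poly_over emb_subfield p pCons.prems)
  then show ?case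
    using pCons.IH[OF p pCons.prems(2)] pCons.prems(2) a
    by (simp add: map_poly_pCons emb_0 emb_add emb_mult subfield_mult[OF emb_subfield])
qed (simp add: emb_0)

text \<open>A minimal polynomial is irreducible over \<open>L\<close>, and so is its image over the
  image of \<open>L\<close>. Hence a polynomial over \<open>L\<close> vanishes at \<open>t\<close>,
  or its image at \<open>t'\<close>, exactly when the remainder modulo \<open>p\<close> is
  0.\<close>

lemma algebraic_transfer:
  assumes p: "p \<in> poly_over L" "p \<noteq> 0" "poly p t = 0"
    and min: "\<And>q. q \<in> poly_over L \<Longrightarrow> q \<noteq> 0 \<Longrightarrow> poly q t = 0 \<Longrightarrow> degree p \<le> degree q"
    and t': "poly (map_poly \<tau> p) t' = 0"
    and q: "q \<in> poly_over L"
  shows "poly q t = 0 \<longleftrightarrow> poly (map_poly \<tau> q) t' = 0"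
proof -
  note L = emb_subfield
  obtain s r where sr: "s \<in> poly_over L" "r \<in> poly_over L" "q = p * s + r" "r = 0 \<or> degree r < degree p"
    using poly_over_division[OF L p(1,2) q] by auto
  have 1: "poly q t = poly r t" "poly (map_poly \<tau> q) t' = poly (map_poly \<tau> r) t'"
    using sr p t' by (simp_all add: emb_poly_add emb_poly_mult poly_over_mult[OF L])
  have 2: "poly r t = 0 \<longleftrightarrow> r = 0"
    using min[of r] sr by (metis leD poly_0)
  have "r = 0" if r: "poly (map_poly \<tau> r) t' = 0"
  proof (rule ccontr)
    assume "r \<noteq> 0"
    \<comment> \<open>A polynomial \<open>g\<close> of least degree whose image vanishes at
      \<open>t'\<close> divides \<open>p\<close>. Its degree is below that of \<open>p\<close>, so
      \<open>t\<close> is a root of the cofactor, and minimality of \<open>p\<close> makes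
      \<open>g\<close> constant.\<close>
    define Z where "Z = (\<lambda>q. q \<in> poly_over L \<and> q \<noteq> 0 \<and> poly (map_poly \<tau> q) t' = 0)"
    define g where "g = arg_min degree Z"
    have "Z r" using \<open>r \<noteq> 0\<close> r sr by (simp add: Z_def)
    then have g: "Z g" and gmin: "\<And>q. Z q \<Longrightarrow> degree g \<le> degree q"
      unfolding g_def by (auto intro: arg_min_natI arg_min_nat_le)
    have "degree g < degree p" using gmin[OF \<open>Z r\<close>] sr \<open>r \<noteq> 0\<close> by auto
    obtain a b where ab: "a \<in> poly_over L" "b \<in> poly_over L" "p = g * a + b" "b = 0 \<or> degree b < degree g"
      using poly_over_division[OF L _ _ p(1), of g] g by (auto simp: Z_def)
    have "poly (map_poly \<tau> b) t' = 0"
      using t' ab g by (simp add: Z_def emb_poly_add emb_poly_mult poly_over_mult[OF L])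
    then have "b = 0" using gmin[of b] ab unfolding Z_def by (metis leD)
    then have pga: "p = g * a" using ab by simp
    then have "a \<noteq> 0" "poly g t \<noteq> 0"
      using p min[of g] g \<open>degree g < degree p\<close> by (auto simp: Z_def)
    then have "degree p \<le> degree a" using min[of a] ab p pga by auto
    moreover have "degree p = degree g + degree a"
      using pga g \<open>a \<noteq> 0\<close> by (auto simp: Z_def degree_mult_eq)
    ultimately have "degree g = 0" by simp
    then obtain c where c: "g = [:c:]" using degree_eq_zeroE by blast
    then have "c \<in> L" using g by (auto simp: Z_def poly_over_def dest: spec[of _ 0])
    then show False using g c by (auto simp: Z_def emb_eq_0 map_poly_pCons emb_0)
  qed
  then show ?thesis using 1 2 emb_poly_eq_0[of r] sr by auto
qed

text \<open>
  In characteristic 0 a minimal polynomial of degree at least 2 cannot have a single root, as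
  that root would be a rational expression in its coefficients.
\<close>

lemma minimal_poly_other_root:
  assumes p: "p \<in> poly_over L" "p \<noteq> 0" "poly p t = 0"
    and min: "\<And>q. q \<in> poly_over L \<Longrightarrow> q \<noteq> 0 \<Longrightarrow> poly q t = 0 \<Longrightarrow> degree p \<le> degree q"
    and t: "t \<notin> L"
  shows "\<exists>t'. t' \<noteq> w \<and> poly (map_poly \<tau> p) t' = 0"
proof (rule ccontr)
  assume "\<not> ?thesis"
  then have only: "t' = w" if "poly (map_poly \<tau> p) t' = 0" for t' using that by auto
  note L = emb_subfield
  define P where "P = map_poly \<tau> p"
  define d where "d = degree p"
  have d: "d > 0" unfolding d_def
  proof (rule ccontr)
    assume "\<not> degree p > 0"
    then obtain c where "p = [:c:]" using degree_eq_zeroE by blast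
    with p show False by simp
  qed
  have P0: "P \<noteq> 0" using p emb_poly_eq_0 by (simp add: P_def)
  have degP: "degree P = d" using emb_degree p by (simp add: P_def d_def)
  \<comment> \<open>If \<open>w\<close> is the only root, what is left after splitting off all
    factors X - w has no root and is a constant, so \<open>P\<close> = c (X - w)^d.\<close>
  obtain g where g: "P = [:- w, 1:] ^ order w P * g" "\<not> [:- w, 1:] dvd g"
    using order_decomp[OF P0, of w] by auto
  have "degree g = 0"
  proof (rule ccontr)
    assume "degree g \<noteq> 0"
    then obtain z where z: "poly g z = 0"
      using Fundamental_Theorem_Algebra.fundamental_theorem_of_algebra[of g] constant_degree[of g] by auto
    then have "poly P z = 0" using g by (metis mult_zero_right poly_mult)
    then have "z = w" using only by (simp add: P_def)
    with z g show False by (simp add: poly_eq_0_iff_dvd)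
  qed
  then obtain c where c: "g = [:c:]" using degree_eq_zeroE by blast
  then have "c \<noteq> 0" using P0 g by auto
  then have "degree P = order w P" using arg_cong[OF g(1), of degree] c
    by (simp add: degree_linear_power)
  then have P: "P = smult c ([:- w, 1:] ^ d)" using g c degP by simp
  have "coeff P d = c" unfolding P coeff_smult coeff_linear_power by simp
  moreover have "coeff P (d - 1) = - c * of_nat d * w"
    unfolding P coeff_smult using d coeff_linear_poly_power[of "d - 1" d "- w" 1]
    by (cases d) simp_all
  ultimately have 1: "\<tau> (coeff p d) = c" "\<tau> (coeff p (d - 1)) = - c * of_nat d * w"
    by (simp_all add: P_def coeff_emb)
  \<comment> \<open>Vieta: the coefficient of X^(d-1) in c (X - w)^d is - c d w, so this element of
    \<open>L\<close> is mapped to \<open>w\<close>. Dividing by \<open>d\<close> is where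
    characteristic 0 enters.\<close>
  define \<rho> where "\<rho> = - coeff p (d - 1) * inverse (of_nat d * coeff p d)"
  have in_L: "coeff p k \<in> L" "of_nat d \<in> L" for k
    using p subfield_of_int[OF L, of "int d"] by (auto simp: poly_over_def)
  have \<rho>: "\<rho> \<in> L" unfolding \<rho>_def
    by (intro subfield_mult[OF L] subfield_uminus[OF L] subfield_inverse[OF L] in_L)
  have "\<tau> \<rho> = - (- c * of_nat d * w) * inverse (of_nat d * c)"
    unfolding \<rho>_def
    by (simp add: emb_mult emb_inverse emb_uminus emb_of_nat in_L 1(1) 1(2)[unfolded One_nat_def] subfield_mult[OF L] subfield_uminus[OF L]
        subfield_inverse[OF L] del: inverse_mult_distrib)
  also have "\<dots> = w" using d \<open>c \<noteq> 0\<close> by (simp add: field_simps)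
  finally have "\<tau> \<rho> = w" .
  \<comment> \<open>So \<open>p\<close> has the root \<rho> in \<open>L\<close>. As \<open>t\<close>
    is not in \<open>L\<close>, dividing by X - \<rho> gives a polynomial of smaller degree that
    still vanishes at \<open>t\<close>, against minimality.\<close>
  then have "\<tau> (poly p \<rho>) = 0"
    using emb_poly[OF p(1) \<rho>] P d by (simp add: P_def zero_power)
  then have root: "poly p \<rho> = 0" using emb_eq_0 poly_in_poly_over[OF L p(1) \<rho>] by simp
  have lin: "[:- \<rho>, 1:] \<in> poly_over L"
    using \<rho> by (intro poly_over_pCons poly_over_0 L subfield_uminus[OF L] subfield_1[OF L])
  obtain s r where sr: "s \<in> poly_over L" "r \<in> poly_over L" "p = [:- \<rho>, 1:] * s + r" "r = 0 \<or> degree r < 1"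
    using poly_over_division[OF L lin _ p(1)] by auto
  have "r = 0"
  proof (rule ccontr)
    assume "r \<noteq> 0"
    then obtain e where "r = [:e:]" using sr degree_eq_zeroE[of r] by auto
    with sr root \<open>r \<noteq> 0\<close> show False by simp
  qed
  then have ps: "p = [:- \<rho>, 1:] * s" using sr by simp
  then have "s \<noteq> 0" using p by auto
  have "t \<noteq> \<rho>" using \<rho> t by auto
  then have "poly s t = 0" using p ps by simp
  then have "degree p \<le> degree s" using min sr \<open>s \<noteq> 0\<close> by auto
  moreover have "degree p = 1 + degree s"
  proof -
    have "degree ([:- \<rho>, 1:] * s) = degree [:- \<rho>, 1:] + degree s"
      using \<open>s \<noteq> 0\<close> by (intro degree_mult_eq) auto
    then show ?thesis unfolding ps[symmetric] by simp
  qed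
  ultimately show False by simp
qed

text \<open>For algebraic \<open>t\<close>, a root other than \<open>w\<close> of the transported
  minimal polynomial. For transcendental \<open>t\<close>, any complex number apart from
  \<open>w\<close> and the countably many roots of transported nonzero polynomials.\<close>

lemma transfer_point:
  assumes "countable L" "t \<notin> L"
  shows "\<exists>t'. t' \<noteq> w \<and> (\<forall>p\<in>poly_over L. poly p t = 0 \<longleftrightarrow> poly (map_poly \<tau> p) t' = 0)"
proof (cases "\<exists>p\<in>poly_over L. p \<noteq> 0 \<and> poly p t = 0")
  case True
  define Z where "Z = (\<lambda>q. q \<in> poly_over L \<and> q \<noteq> 0 \<and> poly q t = 0)"
  define p where "p = arg_min degree Z"
  from True have "Ex Z" by (auto simp: Z_def)
  then have p: "Z p" and pmin: "\<And>q. Z q \<Longrightarrow> degree p \<le> degree q"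
    unfolding p_def by (auto intro: arg_min_natI arg_min_nat_le)
  from minimal_poly_other_root[of p t w] p pmin assms(2)
  obtain t' where "t' \<noteq> w" "poly (map_poly \<tau> p) t' = 0" by (auto simp: Z_def)
  with algebraic_transfer[of p t t'] p pmin show ?thesis by (intro exI[of _ t']) (auto simp: Z_def)
next
  case False
  define B where "B = insert w (\<Union>p\<in>poly_over L - {0}. {z. poly (map_poly \<tau> p) z = 0})"
  have "countable B"
    unfolding B_def using countable_poly_over[OF assms(1)] emb_poly_eq_0
    by (intro countable_insert countable_UN) (auto intro!: countable_finite poly_roots_finite)
  then have "B \<noteq> UNIV" using uncountable_UNIV_complex by auto
  then obtain t' where t': "t' \<notin> B" by auto
  have "poly p t = 0 \<longleftrightarrow> poly (map_poly \<tau> p) t' = 0" if "p \<in> poly_over L" for p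
    using False that t' by (cases "p = 0") (auto simp: B_def)
  with t' show ?thesis by (intro exI[of _ t']) (auto simp: B_def)
qed

text \<open>The new field is L(t), and p(t)/q(t) is sent to the quotient of the transported
  polynomials at \<open>t'\<close>. Hypothesis \<open>tr\<close> makes this well defined and keeps
  denominators nonzero. The relation \<open>R\<close> is the graph of the extension.\<close>

lemma extend_embedding_to:
  assumes "countable L"
    and tr: "\<And>p. p \<in> poly_over L \<Longrightarrow> poly p t = 0 \<longleftrightarrow> poly (map_poly \<tau> p) t' = 0"
  shows "\<exists>L' \<tau>'. embedding_on L' \<tau>' \<and> countable L' \<and> L \<subseteq> L' \<and> t \<in> L' \<and> (\<forall>x\<in>L. \<tau>' x = \<tau> x) \<and> \<tau>' t = t'"
proof -
  note L = emb_subfield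
  define m where "m = (\<lambda>p. poly (map_poly \<tau> p) t')"
  define R where "R = (\<lambda>x w. \<exists>p\<in>poly_over L. \<exists>q\<in>poly_over L. poly q t \<noteq> 0 \<and>
      x = poly p t / poly q t \<and> w = m p / m q)"
  have m: "m (p + q) = m p + m q" "m (p * q) = m p * m q" "m (- p) = - m p"
    if "p \<in> poly_over L" "q \<in> poly_over L" for p q
    using that by (auto simp: m_def emb_poly_add emb_poly_mult emb_poly_uminus)
  have nz: "m q \<noteq> 0" if "q \<in> poly_over L" "poly q t \<noteq> 0" for q
    using tr that by (auto simp: m_def)
  note cl = poly_over_add[OF L] poly_over_mult[OF L] poly_over_uminus[OF L] poly_over_const[OF L] poly_over_0[OF L]
  have RE: "\<exists>p q. p \<in> poly_over L \<and> q \<in> poly_over L \<and> poly q t \<noteq> 0 \<and> x = poly p t / poly q t \<and> w = m p / m q"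
    if "R x w" for x w
    using that unfolding R_def by blast
  have R_unique: "w = w'" if r1: "R x w" and r2: "R x w'" for x w w'
  proof -
    obtain p q where pq: "p \<in> poly_over L" "q \<in> poly_over L" "poly q t \<noteq> 0" "x = poly p t / poly q t" "w = m p / m q"
      using RE[OF r1] by blast
    obtain p' q' where pq': "p' \<in> poly_over L" "q' \<in> poly_over L" "poly q' t \<noteq> 0" "x = poly p' t / poly q' t" "w' = m p' / m q'"
      using RE[OF r2] by blast
    have "poly (p * q' + - (p' * q)) t = 0" using pq pq' by (simp add: frac_eq_eq)
    then have "m (p * q' + - (p' * q)) = 0"
      unfolding m_def by (subst tr[symmetric]) (intro cl pq pq')
    moreover have "m (p * q' + - (p' * q)) = m p * m q' + - (m p' * m q)"
      using pq pq' by (simp only: m cl)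
    ultimately have "m p * m q' = m p' * m q" by simp
    then show ?thesis using pq pq' nz by (simp add: frac_eq_eq)
  qed
  define L' where "L' = {x. \<exists>w. R x w}"
  define \<tau>' where "\<tau>' = (\<lambda>x. THE w. R x w)"
  have \<tau>': "\<tau>' x = w" if "R x w" for x w
    unfolding \<tau>'_def using that R_unique by blast
  have R_const: "R x (\<tau> x)" if "x \<in> L" for x
    unfolding R_def using that L
    by (intro bexI[of _ "[:x:]"] bexI[of _ "[:1:]"])
       (auto simp: m_def map_poly_pCons emb_0 emb_1 intro!: cl subfield_1)
  have R_t: "R t t'"
    unfolding R_def using L
    by (intro bexI[of _ "[:0, 1:]"] bexI[of _ "[:1:]"])
       (auto simp: m_def map_poly_pCons emb_0 emb_1 intro!: cl poly_over_pCons subfield_1 subfield_0)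
  have R_add: "R (x + y) (v + w)" and R_mult: "R (x * y) (v * w)" if r1: "R x v" and r2: "R y w" for x y v w
  proof -
    obtain p q where pq: "p \<in> poly_over L" "q \<in> poly_over L" "poly q t \<noteq> 0" "x = poly p t / poly q t" "v = m p / m q"
      using RE[OF r1] by blast
    obtain p' q' where pq': "p' \<in> poly_over L" "q' \<in> poly_over L" "poly q' t \<noteq> 0" "y = poly p' t / poly q' t" "w = m p' / m q'"
      using RE[OF r2] by blast
    show "R (x + y) (v + w)"
      unfolding R_def using pq pq' nz
      by (intro bexI[where x = "p * q' + p' * q" and A = "poly_over L"] bexI[where x = "q * q'" and A = "poly_over L"])
         (auto simp: m cl add_frac_eq)
    show "R (x * y) (v * w)"
      unfolding R_def using pq pq' nz
      by (intro bexI[of _ "p * p'"] bexI[of _ "q * q'"]) (auto simp: m cl)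
  qed
  have R_uminus: "R (- x) (- v)" and R_inverse: "R (inverse x) (inverse v)" if r1: "R x v" for x v
  proof -
    obtain p q where pq: "p \<in> poly_over L" "q \<in> poly_over L" "poly q t \<noteq> 0" "x = poly p t / poly q t" "v = m p / m q"
      using RE[OF r1] by blast
    show "R (- x) (- v)"
      unfolding R_def using pq by (intro bexI[of _ "- p"] bexI[of _ q]) (auto simp: m cl)
    show "R (inverse x) (inverse v)"
    proof (cases "poly p t = 0")
      case True
      then have "m p = 0" using tr pq by (simp add: m_def)
      then have "inverse x = 0" "inverse v = 0" using pq True by auto
      then show ?thesis using R_const[OF subfield_0[OF L]] by (simp add: emb_0)
    next
      case False
      then show ?thesis
        unfolding R_def using pq by (intro bexI[of _ q] bexI[of _ p]) auto
    qed
  qed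
  have mem: "x \<in> L'" if "R x w" for x w
    using that by (auto simp: L'_def)
  have "is_subfield L'"
    unfolding is_subfield_def
  proof (intro conjI ballI)
    show "0 \<in> L'" "1 \<in> L'"
      using mem[OF R_const[OF subfield_0[OF L]]] mem[OF R_const[OF subfield_1[OF L]]] .
    fix x assume "x \<in> L'"
    then obtain v where x: "R x v" by (auto simp: L'_def)
    show "- x \<in> L'" "inverse x \<in> L'"
      using mem[OF R_uminus[OF x]] mem[OF R_inverse[OF x]] .
    fix y assume "y \<in> L'"
    then obtain w where y: "R y w" by (auto simp: L'_def)
    show "x + y \<in> L'" "x * y \<in> L'"
      using mem[OF R_add[OF x y]] mem[OF R_mult[OF x y]] .
  qed
  moreover have "countable L'"
  proof (rule countable_subset)
    show "L' \<subseteq> (\<lambda>(p, q). poly p t / poly q t) ` (poly_over L \<times> poly_over L)"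
      by (auto simp: L'_def R_def)
    show "countable ((\<lambda>(p, q). poly p t / poly q t) ` (poly_over L \<times> poly_over L))"
      using countable_poly_over[OF assms(1)] by auto
  qed
  moreover have "\<tau>' (x + y) = \<tau>' x + \<tau>' y" "\<tau>' (x * y) = \<tau>' x * \<tau>' y" if "x \<in> L'" "y \<in> L'" for x y
    using that \<tau>' R_add R_mult by (auto simp: L'_def)
  moreover have "\<tau>' x = \<tau> x" if "x \<in> L" for x using \<tau>' R_const that by auto
  moreover have "\<tau>' 0 = 0" "\<tau>' 1 = 1"
    using \<tau>'[OF R_const[OF subfield_0[OF L]]] \<tau>'[OF R_const[OF subfield_1[OF L]]] by (simp_all add: emb_0 emb_1)
  moreover have "L \<subseteq> L'" using mem[OF R_const] by auto
  ultimately show ?thesis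
    using \<tau>'[OF R_t] mem[OF R_t]
    by (intro exI[of _ L'] exI[of _ \<tau>']) (simp add: embedding_on_def)
qed

lemma extend_embedding_moving:
  assumes "countable L" "t \<notin> L"
  shows "\<exists>L' \<tau>'. embedding_on L' \<tau>' \<and> countable L' \<and> L \<subseteq> L' \<and> t \<in> L' \<and> (\<forall>x\<in>L. \<tau>' x = \<tau> x) \<and> \<tau>' t \<noteq> w"
  using transfer_point[OF assms, of w] extend_embedding_to[OF assms(1), of t] by metis

end

lemma extend_embedding:
  assumes "finite S" "embedding_on L \<tau>" "countable L"
  shows "\<exists>L' \<tau>'. embedding_on L' \<tau>' \<and> countable L' \<and> L \<subseteq> L' \<and> S \<subseteq> L' \<and> (\<forall>x\<in>L. \<tau>' x = \<tau> x)"
  using assms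
proof (induction S rule: finite_induct)
  case empty
  then show ?case by auto
next
  case (insert t S)
  then obtain L1 \<tau>1 where 1: "embedding_on L1 \<tau>1" "countable L1" "L \<subseteq> L1" "S \<subseteq> L1" "\<forall>x\<in>L. \<tau>1 x = \<tau> x"
    by blast
  show ?case
  proof (cases "t \<in> L1")
    case True
    with 1 show ?thesis by blast
  next
    case False
    from extend_embedding_moving[OF 1(1,2) False] obtain L2 \<tau>2 where
      "embedding_on L2 \<tau>2" "countable L2" "L1 \<subseteq> L2" "t \<in> L2" "\<forall>x\<in>L1. \<tau>2 x = \<tau>1 x" by metis
    with 1 show ?thesis by (intro exI[of _ L2] exI[of _ \<tau>2]) auto
  qed
qed

section \<open>Coprime polynomials over a field\<close>

text \<open>A nonzero combination of least degree divides every combination, by taking remainders;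
  being a common divisor, it is a unit.\<close>

lemma coprime_poly_bezout:
  fixes p q :: "'a :: field poly"
  assumes "coprime p q"
  shows "\<exists>a b. a * p + b * q = 1"
proof -
  define Z where "Z = (\<lambda>g. g \<noteq> 0 \<and> (\<exists>a b. g = a * p + b * q))"
  have "p \<noteq> 0 \<or> q \<noteq> 0" using assms by auto
  then have "Z p \<or> Z q" unfolding Z_def
    by (metis add.right_neutral add_0 lambda_one mult_zero_left)
  define g where "g = arg_min degree Z"
  have g: "Z g" and gmin: "\<And>h. Z h \<Longrightarrow> degree g \<le> degree h"
    unfolding g_def using \<open>Z p \<or> Z q\<close> by (auto intro: arg_min_natI arg_min_nat_le)
  obtain a b where ab: "g = a * p + b * q" using g by (auto simp: Z_def)
  have dvd: "g dvd r" if r: "r = c * p + d * q" for r c d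
  proof (rule ccontr)
    assume "\<not> g dvd r"
    then have "r mod g \<noteq> 0" by (simp add: mod_eq_0_iff_dvd)
    moreover have "r mod g = (c - r div g * a) * p + (d - r div g * b) * q"
    proof -
      have "r mod g = r - r div g * g" by (simp add: minus_div_mult_eq_mod)
      then show ?thesis using r ab by (simp add: algebra_simps)
    qed
    ultimately have "Z (r mod g)" unfolding Z_def by blast
    then have "degree g \<le> degree (r mod g)" by (rule gmin)
    moreover have "degree (r mod g) < degree g"
      using degree_mod_less[of g r] g \<open>r mod g \<noteq> 0\<close> by (auto simp: Z_def)
    ultimately show False by simp
  qed
  have "g dvd p" "g dvd q" using dvd[of p 1 0] dvd[of q 0 1] by auto
  then have "is_unit g" using coprime_common_divisor[OF assms] by blast
  then obtain h where "1 = g * h" by (auto simp: dvd_def)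
  then have "(h * a) * p + (h * b) * q = 1" using ab by (simp add: algebra_simps)
  then show ?thesis by blast
qed

lemma coprime_poly_dvd_mult:
  fixes p q r :: "'a :: field poly"
  assumes "coprime p q" "p dvd q * r"
  shows "p dvd r"
proof -
  obtain a b where ab: "a * p + b * q = 1" using coprime_poly_bezout[OF assms(1)] by auto
  have "r = (a * p + b * q) * r" using ab by simp
  also have "\<dots> = p * (a * r) + b * (q * r)" by (simp add: algebra_simps)
  finally show ?thesis using assms(2) by (metis dvd_add dvd_mult dvd_triv_left)
qed

lemma monic_dvd_antisym:
  fixes p q :: "'a :: field poly"
  assumes "p dvd q" "degree p = degree q" "lead_coeff p = 1" "lead_coeff q = 1"
  shows "p = q"
proof -
  obtain r where r: "q = p * r" using assms(1) by (auto simp: dvd_def)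
  have "p \<noteq> 0" "q \<noteq> 0" using assms by auto
  then have "r \<noteq> 0" using r by auto
  then have "degree r = 0" using r assms(2) \<open>p \<noteq> 0\<close> by (simp add: degree_mult_eq)
  then obtain c where c: "r = [:c:]" using degree_eq_zeroE by blast
  then have "lead_coeff q = lead_coeff p * c" using r by (simp add: lead_coeff_mult)
  then show ?thesis using assms r c by simp
qed

text \<open>Needed because \<open>fract_coeffs\<close> quantifies over all reduced fractions: there
  is only one.\<close>

lemma monic_coprime_fraction_unique:
  fixes p q p' q' :: "'a :: field poly"
  assumes "p * q' = p' * q" "coprime p q" "coprime p' q'" "lead_coeff q = 1" "lead_coeff q' = 1"
  shows "p = p' \<and> q = q'"
proof -
  have nz: "q \<noteq> 0" "q' \<noteq> 0" using assms by auto
  have "q dvd q'"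
    using coprime_poly_dvd_mult[of q p q'] assms by (simp add: coprime_commute)
  moreover have "q' dvd q"
    using coprime_poly_dvd_mult[of q' p' q] assms by (metis coprime_commute dvd_triv_right)
  ultimately have "q = q'"
    using assms nz by (intro monic_dvd_antisym) (auto intro!: antisym dvd_imp_degree_le)
  then show ?thesis using assms nz by simp
qed

section \<open>The resolvent of a matrix\<close>

definition char_matrix :: "'a :: field^'n^'n \<Rightarrow> 'a poly^'n^'n" where
  "char_matrix A = (\<chi> i j. (if i = j then [:0, 1:] else 0) - [:A $ i $ j:])"

definition char_poly :: "'a :: field^'n^'n \<Rightarrow> 'a poly" where
  "char_poly A = det (char_matrix A)"

text \<open>Cramer's form of the (k, j) entry of the adjugate of sI - A: column \<open>k\<close> is
  replaced by the unit vector \<open>j\<close>.\<close>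

definition adjugate :: "'a :: field^'n^'n \<Rightarrow> 'n \<Rightarrow> 'n \<Rightarrow> 'a poly" where
  "adjugate A k j = det (\<chi> i l. if l = k then (if i = j then 1 else 0) else char_matrix A $ i $ l)"

lemma smult_sum_right: "smult a (sum f I) = (\<Sum>i\<in>I. smult a (f i))"
  by (induction I rule: infinite_finite_induct) (simp_all add: smult_add_right)

lemma degree_det_term:
  fixes F :: "'a :: field poly^'n^'n"
  shows "degree (of_int (sign p) * (\<Prod>i\<in>UNIV. F $ i $ p i)) \<le> (\<Sum>i\<in>UNIV. degree (F $ i $ p i))"
proof -
  have "degree (of_int (sign p) * (\<Prod>i\<in>UNIV. F $ i $ p i)) \<le> degree (\<Prod>i\<in>UNIV. F $ i $ p i)"
    using degree_mult_le[of "of_int (sign p)" "\<Prod>i\<in>UNIV. F $ i $ p i"] by simp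
  also have "\<dots> \<le> (\<Sum>i\<in>UNIV. degree (F $ i $ p i))"
    using degree_prod_sum_le[of UNIV "\<lambda>i. F $ i $ p i"] by (simp add: o_def)
  finally show ?thesis .
qed

lemma degree_char_matrix_le: "degree (char_matrix A $ i $ j) \<le> (if i = j then 1 else 0)"
  by (auto simp: char_matrix_def)

text \<open>Every Leibniz term takes one factor from the replaced column, which is constant, and the
  other factors have degree at most 1.\<close>

lemma degree_adjugate_less:
  fixes A :: "'a :: field^'n^'n"
  shows "degree (adjugate A k j) < CARD('n)"
proof -
  let ?F = "(\<chi> i l. if l = k then (if i = j then 1 else 0) else char_matrix A $ i $ l) :: 'a poly^'n^'n"
  have "degree (of_int (sign p) * (\<Prod>i\<in>UNIV. ?F $ i $ p i)) \<le> CARD('n) - 1"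
    if p: "p permutes (UNIV :: 'n set)" for p
  proof -
    obtain i0 where i0: "p i0 = k" using permutes_surj[OF p] by (metis surjD)
    have "degree (of_int (sign p) * (\<Prod>i\<in>UNIV. ?F $ i $ p i)) \<le> (\<Sum>i\<in>UNIV. degree (?F $ i $ p i))"
      by (rule degree_det_term)
    also have "\<dots> \<le> (\<Sum>i\<in>UNIV. if i = i0 then 0 else 1)"
    proof (rule sum_mono)
      fix i
      show "degree (?F $ i $ p i) \<le> (if i = i0 then 0 else 1)"
        using i0 order_trans[OF degree_char_matrix_le, of i "p i" 1 A] by auto
    qed
    also have "\<dots> = CARD('n) - 1"
      by (subst sum.remove[of _ i0]) (auto simp: card_Diff_singleton)
    finally show ?thesis .
  qed
  then have "degree (adjugate A k j) \<le> CARD('n) - 1"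
    unfolding adjugate_def det_def by (intro degree_sum_le) auto
  moreover have "CARD('n) > 0" by simp
  ultimately show ?thesis by linarith
qed

text \<open>A Leibniz term has degree at most the number of fixed points of its permutation, so only
  the identity reaches degree n, with coefficient 1.\<close>

lemma degree_char_poly: "degree (char_poly (A :: 'a :: field^'n^'n)) = CARD('n)"
  and lead_coeff_char_poly: "lead_coeff (char_poly (A :: 'a :: field^'n^'n)) = 1"
proof -
  let ?t = "\<lambda>p. of_int (sign p) * (\<Prod>i\<in>UNIV. char_matrix A $ i $ p i)"
  let ?P = "{p. p permutes (UNIV :: 'n set)}"
  have le: "degree (?t p) \<le> card {i. p i = i}" for p
  proof -
    have "degree (?t p) \<le> (\<Sum>i\<in>UNIV. degree (char_matrix A $ i $ p i))"
      by (rule degree_det_term)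
    also have "\<dots> \<le> (\<Sum>i\<in>UNIV. if i = p i then 1 else 0)"
      by (intro sum_mono degree_char_matrix_le)
    also have "\<dots> = card {i. p i = i}" by (simp add: sum.If_cases eq_commute)
    finally show ?thesis .
  qed
  have lt: "coeff (?t p) CARD('n) = 0" if "p \<noteq> id" for p
  proof -
    from \<open>p \<noteq> id\<close> obtain i where "p i \<noteq> i" by (auto simp: fun_eq_iff)
    then have "card {i. p i = i} < CARD('n)" by (intro psubset_card_mono) auto
    then show ?thesis using le[of p] by (intro coeff_eq_0) simp
  qed
  have id: "coeff (?t id) CARD('n) = 1"
  proof -
    have *: "char_matrix A $ i $ i = [:- A $ i $ i, 1:]" for i by (simp add: char_matrix_def)
    have "degree (\<Prod>i\<in>UNIV. char_matrix A $ i $ i) = (\<Sum>i\<in>UNIV. degree (char_matrix A $ i $ i))"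
      by (rule degree_prod_sum_eq) (simp add: *)
    then have "degree (\<Prod>i\<in>UNIV. char_matrix A $ i $ i) = CARD('n)" by (simp add: *)
    moreover have "lead_coeff (\<Prod>i\<in>UNIV. char_matrix A $ i $ i) = 1"
      unfolding lead_coeff_prod by (simp add: *)
    ultimately show ?thesis by (simp add: sign_id)
  qed
  have "id \<in> ?P" by (simp add: permutes_id)
  have "coeff (char_poly A) CARD('n) = (\<Sum>p\<in>?P. coeff (?t p) CARD('n))"
    by (simp add: char_poly_def det_def coeff_sum)
  also have "\<dots> = coeff (?t id) CARD('n) + (\<Sum>p\<in>?P - {id}. coeff (?t p) CARD('n))"
    using \<open>id \<in> ?P\<close> by (intro sum.remove) auto
  also have "\<dots> = 1" using id lt by simp
  finally have 1: "coeff (char_poly A) CARD('n) = 1" .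
  have "degree (?t p) \<le> CARD('n)" for p
    using le[of p] card_mono[of UNIV "{i. p i = i}"] by (meson finite order_trans subset_UNIV)
  then have "degree (char_poly A) \<le> CARD('n)"
    unfolding char_poly_def det_def by (intro degree_sum_le) auto
  with 1 show "degree (char_poly A) = CARD('n)" by (intro antisym le_degree) auto
  with 1 show "lead_coeff (char_poly A) = 1" by simp
qed

lemma char_poly_nonzero: "char_poly A \<noteq> 0"
  using lead_coeff_char_poly[of A] by auto

lemma to_fract_sum: "to_fract (sum f I) = (\<Sum>i\<in>I. to_fract (f i))"
  by (induction I rule: infinite_finite_induct) auto

lemma to_fract_det:
  fixes F :: "'a :: idom^'n^'n"
  shows "to_fract (det F) = det (\<chi> i j. to_fract (F $ i $ j))"
proof -
  have p: "to_fract (prod f I) = (\<Prod>i\<in>I. to_fract (f i))" for f :: "'n \<Rightarrow> 'a" and I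
    by (induction I rule: infinite_finite_induct) auto
  have i: "to_fract (of_int k :: 'a) = of_int k" for k
    by (induction k rule: int_induct[of _ 0]) auto
  show ?thesis unfolding det_def by (simp add: to_fract_sum p i)
qed

text \<open>Cramer's rule for column \<open>j\<close> of the inverse: the unit vector in the
  replaced column is \<open>F\<close> applied to that column.\<close>

lemma resolvent_entries:
  fixes A :: "'a :: field^'n^'n"
  defines "F \<equiv> (\<chi> i j. to_fract (char_matrix A $ i $ j))"
  assumes R: "F ** R = mat 1"
  shows "to_fract (adjugate A k j) = R $ k $ j * to_fract (char_poly A)"
proof -
  have "to_fract (adjugate A k j) = det (\<chi> i l. if l = k then (F *v (\<chi> l. R $ l $ j)) $ i else F $ i $ l)"
  proof -
    have "(F *v (\<chi> l. R $ l $ j)) $ i = (F ** R) $ i $ j" for i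
      by (simp add: matrix_vector_mult_def matrix_matrix_mult_def)
    then have "(F *v (\<chi> l. R $ l $ j)) $ i = (if i = j then 1 else 0)" for i
      by (simp add: R mat_def)
    then show ?thesis
      unfolding adjugate_def to_fract_det
      by (intro arg_cong[of _ _ det]) (simp add: vec_eq_iff F_def)
  qed
  also have "\<dots> = R $ k $ j * det F" by (subst cramer_lemma) simp
  finally show ?thesis by (simp add: char_poly_def to_fract_det F_def)
qed

lemma char_matrix_invertible:
  fixes A :: "'a :: field^'n^'n"
  shows "invertible (\<chi> i j. to_fract (char_matrix A $ i $ j))"
  using char_poly_nonzero[of A] by (simp add: invertible_det_nz char_poly_def flip: to_fract_det)

text \<open>Both identities hold over the fraction field, where the inverse exists, and descend
  because \<open>to_fract\<close> is injective.\<close>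

lemma adjugate_right: "(\<Sum>l\<in>UNIV. char_matrix A $ i $ l * adjugate A l j) = (if i = j then char_poly A else 0)"
  and adjugate_left: "(\<Sum>l\<in>UNIV. adjugate A i l * char_matrix A $ l $ j) = (if i = j then char_poly A else 0)"
  for A :: "'a :: field^'n^'n"
proof -
  define F where "F = (\<chi> i j. to_fract (char_matrix A $ i $ j))"
  obtain R where R: "F ** R = mat 1" "R ** F = mat 1"
    using char_matrix_invertible[of A] unfolding invertible_def F_def by blast
  have X: "to_fract (adjugate A k j) = R $ k $ j * to_fract (char_poly A)" for k j
    using resolvent_entries R(1) unfolding F_def by blast
  have "to_fract (\<Sum>l\<in>UNIV. char_matrix A $ i $ l * adjugate A l j) = (F ** R) $ i $ j * to_fract (char_poly A)"
    by (simp add: to_fract_sum X F_def matrix_matrix_mult_def sum_distrib_right mult.assoc)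
  also have "\<dots> = to_fract (if i = j then char_poly A else 0)" by (simp add: R mat_def)
  finally show "(\<Sum>l\<in>UNIV. char_matrix A $ i $ l * adjugate A l j) = (if i = j then char_poly A else 0)"
    by (simp only: to_fract_eq_iff)
  have "to_fract (\<Sum>l\<in>UNIV. adjugate A i l * char_matrix A $ l $ j) = (R ** F) $ i $ j * to_fract (char_poly A)"
    by (simp add: to_fract_sum X F_def matrix_matrix_mult_def sum_distrib_left ac_simps)
  also have "\<dots> = to_fract (if i = j then char_poly A else 0)" by (simp add: R mat_def)
  finally show "(\<Sum>l\<in>UNIV. adjugate A i l * char_matrix A $ l $ j) = (if i = j then char_poly A else 0)"
    by (simp only: to_fract_eq_iff)
qed

section \<open>Observability\<close>

definition row_iter :: "'a :: field^'n^'n \<Rightarrow> 'a^'n \<Rightarrow> nat \<Rightarrow> 'a^'n" where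
  "row_iter A w m = ((\<lambda>v. v v* A) ^^ m) w"

lemma row_iter_0 [simp]: "row_iter A w 0 = w"
  by (simp add: row_iter_def)

lemma row_iter_Suc: "row_iter A w (Suc m) = row_iter A w m v* A"
  by (simp add: row_iter_def)

lemma row_iter_Suc': "row_iter A w (Suc m) = row_iter A (w v* A) m"
  using funpow_swap1[of "\<lambda>v. v v* A" m w] by (simp add: row_iter_def)

lemma row_iter_add: "row_iter A (row_iter A w k) m = row_iter A w (k + m)"
  by (induction m) (simp_all add: row_iter_Suc)

text \<open>An arbitrary but fixed enumeration of a finite type. It lets square matrices indexed by
  types carry powers of a matrix or orders of derivatives in their rows.\<close>

definition index_of :: "'n :: finite \<Rightarrow> nat" where
  "index_of = (SOME f. bij_betw f UNIV {..<CARD('n)})"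

lemma bij_index_of: "bij_betw (index_of :: 'n :: finite \<Rightarrow> nat) UNIV {..<CARD('n)}"
proof -
  have "\<exists>f :: 'n \<Rightarrow> nat. bij_betw f UNIV {..<CARD('n)}"
    using ex_bij_betw_finite_nat[of "UNIV :: 'n set"] by (simp add: atLeast0LessThan)
  then show ?thesis unfolding index_of_def by (rule someI_ex)
qed

lemma index_of_less: "index_of (k :: 'n :: finite) < CARD('n)"
  using bij_index_of[where 'n = 'n] by (auto simp: bij_betw_def)

lemma index_of_inj: "index_of (k :: 'n :: finite) = index_of l \<longleftrightarrow> k = l"
  using bij_index_of[where 'n = 'n] by (auto simp: bij_betw_def inj_on_def)

lemma index_of_surj: "m < CARD('n) \<Longrightarrow> \<exists>k :: 'n :: finite. index_of k = m"
  using bij_index_of[where 'n = 'n] unfolding bij_betw_def by (metis imageE lessThan_iff)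

text \<open>The Kalman observability matrix for vertex \<open>i\<close>, with rows e_i^T A^k for k <
  n. Applied to \<open>transpose A\<close> it is the transposed controllability matrix for vertex
  \<open>i\<close>.\<close>

definition obs_matrix :: "'a :: field^'n^'n \<Rightarrow> 'n \<Rightarrow> 'a^'n^'n" where
  "obs_matrix A i = (\<chi> k. row_iter A (axis i 1) (index_of k))"

lemma sum_axis:
  fixes v :: "'a :: field^'n"
  shows "(\<Sum>l\<in>UNIV. axis i 1 $ l * v $ l) = v $ i"
proof -
  have "(\<Sum>l\<in>UNIV. axis i 1 $ l * v $ l) = (\<Sum>l\<in>UNIV. if l = i then v $ l else 0)"
    by (intro sum.cong) (auto simp: axis_def)
  then show ?thesis by simp
qed

lemma det_nonzero_left_kernel:
  fixes F :: "'a :: field^'n^'n"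
  assumes "det F \<noteq> 0" "v v* F = 0"
  shows "v = 0"
  using assms by (metis invertible_def invertible_det_nz vector_matrix_mul_assoc vector_matrix_mul_rid vector_matrix_mult_0)

lemma det_nonzero_right_kernel:
  fixes F :: "'a :: field^'n^'n"
  assumes "det F \<noteq> 0" "F *v v = 0"
  shows "v = 0"
  using assms by (metis invertible_def invertible_det_nz matrix_vector_mul_assoc matrix_vector_mul_lid matrix_vector_mult_0_right)

lemma det_nonzero_left_surj:
  fixes F :: "'a :: field^'n^'n"
  assumes "det F \<noteq> 0"
  shows "\<exists>v. v v* F = w"
  using assms by (metis invertible_def invertible_det_nz vector_matrix_mul_assoc vector_matrix_mul_rid)

lemma det_nonzeroI_left_kernel:
  fixes F :: "'a :: field^'n^'n"
  assumes "\<And>v. v v* F = 0 \<Longrightarrow> v = 0"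
  shows "det F \<noteq> 0"
proof -
  have "transpose F *v v = 0 \<Longrightarrow> v = 0" for v using assms by simp
  then have "\<exists>B. B ** transpose F = mat 1" by (simp add: matrix_left_invertible_ker)
  then have "invertible (transpose F)" by (simp add: invertible_left_inverse)
  then show ?thesis by (simp add: invertible_det_nz)
qed

text \<open>Both sides are w A^m e_j. This is the bridge between observations w A^m and the
  reachable vectors A^m e_j.\<close>

lemma row_iter_transpose:
  "row_iter A w m $ j = (\<Sum>l\<in>UNIV. w $ l * row_iter (transpose A) (axis j 1) m $ l)"
proof (induction m arbitrary: w)
  case 0
  show ?case by (simp add: axis_def if_distrib cong: if_cong)
next
  case (Suc m)
  have "row_iter A w (Suc m) $ j = (\<Sum>l\<in>UNIV. (w v* A) $ l * row_iter (transpose A) (axis j 1) m $ l)"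
    by (simp add: row_iter_Suc' Suc.IH)
  also have "\<dots> = (\<Sum>l\<in>UNIV. \<Sum>r\<in>UNIV. w $ r * A $ r $ l * row_iter (transpose A) (axis j 1) m $ l)"
    by (simp add: vector_matrix_mult_def sum_distrib_right)
  also have "\<dots> = (\<Sum>r\<in>UNIV. \<Sum>l\<in>UNIV. w $ r * A $ r $ l * row_iter (transpose A) (axis j 1) m $ l)"
    by (rule sum.swap)
  also have "\<dots> = (\<Sum>r\<in>UNIV. w $ r * row_iter (transpose A) (axis j 1) (Suc m) $ r)"
    by (simp add: row_iter_Suc vector_matrix_mult_def transpose_def sum_distrib_left ac_simps)
  finally show ?case .
qed

section \<open>Rows of the adjugate and coprimality with the characteristic polynomial\<close>

definition adj_row :: "'a :: field^'n^'n \<Rightarrow> 'a^'n \<Rightarrow> 'n \<Rightarrow> 'a poly" where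
  "adj_row A w j = (\<Sum>l\<in>UNIV. smult (w $ l) (adjugate A l j))"

lemma adj_row_axis: "adj_row A (axis i 1) j = adjugate A i j"
proof -
  have "adj_row A (axis i 1) j = (\<Sum>l\<in>UNIV. if l = i then adjugate A l j else 0)"
    unfolding adj_row_def by (intro sum.cong) (auto simp: axis_def)
  then show ?thesis by simp
qed

lemma degree_adj_row_less: "degree (adj_row A w j) < CARD('n)" for A :: "'a :: field^'n^'n"
proof -
  have "degree (adj_row A w j) \<le> CARD('n) - 1"
    unfolding adj_row_def
  proof (rule degree_sum_le)
    fix l
    show "degree (smult (w $ l) (adjugate A l j)) \<le> CARD('n) - 1"
      using order_trans[OF degree_smult_le[of "w $ l" "adjugate A l j"], of "CARD('n) - 1"]
        degree_adjugate_less[of A l j] by simp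
  qed simp
  moreover have "CARD('n) > 0" by simp
  ultimately show ?thesis by linarith
qed

text \<open>From s adj = A adj + \<chi> I, multiplied on the left by \<open>w\<close>. Modulo the
  characteristic polynomial, multiplication by s thus acts on these row entries as w -> w A.\<close>

lemma adj_row_step: "[:0, 1:] * adj_row A w j = adj_row A (w v* A) j + smult (w $ j) (char_poly A)"
  for A :: "'a :: field^'n^'n"
proof -
  have entry: "[:0, 1:] * adjugate A l j = (\<Sum>r\<in>UNIV. smult (A $ l $ r) (adjugate A r j)) + (if l = j then char_poly A else 0)" for l
  proof -
    have "(\<Sum>r\<in>UNIV. char_matrix A $ l $ r * adjugate A r j) =
        (\<Sum>r\<in>UNIV. (if l = r then [:0, 1:] * adjugate A r j else 0) - smult (A $ l $ r) (adjugate A r j))"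
      by (intro sum.cong refl) (auto simp: char_matrix_def algebra_simps)
    also have "\<dots> = [:0, 1:] * adjugate A l j - (\<Sum>r\<in>UNIV. smult (A $ l $ r) (adjugate A r j))"
      by (simp add: sum_subtractf)
    finally show ?thesis using adjugate_right[of A l j] by (simp add: algebra_simps)
  qed
  have "[:0, 1:] * adj_row A w j = (\<Sum>l\<in>UNIV. smult (w $ l) ([:0, 1:] * adjugate A l j))"
    by (simp add: adj_row_def sum_distrib_left)
  also have "\<dots> = (\<Sum>l\<in>UNIV. \<Sum>r\<in>UNIV. smult (w $ l * A $ l $ r) (adjugate A r j)) +
      (\<Sum>l\<in>UNIV. if l = j then smult (w $ l) (char_poly A) else 0)"
  proof -
    have "smult (w $ l) ([:0, 1:] * adjugate A l j) =
        (\<Sum>r\<in>UNIV. smult (w $ l * A $ l $ r) (adjugate A r j)) + (if l = j then smult (w $ l) (char_poly A) else 0)" for l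
      unfolding entry by (simp add: smult_add_right smult_sum_right)
    then show ?thesis by (simp add: sum.distrib)
  qed
  also have "(\<Sum>l\<in>UNIV. \<Sum>r\<in>UNIV. smult (w $ l * A $ l $ r) (adjugate A r j)) = adj_row A (w v* A) j"
    unfolding adj_row_def by (subst sum.swap) (simp add: vector_matrix_mult_def smult_sum)
  finally show ?thesis by simp
qed

lemma adj_row_add: "adj_row A (v + w) j = adj_row A v j + adj_row A w j"
  by (simp add: adj_row_def smult_add_left sum.distrib)

lemma adj_row_scale: "adj_row A (a *s w) j = smult a (adj_row A w j)"
  by (simp add: adj_row_def smult_sum_right)

lemma adj_row_0 [simp]: "adj_row A 0 j = 0"
  by (simp add: adj_row_def)

text \<open>In \<open>adj_row_step\<close> the term w_j \<chi> has degree n unless w_j = 0, while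
  adjugate rows have smaller degree; so vanishing passes from \<open>w\<close> to w A.\<close>

lemma adj_row_eq_0_iter:
  assumes "adj_row A w j = 0"
  shows "adj_row A (row_iter A w m) j = 0 \<and> row_iter A w m $ j = 0"
proof -
  have step: "v $ j = 0 \<and> adj_row A (v v* A) j = 0" if "adj_row A v j = 0" for v
  proof -
    have *: "adj_row A (v v* A) j = - smult (v $ j) (char_poly A)"
      using adj_row_step[of A v j] that by (simp add: eq_neg_iff_add_eq_0)
    have "v $ j = 0"
    proof (rule ccontr)
      assume "v $ j \<noteq> 0"
      then have "degree (adj_row A (v v* A) j) = degree (char_poly A)" by (simp add: *)
      then show False using degree_adj_row_less[of A "v v* A" j] by (simp add: degree_char_poly)
    qed
    with * show ?thesis by simp
  qed
  show ?thesis
  proof (induction m)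
    case 0 then show ?case using assms step by simp
  next
    case (Suc m) then show ?case using step by (simp add: row_iter_Suc)
  qed
qed

lemma adj_row_eq_0D:
  assumes "det (obs_matrix (transpose A) j) \<noteq> 0" "adj_row A w j = 0"
  shows "w = 0"
proof -
  have "(obs_matrix (transpose A) j *v w) $ k = row_iter A w (index_of k) $ j" for k
    unfolding row_iter_transpose[of A w] by (simp add: obs_matrix_def matrix_vector_mult_def mult.commute)
  then have "obs_matrix (transpose A) j *v w = 0"
    using adj_row_eq_0_iter[OF assms(2)] by (simp add: vec_eq_iff)
  then show ?thesis using assms(1) det_nonzero_right_kernel by blast
qed

text \<open>Let \<chi> = d e with \<open>d\<close> dividing the adjugate entry. Then \<chi> divides
  e times the entry, which modulo \<chi> is the row entry of e_i^T e(A), of degree below n and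
  therefore 0. Controllability gives e_i^T e(A) = 0, and observability allows this for e nonzero
  only if deg e \<ge> n, so \<open>d\<close> is constant.\<close>

lemma coprime_adjugate_char_poly:
  fixes A :: "'a :: field^'n^'n"
  assumes obs: "det (obs_matrix A i) \<noteq> 0" and ctr: "det (obs_matrix (transpose A) j) \<noteq> 0"
  shows "coprime (adjugate A i j) (char_poly A)"
proof (rule coprimeI)
  fix d assume "d dvd adjugate A i j" "d dvd char_poly A"
  then obtain e f where f: "adjugate A i j = d * f" and e: "char_poly A = d * e"
    by (auto simp: dvd_def)
  have nz: "d \<noteq> 0" "e \<noteq> 0" using e char_poly_nonzero[of A] by auto
  have pow: "\<exists>q. [:0, 1:] ^ m * adjugate A i j = adj_row A (row_iter A (axis i 1) m) j + char_poly A * q" for m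
  proof (induction m)
    case 0 show ?case by (simp add: adj_row_axis)
  next
    case (Suc m)
    then obtain q where q: "[:0, 1:] ^ m * adjugate A i j = adj_row A (row_iter A (axis i 1) m) j + char_poly A * q"
      by blast
    have "[:0, 1:] ^ Suc m * adjugate A i j = [:0, 1:] * ([:0, 1:] ^ m * adjugate A i j)"
      by (simp only: power_Suc mult.assoc)
    also have "\<dots> = [:0, 1:] * adj_row A (row_iter A (axis i 1) m) j + [:0, 1:] * (char_poly A * q)"
      unfolding q by (simp only: distrib_left)
    also have "\<dots> = adj_row A (row_iter A (axis i 1) (Suc m)) j + char_poly A * ([:row_iter A (axis i 1) m $ j:] + [:0, 1:] * q)"
      unfolding adj_row_step row_iter_Suc by (simp add: distrib_left mult.left_commute)
    finally show ?case by blast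
  qed
  then obtain q where q: "\<And>m. [:0, 1:] ^ m * adjugate A i j = adj_row A (row_iter A (axis i 1) m) j + char_poly A * q m"
    by metis
  \<comment> \<open>This is e_i^T e(A).\<close>
  define w where "w = (\<Sum>m\<le>degree e. coeff e m *s row_iter A (axis i 1) m)"
  have "e * adjugate A i j = (\<Sum>m\<le>degree e. smult (coeff e m) ([:0, 1:] ^ m * adjugate A i j))"
  proof -
    have "e = (\<Sum>m\<le>degree e. smult (coeff e m) ([:0, 1:] ^ m))"
      using poly_as_sum_of_monoms[of e] by (simp add: monom_altdef)
    then have "e * adjugate A i j = (\<Sum>m\<le>degree e. smult (coeff e m) ([:0, 1:] ^ m)) * adjugate A i j"
      by simp
    then show ?thesis by (simp add: sum_distrib_right)
  qed
  also have "\<dots> = adj_row A w j + char_poly A * (\<Sum>m\<le>degree e. smult (coeff e m) (q m))"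
  proof -
    have "adj_row A (\<Sum>m\<in>I. coeff e m *s row_iter A (axis i 1) m) j =
        (\<Sum>m\<in>I. smult (coeff e m) (adj_row A (row_iter A (axis i 1) m) j))" for I
      by (induction I rule: infinite_finite_induct) (simp_all add: adj_row_add adj_row_scale)
    then show ?thesis
      unfolding q w_def by (simp add: smult_add_right sum.distrib sum_distrib_left)
  qed
  finally have "char_poly A * f = adj_row A w j + char_poly A * (\<Sum>m\<le>degree e. smult (coeff e m) (q m))"
    by (simp add: f e ac_simps)
  then have dvd: "char_poly A dvd adj_row A w j"
    by (metis dvd_add_left_iff dvd_triv_left)
  have "adj_row A w j = 0"
  proof (rule ccontr)
    assume "adj_row A w j \<noteq> 0"
    with dvd have "degree (char_poly A) \<le> degree (adj_row A w j)" by (intro dvd_imp_degree_le)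
    then show False using degree_adj_row_less[of A w j] by (simp add: degree_char_poly)
  qed
  then have w: "w = 0" using ctr by (rule adj_row_eq_0D[rotated])
  have "degree d = 0"
  proof (rule ccontr)
    assume "degree d \<noteq> 0"
    moreover have "CARD('n) = degree d + degree e"
      using arg_cong[OF e, of degree] nz by (simp add: degree_mult_eq degree_char_poly)
    ultimately have deg: "degree e < CARD('n)" by simp
    define c :: "'a^'n" where "c = (\<chi> k. coeff e (index_of k))"
    have "c v* obs_matrix A i = (\<Sum>k\<in>(UNIV :: 'n set). coeff e (index_of k) *s row_iter A (axis i 1) (index_of k))"
      by (simp add: vec_eq_iff vector_matrix_mult_def obs_matrix_def c_def)
    also have "\<dots> = (\<Sum>m\<in>{..<CARD('n)}. coeff e m *s row_iter A (axis i 1) m)"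
      using bij_index_of by (intro sum.reindex_bij_betw)
    also have "\<dots> = w"
      unfolding w_def using deg
      by (intro sum.mono_neutral_right) (auto simp: coeff_eq_0)
    finally have "c = 0" using w obs det_nonzero_left_kernel by metis
    then have "coeff e (index_of k) = 0" for k :: 'n by (simp add: c_def vec_eq_iff)
    then have "lead_coeff e = 0" using index_of_surj[OF deg] by metis
    with nz show False by simp
  qed
  then show "is_unit d" using nz by (simp add: is_unit_iff_degree)
qed

text \<open>
  The Markov parameters \<open>e\<^sub>i\<^sup>T A\<^sup>m e\<^sub>j = row_iter A (axis i 1) m $ j\<close> are the coefficients of the
  Laurent expansion of \<open>adjugate A i j / char_poly A\<close> at infinity.
\<close>

lemma markov_determined:
  fixes A A' :: "'a :: field^'n^'n"
  assumes "char_poly A = char_poly A'" "smult g (adjugate A i j) = smult g' (adjugate A' i j)"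
  shows "g * row_iter A (axis i 1) m $ j = g' * row_iter A' (axis i 1) m $ j"
proof -
  \<comment> \<open>Comparison of the coefficients of s^n in \<open>adj_row_step\<close>: there
    \<chi> contributes 1 and the adjugate row nothing.\<close>
  have coeff_n: "w $ j = coeff (adj_row B w j) (CARD('n) - 1)" for B :: "'a^'n^'n" and w
  proof -
    have "coeff ([:0, 1:] * adj_row B w j) CARD('n) = coeff (adj_row B w j) (CARD('n) - 1)"
      by (cases "CARD('n)") (simp_all add: coeff_pCons)
    moreover have "coeff (adj_row B (w v* B) j) CARD('n) = 0"
      by (intro coeff_eq_0 degree_adj_row_less)
    moreover have "coeff (char_poly B) CARD('n) = 1"
      using lead_coeff_char_poly[of B] by (simp add: degree_char_poly)
    ultimately show ?thesis using arg_cong[OF adj_row_step[of B w j], of "\<lambda>p. coeff p CARD('n)"] by simp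
  qed
  \<comment> \<open>Induction on whole row polynomials: the next row is determined by the current
    one, its coefficient of s^(n-1) and the common characteristic polynomial.\<close>
  have rows: "smult g (adj_row A (row_iter A (axis i 1) m) j) = smult g' (adj_row A' (row_iter A' (axis i 1) m) j)" for m
  proof (induction m)
    case 0 then show ?case using assms(2) by (simp add: adj_row_axis)
  next
    case (Suc m)
    let ?w = "row_iter A (axis i 1) m" and ?w' = "row_iter A' (axis i 1) m"
    have "g * ?w $ j = g' * ?w' $ j"
      unfolding coeff_n[of ?w A] coeff_n[of ?w' A']
      using arg_cong[OF Suc, of "\<lambda>p. coeff p (CARD('n) - 1)"] by simp
    moreover have "smult h (adj_row B (w v* B) j) = [:0, 1:] * smult h (adj_row B w j) - smult (h * w $ j) (char_poly B)"
      for h w and B :: "'a^'n^'n"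
    proof -
      have "adj_row B (w v* B) j = [:0, 1:] * adj_row B w j - smult (w $ j) (char_poly B)"
        using adj_row_step[of B w j] by (simp add: algebra_simps)
      then show ?thesis by (simp only: smult_diff_right mult_smult_right smult_smult)
    qed
    ultimately show ?case using Suc assms(1) by (simp only: row_iter_Suc)
  qed
  show ?thesis
    unfolding coeff_n[of "row_iter A (axis i 1) m" A] coeff_n[of "row_iter A' (axis i 1) m" A']
    using arg_cong[OF rows[of m], of "\<lambda>p. coeff p (CARD('n) - 1)"] by simp
qed

section \<open>Generic observability and controllability\<close>

text \<open>Rates are free values for any graph, so the same shape covers specializations of the
  model, in-trees and the reversed graph.\<close>

definition compartmental :: "('n \<times> 'n) set \<Rightarrow> ('n \<times> 'n \<Rightarrow> 'a :: field) \<Rightarrow> ('n \<Rightarrow> 'a) \<Rightarrow> 'a^'n^'n" where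
  "compartmental E a l = (\<chi> i j. if i = j then - l i - (\<Sum>k | (i, k) \<in> E. a (i, k))
     else if (j, i) \<in> E then a (j, i) else 0)"

definition comp_at :: "'n :: finite compartment_model \<Rightarrow> (nat \<Rightarrow> complex) \<Rightarrow> complex^'n^'n" where
  "comp_at M \<mu> = compartmental (edges M) (\<lambda>e. \<mu> (edge_par M e))
     (\<lambda>i. if i \<in> leaks M then \<mu> (leak_par M i) else 0)"

lemma ratval_comp: "ratval \<mu> (comp_matrix M $ i $ j) (comp_at M \<mu> $ i $ j)"
proof -
  have "ratval \<mu> ((if i \<in> leaks M then - par (leak_par M i) else 0) - (\<Sum>k | (i, k) \<in> edges M. par (edge_par M (i, k))))
    (- (if i \<in> leaks M then \<mu> (leak_par M i) else 0) - (\<Sum>k | (i, k) \<in> edges M. \<mu> (edge_par M (i, k))))"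
    by (intro ratval_diff ratval_sum ratval_par)
       (auto intro: ratval_uminus ratval_par ratval_0)
  then show ?thesis
    by (auto simp: comp_matrix_def comp_at_def compartmental_def intro: ratval_par ratval_0)
qed

lemma ratval_row_iter:
  fixes F :: "ratfun^'n^'n" and G :: "complex^'n^'n" and v :: "ratfun^'n" and w :: "complex^'n"
  assumes "\<And>i j. ratval \<mu> (F $ i $ j) (G $ i $ j)" "\<And>i. ratval \<mu> (v $ i) (w $ i)"
  shows "ratval \<mu> (row_iter F v m $ j) (row_iter G w m $ j)"
  by (induction m arbitrary: j)
     (auto simp: row_iter_Suc vector_matrix_mult_def assms intro!: ratval_sum ratval_mult)

lemma ratval_axis: "ratval \<mu> (axis i 1 $ j) (axis i 1 $ j)"
  by (auto simp: axis_def ratval_0 ratval_1)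

lemma ratval_det_obs:
  fixes F :: "ratfun^'n^'n" and G :: "complex^'n^'n"
  assumes "\<And>i j. ratval \<mu> (F $ i $ j) (G $ i $ j)"
  shows "ratval \<mu> (det (obs_matrix F i)) (det (obs_matrix G i))"
  by (rule ratval_det) (simp add: obs_matrix_def ratval_row_iter assms ratval_axis)

lemma polyfun_det_obs:
  fixes F :: "('v \<Rightarrow> complex) \<Rightarrow> complex^'n^'n"
  assumes "\<And>i j. polyfun V (\<lambda>z. F z $ i $ j)"
  shows "polyfun V (\<lambda>z. det (obs_matrix (F z) i))"
proof (rule polyfun_det)
  have "polyfun V (\<lambda>z. row_iter (F z) w m $ j)" for w m j
    by (induction m arbitrary: j)
       (auto simp: row_iter_Suc vector_matrix_mult_def intro!: polyfun_const polyfun_sum polyfun_mult assms)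
  then show "polyfun V (\<lambda>z. obs_matrix (F z) i $ k $ j)" for k j by (simp add: obs_matrix_def)
qed

lemma row_iter_eigenvector:
  assumes "A *v v = c *s v"
  shows "(\<Sum>l\<in>UNIV. row_iter A w m $ l * v $ l) = c ^ m * (\<Sum>l\<in>UNIV. w $ l * v $ l)"
proof (induction m)
  case (Suc m)
  have "(\<Sum>l\<in>UNIV. row_iter A w (Suc m) $ l * v $ l) =
      (\<Sum>l\<in>UNIV. \<Sum>r\<in>UNIV. row_iter A w m $ r * (A $ r $ l * v $ l))"
    by (simp add: row_iter_Suc vector_matrix_mult_def sum_distrib_right mult.assoc)
  also have "\<dots> = (\<Sum>r\<in>UNIV. row_iter A w m $ r * (A *v v) $ r)"
    by (subst sum.swap) (simp add: matrix_vector_mult_def sum_distrib_left)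
  also have "\<dots> = c * (\<Sum>r\<in>UNIV. row_iter A w m $ r * v $ r)"
    unfolding assms by (simp add: sum_distrib_left ac_simps)
  finally show ?case using Suc by simp
qed simp

text \<open>A left kernel vector is a polynomial \<open>q\<close> of degree below n; pairing with
  the eigenvectors gives q(c_r) v_r(i) = 0, hence n distinct roots.\<close>

lemma observable_if_eigenvectors:
  fixes A :: "'a :: field^'n^'n"
  assumes "inj c" "\<And>r :: 'n. A *v v r = c r *s v r" "\<And>r. v r $ i \<noteq> 0"
  shows "det (obs_matrix A i) \<noteq> 0"
proof (rule det_nonzeroI_left_kernel)
  fix d assume d: "d v* obs_matrix A i = 0"
  define q where "q = (\<Sum>k\<in>UNIV. monom (d $ k) (index_of k))"
  have coeff: "coeff q (index_of k) = d $ k" for k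
    unfolding q_def coeff_sum by (subst sum.remove[of _ k]) (auto simp: index_of_inj intro!: sum.neutral)
  have root: "poly q (c r) = 0" for r
  proof -
    have "0 = (\<Sum>l\<in>UNIV. (d v* obs_matrix A i) $ l * v r $ l)" by (simp add: d)
    also have "\<dots> = (\<Sum>l\<in>UNIV. \<Sum>k\<in>UNIV. d $ k * (row_iter A (axis i 1) (index_of k) $ l * v r $ l))"
      by (simp add: vector_matrix_mult_def obs_matrix_def sum_distrib_right mult.assoc)
    also have "\<dots> = (\<Sum>k\<in>UNIV. d $ k * (\<Sum>l\<in>UNIV. row_iter A (axis i 1) (index_of k) $ l * v r $ l))"
      by (subst sum.swap) (simp add: sum_distrib_left)
    also have "\<dots> = (\<Sum>k\<in>UNIV. d $ k * (c r ^ index_of k * v r $ i))"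
      by (simp add: row_iter_eigenvector[OF assms(2)] sum_axis)
    also have "\<dots> = poly q (c r) * v r $ i"
      by (simp add: q_def poly_sum poly_monom sum_distrib_right mult.assoc)
    finally show ?thesis using assms(3)[of r] by simp
  qed
  have "q = 0"
  proof (rule ccontr)
    assume "q \<noteq> 0"
    have "degree q \<le> CARD('n) - 1"
      unfolding q_def
    proof (rule degree_sum_le)
      fix k
      show "degree (monom (d $ k) (index_of k)) \<le> CARD('n) - 1"
        using order_trans[OF degree_monom_le[of "d $ k" "index_of k"]] index_of_less[of k] by simp
    qed simp
    moreover have "CARD('n) \<le> card {x. poly q x = 0}"
      using root card_image[OF assms(1)] poly_roots_finite[OF \<open>q \<noteq> 0\<close>]
      by (metis (mono_tags, lifting) card_mono image_subset_iff mem_Collect_eq)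
    moreover have "card {x. poly q x = 0} \<le> degree q" using \<open>q \<noteq> 0\<close> by (rule card_poly_roots_bound)
    moreover have "CARD('n) > 0" by simp
    ultimately show False by linarith
  qed
  then show "d = 0" using coeff by (simp add: vec_eq_iff)
qed

text \<open>
  For an in-tree with root \<open>i\<close> and pairwise different rates, each vertex \<open>r\<close> has an eigenvector that
  is supported on the path from \<open>r\<close> to \<open>i\<close> and does not vanish at \<open>i\<close>.
\<close>

lemma in_tree_observable:
  fixes E :: "('n :: finite \<times> 'n) set" and i :: 'n
  assumes "irrefl E" and edge: "\<And>k. k \<noteq> i \<Longrightarrow> (k, p k) \<in> E" and path: "\<And>r. \<exists>m. (p ^^ m) r = i"
  shows "\<exists>a :: 'n \<times> 'n \<Rightarrow> complex. det (obs_matrix (compartmental E a (\<lambda>_. 0)) i) \<noteq> 0"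
proof -
  \<comment> \<open>Outflow rates, pairwise different, with 0 at the root only. Edges off the tree
    get rate 0. The value \<open>p i\<close> is unspecified, which is harmless because the rate at
    \<open>i\<close> vanishes.\<close>
  define \<alpha> :: "'n \<Rightarrow> complex" where "\<alpha> = (\<lambda>k. if k = i then 0 else of_nat (Suc (index_of k)))"
  define a where "a = (\<lambda>(x, y). if y = p x then \<alpha> x else 0)"
  define A where "A = compartmental E a (\<lambda>_. 0)"
  have \<alpha>: "\<alpha> x = \<alpha> y \<longleftrightarrow> x = y" for x y
    unfolding \<alpha>_def by (auto simp: index_of_inj simp del: of_nat_Suc)
  have \<alpha>_0: "\<alpha> x = 0 \<longleftrightarrow> x = i" for x using \<alpha>[of x i] by (simp add: \<alpha>_def)
  have A: "A $ x $ y = \<alpha> y * ((if x = p y then 1 else 0) - (if x = y then 1 else 0))" for x y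
  proof -
    have diag: "(\<Sum>k | (y, k) \<in> E. a (y, k)) = \<alpha> y"
    proof (cases "y = i")
      case True
      then show ?thesis by (auto simp: a_def \<alpha>_0 intro!: sum.neutral)
    next
      case False
      then have "(\<Sum>k | (y, k) \<in> E. a (y, k)) = a (y, p y)"
        using edge[OF False] by (subst sum.remove[of _ "p y"]) (auto simp: a_def intro!: sum.neutral)
      then show ?thesis by (simp add: a_def)
    qed
    show ?thesis
    proof (cases "y = i")
      case True
      then have "\<alpha> y = 0" by (simp add: \<alpha>_0)
      then show ?thesis using diag by (auto simp: A_def compartmental_def a_def)
    next
      case False
      then have "(y, p y) \<in> E" "p y \<noteq> y" using edge assms(1) by (auto simp: irrefl_def) metis
      then show ?thesis using diag by (auto simp: A_def compartmental_def a_def)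
    qed
  qed
  define d where "d = (\<lambda>r. LEAST m. (p ^^ m) r = i)"
  define P where "P = (\<lambda>r m. (p ^^ m) r)"
  have P_d: "P r (d r) = i" for r unfolding P_def d_def by (rule LeastI_ex) (rule path)
  have P_less: "P r m \<noteq> i" if "m < d r" for r m
    using not_less_Least[of m "\<lambda>m. (p ^^ m) r = i"] that by (auto simp: P_def d_def)
  have P_Suc: "P r (Suc m) = p (P r m)" for r m by (simp add: P_def)
  have P_neq: "P r m \<noteq> r" if "0 < m" "m \<le> d r" for r m
  proof
    assume *: "P r m = r"
    have "P r (d r) = (p ^^ (d r - m)) (P r m)"
      using that by (simp add: P_def flip: funpow_add[THEN fun_cong, simplified])
    then have "P r (d r - m) = i" using * P_d by (simp add: P_def)
    then show False using P_less[of "d r - m" r] that by simp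
  qed
  \<comment> \<open>Forced by the eigenvector equation for eigenvalue - \<alpha> r at the (m+1)-st
    vertex of the path: inflow \<alpha> (P m) g m minus outflow \<alpha> (P (m+1)) g (m+1) equals -
    \<alpha> r g (m+1).\<close>
  define g where "g = (\<lambda>r. rec_nat (1 :: complex) (\<lambda>m x. \<alpha> (P r m) * x / (\<alpha> (P r (Suc m)) - \<alpha> r)))"
  have g0: "g r 0 = 1" and gS: "g r (Suc m) = \<alpha> (P r m) * g r m / (\<alpha> (P r (Suc m)) - \<alpha> r)" for r m
    by (simp_all add: g_def)
  have g_nz: "m \<le> d r \<Longrightarrow> g r m \<noteq> 0" for r m
  proof (induction m)
    case (Suc m)
    then show ?case using P_neq[of "Suc m" r] P_less[of m r] by (simp add: gS \<alpha> \<alpha>_0)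
  qed (simp add: g0)
  define v :: "'n \<Rightarrow> complex^'n" where "v = (\<lambda>r. \<chi> x. \<Sum>m\<le>d r. if P r m = x then g r m else 0)"
  have "A *v v r = (- \<alpha> r) *s v r" for r
  proof -
    have "(A *v v r) $ x = ((- \<alpha> r) *s v r) $ x" for x
    proof -
      define \<delta> where "\<delta> = (\<lambda>m. if x = P r m then 1 else 0 :: complex)"
      have "(A *v v r) $ x = (\<Sum>y\<in>UNIV. \<Sum>m\<le>d r. A $ x $ y * (if P r m = y then g r m else 0))"
        by (simp add: matrix_vector_mult_def v_def sum_distrib_left)
      also have "\<dots> = (\<Sum>m\<le>d r. \<Sum>y\<in>UNIV. A $ x $ y * (if P r m = y then g r m else 0))"
        by (rule sum.swap)
      also have "\<dots> = (\<Sum>m\<le>d r. A $ x $ P r m * g r m)"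
        by (simp add: if_distrib cong: if_cong)
      also have "\<dots> = (\<Sum>m\<le>d r. g r m * \<alpha> (P r m) * \<delta> (Suc m)) - (\<Sum>m\<le>d r. g r m * \<alpha> (P r m) * \<delta> m)"
        unfolding sum_subtractf[symmetric] by (intro sum.cong) (auto simp: A \<delta>_def P_Suc)
      \<comment> \<open>The term m = \<open>d r\<close> disappears because the path has reached the
        root, whose rate is 0.\<close>
      also have "(\<Sum>m\<le>d r. g r m * \<alpha> (P r m) * \<delta> (Suc m)) = (\<Sum>m<d r. g r m * \<alpha> (P r m) * \<delta> (Suc m))"
        using P_d[of r] \<alpha>_0 by (simp flip: lessThan_Suc_atMost)
      also have "\<dots> = (\<Sum>m<d r. g r (Suc m) * (\<alpha> (P r (Suc m)) - \<alpha> r) * \<delta> (Suc m))"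
      proof (intro sum.cong refl)
        fix m assume "m \<in> {..<d r}"
        then have "P r (Suc m) \<noteq> r" using P_neq[of "Suc m" r] by auto
        then have "\<alpha> (P r (Suc m)) - \<alpha> r \<noteq> 0" by (simp add: \<alpha>)
        then show "g r m * \<alpha> (P r m) * \<delta> (Suc m) = g r (Suc m) * (\<alpha> (P r (Suc m)) - \<alpha> r) * \<delta> (Suc m)"
          by (simp add: gS)
      qed
      \<comment> \<open>The term m = 0 added by the shift is zero because the path starts at
        \<open>r\<close>.\<close>
      also have "\<dots> = (\<Sum>m\<le>d r. g r m * (\<alpha> (P r m) - \<alpha> r) * \<delta> m)"
        unfolding lessThan_Suc_atMost[symmetric] sum.lessThan_Suc_shift by (simp add: P_def)
      also have "\<dots> - (\<Sum>m\<le>d r. g r m * \<alpha> (P r m) * \<delta> m) = (\<Sum>m\<le>d r. - \<alpha> r * (g r m * \<delta> m))"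
        unfolding sum_subtractf[symmetric] by (intro sum.cong) (auto simp: algebra_simps)
      also have "\<dots> = - \<alpha> r * (\<Sum>m\<le>d r. g r m * \<delta> m)" by (simp add: sum_distrib_left)
      also have "(\<Sum>m\<le>d r. g r m * \<delta> m) = v r $ x"
        unfolding v_def by (auto simp: \<delta>_def intro!: sum.cong)
      finally show ?thesis by simp
    qed
    then show ?thesis by (simp add: vec_eq_iff)
  qed
  moreover have "v r $ i \<noteq> 0" for r
  proof -
    have "v r $ i = g r (d r)"
      unfolding v_def vec_lambda_beta
      using P_d[of r] P_less[of _ r] by (subst sum.remove[of _ "d r"]) (auto intro!: sum.neutral)
    then show ?thesis using g_nz by simp
  qed
  moreover have "inj (\<lambda>r. - \<alpha> r)" by (auto simp: inj_def \<alpha>)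
  ultimately have "det (obs_matrix A i) \<noteq> 0"
    by (intro observable_if_eigenvectors[of "\<lambda>r. - \<alpha> r" A v i])
  then show ?thesis unfolding A_def by blast
qed

section \<open>From in-trees to all vertices, and from observability to controllability\<close>

text \<open>A breadth-first tree: \<open>p\<close> moves to a neighbour strictly closer to
  \<open>i\<close>.\<close>

lemma strongly_connected_in_tree:
  fixes E :: "('n :: finite \<times> 'n) set"
  assumes "strongly_connected E"
  obtains p where "\<And>k. k \<noteq> i \<Longrightarrow> (k, p k) \<in> E" "\<And>r. \<exists>m. (p ^^ m) r = i"
proof -
  define dist where "dist = (\<lambda>k. LEAST m. (k, i) \<in> E ^^ m)"
  have dist: "(k, i) \<in> E ^^ dist k" for k
  proof -
    have "\<exists>m. (k, i) \<in> E ^^ m" using assms by (auto simp: strongly_connected_def rtrancl_power)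
    then show ?thesis unfolding dist_def by (rule LeastI_ex)
  qed
  have "\<exists>y. (k, y) \<in> E \<and> dist y < dist k" if k: "k \<noteq> i" for k
  proof (cases "dist k")
    case 0
    then show ?thesis using dist[of k] k by simp
  next
    case (Suc m)
    then obtain y where y: "(k, y) \<in> E" "(y, i) \<in> E ^^ m"
      using dist[of k] relpow_Suc_D2[of k i m E] by auto
    then have "dist y \<le> m" unfolding dist_def by (intro Least_le)
    with y Suc show ?thesis by auto
  qed
  then obtain p where p: "\<And>k. k \<noteq> i \<Longrightarrow> (k, p k) \<in> E \<and> dist (p k) < dist k" by metis
  have "\<exists>m. (p ^^ m) r = i" for r
  proof (induction "dist r" arbitrary: r rule: less_induct)
    case less
    show ?case
    proof (cases "r = i")
      case True then show ?thesis by (intro exI[of _ 0]) simp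
    next
      case False
      then obtain m where "(p ^^ m) (p r) = i" using less[of "p r"] p by auto
      then show ?thesis by (intro exI[of _ "Suc m"]) (simp add: funpow_swap1)
    qed
  qed
  with p show thesis using that by blast
qed

lemma polyfun_compartmental: "polyfun UNIV (\<lambda>z. compartmental E (\<lambda>e. z (f e)) (\<lambda>_. 0) $ i $ j)"
proof -
  have "polyfun UNIV (\<lambda>z. - (\<Sum>k | (i, k) \<in> E. z (f (i, k))))"
    using polyfun_mult[OF polyfun_const[of UNIV "-1"]
        polyfun_sum[OF polyfun_var, of "{k. (i, k) \<in> E}" "\<lambda>k. f (i, k)" UNIV]] by simp
  then show ?thesis
    by (cases "i = j"; cases "(j, i) \<in> E") (simp_all add: compartmental_def polyfun_const polyfun_var)
qed

text \<open>In-tree rates depend on the root, but each determinant is a nonzero polynomial in the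
  rates, so their product is nonzero somewhere. Having one choice of rates for all vertices is
  essential for time reversal, where no entry of the null vector may vanish.\<close>

lemma all_vertices_observable:
  fixes E :: "('n :: finite \<times> 'n) set"
  assumes "irrefl E" "strongly_connected E"
  shows "\<exists>a :: 'n \<times> 'n \<Rightarrow> complex. \<forall>i. det (obs_matrix (compartmental E a (\<lambda>_. 0)) i) \<noteq> 0"
proof -
  let ?F = "\<lambda>z :: nat \<Rightarrow> complex. compartmental E (\<lambda>e. z (index_of e)) (\<lambda>_. 0) :: complex^'n^'n"
  have "\<exists>q :: nat cpoly. \<forall>z. poly_eval z q = det (obs_matrix (?F z) i)" for i
    using polyfun_det_obs[OF polyfun_compartmental] unfolding polyfun_def by blast
  then obtain q :: "'n \<Rightarrow> nat cpoly" where q: "\<And>i z. poly_eval z (q i) = det (obs_matrix (?F z) i)" by metis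
  have "q i \<noteq> 0" for i
  proof -
    obtain p where p: "\<And>k. k \<noteq> i \<Longrightarrow> (k, p k) \<in> E" "\<And>r. \<exists>m. (p ^^ m) r = i"
      using strongly_connected_in_tree[OF assms(2)] by blast
    obtain a :: "'n \<times> 'n \<Rightarrow> complex" where a: "det (obs_matrix (compartmental E a (\<lambda>_. 0)) i) \<noteq> 0"
      using in_tree_observable[OF assms(1) p] by blast
    define z where "z = (\<lambda>k. a (the_inv index_of k))"
    have "z (index_of e) = a e" for e
      unfolding z_def by (subst the_inv_f_f) (auto simp: inj_def index_of_inj)
    then have "poly_eval z (q i) \<noteq> 0" using a by (simp add: q)
    then show ?thesis by auto
  qed
  then have "(\<Prod>i\<in>UNIV. q i) \<noteq> 0" by simp
  then obtain z where z: "poly_eval z (\<Prod>i\<in>UNIV. q i) \<noteq> 0" using poly_nonvanishing_point by blast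
  have "poly_eval z (q i) \<noteq> 0" for i
  proof
    assume "poly_eval z (q i) = 0"
    moreover have "(\<Prod>i\<in>UNIV. q i) = q i * (\<Prod>i\<in>UNIV - {i}. q i)" by (subst prod.remove[of _ i]) auto
    ultimately show False using z by simp
  qed
  then show ?thesis by (intro exI[of _ "\<lambda>e. z (index_of e)"]) (simp add: q)
qed

text \<open>
  Time reversal: conjugating the transpose of a leak-free compartmental matrix by its null vector
  gives a leak-free compartmental matrix of the reversed graph, so that controllability follows
  from observability for the reversed graph.
\<close>

lemma strongly_connected_controllable:
  fixes E :: "('n :: finite \<times> 'n) set"
  assumes "irrefl E" "strongly_connected E"
  shows "\<exists>a :: 'n \<times> 'n \<Rightarrow> complex. det (obs_matrix (transpose (compartmental E a (\<lambda>_. 0))) j) \<noteq> 0"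
proof -
  have "irrefl (E\<inverse>)" using assms(1) by (auto simp: irrefl_def)
  moreover have "strongly_connected (E\<inverse>)"
    using assms(2) by (auto simp: strongly_connected_def rtrancl_converse)
  ultimately obtain b :: "'n \<times> 'n \<Rightarrow> complex"
    where b: "\<And>i. det (obs_matrix (compartmental (E\<inverse>) b (\<lambda>_. 0)) i) \<noteq> 0"
    using all_vertices_observable by blast
  define B where "B = compartmental (E\<inverse>) b (\<lambda>_. 0)"
  have offdiag: "B $ y $ x = (if (y, x) \<in> E then b (x, y) else 0)" if "x \<noteq> y" for x y
    using that by (simp add: B_def compartmental_def)
  \<comment> \<open>Without leaks mass is conserved: columns sum to 0, so \<open>B\<close> is
    singular and has a null vector.\<close>
  have colsum: "(\<Sum>x\<in>UNIV. B $ x $ y) = 0" for y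
  proof -
    have "(\<Sum>x\<in>UNIV. B $ x $ y) = B $ y $ y + (\<Sum>x\<in>UNIV - {y}. B $ x $ y)"
      by (intro sum.remove) auto
    also have "(\<Sum>x\<in>UNIV - {y}. B $ x $ y) = (\<Sum>x\<in>UNIV - {y}. if (x, y) \<in> E then b (y, x) else 0)"
      by (intro sum.cong refl offdiag) auto
    also have "\<dots> = (\<Sum>k | (y, k) \<in> E\<inverse>. b (y, k))"
      using assms(1) by (subst sum.inter_filter[symmetric]) (auto simp: irrefl_def intro!: sum.cong)
    finally show ?thesis by (simp add: B_def compartmental_def)
  qed
  have "det B = 0"
  proof (rule ccontr)
    assume "det B \<noteq> 0"
    moreover have "(\<chi> x. 1) v* B = 0" using colsum by (simp add: vec_eq_iff vector_matrix_mult_def)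
    ultimately have "(\<chi> x. 1) = (0 :: complex^'n)" by (rule det_nonzero_left_kernel)
    then show False by (simp add: vec_eq_iff)
  qed
  then have "\<not> (\<forall>v. v v* transpose B = 0 \<longrightarrow> v = 0)"
    using det_nonzeroI_left_kernel[of "transpose B"] by auto
  then obtain \<pi> where \<pi>: "B *v \<pi> = 0" "\<pi> \<noteq> 0" by auto
  \<comment> \<open>A null vector vanishing at \<open>i\<close> would be invisible from
    \<open>i\<close>, against observability there.\<close>
  have \<pi>_nz: "\<pi> $ i \<noteq> 0" for i
  proof
    assume "\<pi> $ i = 0"
    have eig: "B *v \<pi> = 0 *s \<pi>" using \<pi> by simp
    have "obs_matrix B i *v \<pi> = 0"
      using \<open>\<pi> $ i = 0\<close>
      by (simp add: vec_eq_iff obs_matrix_def matrix_vector_mult_def row_iter_eigenvector[OF eig] sum_axis)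
    then show False using b[of i] \<pi> det_nonzero_right_kernel unfolding B_def by blast
  qed
  \<comment> \<open>Chosen so that A = D B^T D^(-1) with D = diag \<pi>. Off the diagonal this is
    immediate; on the diagonal it is the equation B \<pi> = 0.\<close>
  define a where "a = (\<lambda>(y, x). \<pi> $ x * b (x, y) / \<pi> $ y)"
  define A where "A = compartmental E a (\<lambda>_. 0)"
  have A: "A $ x $ y = \<pi> $ x * B $ y $ x / \<pi> $ y" for x y
  proof (cases "x = y")
    case False
    then show ?thesis by (simp add: A_def compartmental_def a_def offdiag)
  next
    case True
    have "0 = (\<Sum>k\<in>UNIV. B $ y $ k * \<pi> $ k)"
      using \<pi>(1) by (simp add: vec_eq_iff matrix_vector_mult_def)
    also have "\<dots> = B $ y $ y * \<pi> $ y + (\<Sum>k\<in>UNIV - {y}. B $ y $ k * \<pi> $ k)"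
      by (intro sum.remove) auto
    also have "(\<Sum>k\<in>UNIV - {y}. B $ y $ k * \<pi> $ k) = (\<Sum>k\<in>UNIV - {y}. if (y, k) \<in> E then b (k, y) * \<pi> $ k else 0)"
      by (intro sum.cong refl) (auto simp: offdiag)
    also have "\<dots> = (\<Sum>k | (y, k) \<in> E. b (k, y) * \<pi> $ k)"
      using assms(1) by (subst sum.inter_filter[symmetric]) (auto simp: irrefl_def intro!: sum.cong)
    finally have "(\<Sum>k | (y, k) \<in> E. b (k, y) * \<pi> $ k) = - (B $ y $ y * \<pi> $ y)"
      by (simp add: eq_neg_iff_add_eq_0 add.commute)
    then have "(\<Sum>k | (y, k) \<in> E. a (y, k)) = - B $ y $ y"
      using \<pi>_nz[of y] by (simp add: a_def mult.commute flip: sum_divide_distrib)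
    then show ?thesis using True \<pi>_nz[of y] by (simp add: A_def compartmental_def)
  qed
  have row: "row_iter (transpose A) (axis j 1) m $ l = \<pi> $ l / \<pi> $ j * row_iter B (axis j 1) m $ l" for m l
  proof (induction m arbitrary: l)
    case 0
    then show ?case using \<pi>_nz by (simp add: axis_def)
  next
    case (Suc m)
    have "transpose A $ r $ l = \<pi> $ l * B $ r $ l / \<pi> $ r" for r
      by (simp add: transpose_def A)
    then show ?case
      using \<pi>_nz
      by (simp only: row_iter_Suc vector_matrix_mult_def vec_lambda_beta Suc sum_distrib_left)
         (intro sum.cong refl, simp add: field_simps)
  qed
  have "det (obs_matrix (transpose A) j) \<noteq> 0"
  proof (rule det_nonzeroI_left_kernel)
    fix c assume c: "c v* obs_matrix (transpose A) j = 0"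
    have "(c v* obs_matrix B j) $ l = 0" for l
    proof -
      have "(c v* obs_matrix (transpose A) j) $ l = \<pi> $ l / \<pi> $ j * (c v* obs_matrix B j) $ l"
        by (simp add: vector_matrix_mult_def obs_matrix_def row sum_distrib_left ac_simps)
      then show ?thesis using c \<pi>_nz by simp
    qed
    then have "c v* obs_matrix B j = 0" by (simp add: vec_eq_iff)
    then show "c = 0" using b[of j] det_nonzero_left_kernel unfolding B_def by blast
  qed
  then show ?thesis unfolding A_def by blast
qed

text \<open>Parameter indices of edges are distinct and differ from those of leaks, so edge rates
  can be prescribed while all leaks are switched off.\<close>

lemma comp_at_surj:
  assumes "linear_compartment_model M"
  shows "\<exists>\<mu>. comp_at M \<mu> = compartmental (edges M) a (\<lambda>_. 0)"
proof -
  define \<mu> where "\<mu> = (\<lambda>k. if k \<in> edge_par M ` edges M then a (inv_into (edges M) (edge_par M) k) else 0)"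
  have 1: "\<mu> (edge_par M e) = a e" if "e \<in> edges M" for e
    using assms that by (simp add: \<mu>_def linear_compartment_model_def)
  have 2: "\<mu> (leak_par M i) = 0" if "i \<in> leaks M" for i
    using assms that by (auto simp: \<mu>_def linear_compartment_model_def)
  have "comp_at M \<mu> = compartmental (edges M) a (\<lambda>_. 0)"
    using 2 by (auto simp: comp_at_def compartmental_def vec_eq_iff 1)
  then show ?thesis by blast
qed

text \<open>A single specialization with nonzero determinant rules out that the determinant vanishes
  as a rational function.\<close>

lemma comp_matrix_observable:
  assumes "linear_compartment_model M" "strongly_connected (edges M)"
  shows "det (obs_matrix (comp_matrix M) i) \<noteq> 0"
proof -
  have "irrefl (edges M)" using assms(1) by (simp add: linear_compartment_model_def)
  then obtain a where a: "det (obs_matrix (compartmental (edges M) a (\<lambda>_. 0 :: complex)) i) \<noteq> 0"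
    using all_vertices_observable assms(2) by blast
  obtain \<mu> where "comp_at M \<mu> = compartmental (edges M) a (\<lambda>_. 0)" using comp_at_surj[OF assms(1)] by blast
  then show ?thesis using ratval_det_obs[OF ratval_comp, of \<mu> M i] a ratval_unique ratval_0 by metis
qed

lemma comp_matrix_controllable:
  assumes "linear_compartment_model M" "strongly_connected (edges M)"
  shows "det (obs_matrix (transpose (comp_matrix M)) j) \<noteq> 0"
proof -
  have "irrefl (edges M)" using assms(1) by (simp add: linear_compartment_model_def)
  then obtain a where a: "det (obs_matrix (transpose (compartmental (edges M) a (\<lambda>_. 0 :: complex))) j) \<noteq> 0"
    using strongly_connected_controllable assms(2) by blast
  obtain \<mu> where \<mu>: "comp_at M \<mu> = compartmental (edges M) a (\<lambda>_. 0)" using comp_at_surj[OF assms(1)] by blast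
  have "ratval \<mu> (transpose (comp_matrix M) $ i $ k) (transpose (comp_at M \<mu>) $ i $ k)" for i k
    by (simp add: transpose_def ratval_comp)
  then have "ratval \<mu> (det (obs_matrix (transpose (comp_matrix M)) j)) (det (obs_matrix (transpose (comp_at M \<mu>)) j))"
    by (rule ratval_det_obs)
  then show ?thesis using \<mu> a ratval_unique ratval_0 by metis
qed

section \<open>Analytic solutions of linear systems\<close>

lemma fps_expansion_coeff_bound:
  fixes f :: "complex \<Rightarrow> complex"
  assumes "f has_fps_expansion F"
  shows "\<exists>K \<rho>. K \<ge> 0 \<and> \<rho> \<ge> 0 \<and> (\<forall>n. norm (fps_nth F n) \<le> K * \<rho> ^ n)"
proof -
  have "fps_conv_radius F > 0" using assms by (simp add: has_fps_expansion_def)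
  then obtain r where r: "0 < ereal r" "ereal r < fps_conv_radius F"
    using ereal_dense2 by blast
  then have "r > 0" by simp
  have "summable (\<lambda>n. fps_nth F n * of_real r ^ n)"
    using r by (intro summable_in_conv_radius) (simp add: fps_conv_radius_def)
  then have "Bseq (\<lambda>n. fps_nth F n * of_real r ^ n)"
    by (intro convergent_imp_Bseq) (auto dest: summable_LIMSEQ_zero simp: convergent_def)
  then obtain K where K: "K > 0" "\<And>n. norm (fps_nth F n * of_real r ^ n) \<le> K"
    unfolding Bseq_def by auto
  have "norm (fps_nth F n) \<le> K * (1 / r) ^ n" for n
    using K(2)[of n] \<open>r > 0\<close> by (simp add: norm_mult norm_power power_divide field_simps)
  then show ?thesis using K(1) \<open>r > 0\<close> by (intro exI[of _ K] exI[of _ "1 / r"]) auto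
qed

lemma fps_conv_radius_pos:
  fixes F :: "complex fps"
  assumes "\<And>n. norm (fps_nth F n) \<le> C * Q ^ n" "Q > 0"
  shows "fps_conv_radius F > 0"
proof -
  define z where "z = 1 / (2 * Q)"
  have "z > 0" using assms(2) by (simp add: z_def)
  have "summable (\<lambda>n. fps_nth F n * (of_real z :: complex) ^ n)"
  proof (rule summable_comparison_test)
    show "\<exists>N. \<forall>n\<ge>N. norm (fps_nth F n * (of_real z :: complex) ^ n) \<le> C * (1 / 2) ^ n"
    proof (intro exI allI impI)
      fix n
      have "norm (fps_nth F n * (of_real z :: complex) ^ n) \<le> C * Q ^ n * z ^ n"
        using assms(1)[of n] \<open>z > 0\<close> by (auto simp: norm_mult norm_power intro!: mult_right_mono)
      also have "\<dots> = C * (Q * z) ^ n" by (simp add: power_mult_distrib)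
      also have "Q * z = 1 / 2" using assms(2) by (simp add: z_def)
      finally show "norm (fps_nth F n * (of_real z :: complex) ^ n) \<le> C * (1 / 2) ^ n" .
    qed
    show "summable (\<lambda>n. C * (1 / 2 :: real) ^ n)"
      by (intro summable_mult summable_geometric) simp
  qed
  then have "conv_radius (fps_nth F) \<ge> norm (of_real z :: complex)" by (rule conv_radius_geI)
  moreover have "norm (of_real z :: complex) > 0" using assms(2) by (simp add: z_def)
  ultimately show ?thesis unfolding fps_conv_radius_def
    by (metis ereal_less(2) less_le_trans)
qed

text \<open>Power series method: the ODE gives a recursion for the coefficients, and a geometric
  bound on them yields a positive radius of convergence.\<close>

lemma linear_ode_solution:
  fixes A :: "complex^'n^'n" and f :: "'n \<Rightarrow> complex \<Rightarrow> complex"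
  assumes f: "\<And>i. f i analytic_on {0}"
  shows "\<exists>x. (\<forall>i. x i analytic_on {0}) \<and>
     (\<forall>i. \<forall>\<^sub>F t in nhds 0. (x i has_field_derivative ((\<Sum>j\<in>UNIV. A $ i $ j * x j t) + f i t)) (at t)) \<and>
     (\<forall>i. x i 0 = x0 i)"
proof -
  define w where "w = (\<lambda>i. fps_nth (fps_expansion (f i) 0))"
  have wf: "f i has_fps_expansion fps_expansion (f i) 0" for i
    using f by (rule analytic_at_imp_has_fps_expansion_0)
  obtain K' \<rho>' where "\<forall>i. K' i \<ge> 0 \<and> \<rho>' i \<ge> 0 \<and> (\<forall>n. norm (w i n) \<le> K' i * \<rho>' i ^ n)"
    using fps_expansion_coeff_bound[OF wf] unfolding w_def by metis
  then have K': "\<And>i. K' i \<ge> 0" "\<And>i. \<rho>' i \<ge> 0" "\<And>i n. norm (w i n) \<le> K' i * \<rho>' i ^ n" by auto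
  define K where "K = (\<Sum>i\<in>UNIV. K' i)"
  define \<rho> where "\<rho> = (\<Sum>i\<in>UNIV. \<rho>' i)"
  have \<rho>: "\<rho>' i \<le> \<rho>" for i unfolding \<rho>_def using K' by (intro member_le_sum) auto
  have W: "(\<Sum>i\<in>UNIV. norm (w i n)) \<le> K * \<rho> ^ n" for n
  proof -
    have "norm (w i n) \<le> K' i * \<rho> ^ n" for i
      using K' \<rho> by (meson mult_left_mono order_trans power_mono)
    then show ?thesis unfolding K_def sum_distrib_right by (intro sum_mono)
  qed
  define c where "c = rec_nat x0 (\<lambda>k c i. ((\<Sum>j\<in>UNIV. A $ i $ j * c j) + w i k) / of_nat (Suc k))"
  have c0: "c 0 = x0" and cS: "c (Suc k) i = ((\<Sum>j\<in>UNIV. A $ i $ j * c k j) + w i k) / of_nat (Suc k)" for k i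
    by (simp_all add: c_def)
  define a where "a = (\<Sum>i\<in>UNIV. \<Sum>j\<in>UNIV. norm (A $ i $ j))"
  \<comment> \<open>At least \<rho>, to dominate the input coefficients, and at least a + 1, to
    absorb both terms of the recursive estimate; \<open>C\<close> below dominates the initial norm
    and \<open>K\<close>.\<close>
  define Q where "Q = a + \<rho> + 1"
  define S where "S = (\<lambda>k. \<Sum>i\<in>UNIV. norm (c k i))"
  define C where "C = S 0 + K"
  have pos: "a \<ge> 0" "\<rho> \<ge> 0" "K \<ge> 0" "S k \<ge> 0" for k
    using K' by (auto simp: a_def \<rho>_def K_def S_def intro!: sum_nonneg)
  have S_Suc: "S (Suc k) \<le> a * S k + K * \<rho> ^ k" for k
  proof -
    have "norm (c (Suc k) i) \<le> (\<Sum>j\<in>UNIV. norm (A $ i $ j)) * S k + norm (w i k)" for i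
    proof -
      have "norm (c (Suc k) i) \<le> norm ((\<Sum>j\<in>UNIV. A $ i $ j * c k j) + w i k)"
        unfolding cS norm_divide norm_of_nat by (simp add: field_simps)
      also have "\<dots> \<le> (\<Sum>j\<in>UNIV. norm (A $ i $ j) * norm (c k j)) + norm (w i k)"
        by (intro order_trans[OF norm_triangle_ineq] add_mono order_trans[OF norm_sum] order_refl)
           (simp add: norm_mult)
      also have "(\<Sum>j\<in>UNIV. norm (A $ i $ j) * norm (c k j)) \<le> (\<Sum>j\<in>UNIV. norm (A $ i $ j) * S k)"
        unfolding S_def by (intro sum_mono mult_left_mono member_le_sum) auto
      finally show ?thesis by (simp add: sum_distrib_right)
    qed
    then have "S (Suc k) \<le> (\<Sum>i\<in>UNIV. (\<Sum>j\<in>UNIV. norm (A $ i $ j)) * S k + norm (w i k))"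
      unfolding S_def by (intro sum_mono)
    also have "\<dots> = a * S k + (\<Sum>i\<in>UNIV. norm (w i k))"
      by (simp add: sum.distrib a_def sum_distrib_right)
    finally show ?thesis using W[of k] by simp
  qed
  have S_bound: "S k \<le> C * Q ^ k" for k
  proof (induction k)
    case 0 then show ?case using pos by (simp add: C_def)
  next
    case (Suc k)
    have "S (Suc k) \<le> a * (C * Q ^ k) + K * \<rho> ^ k"
      using S_Suc[of k] Suc mult_left_mono[OF Suc pos(1)] by linarith
    also have "K * \<rho> ^ k \<le> C * Q ^ k"
      using pos by (intro mult_mono power_mono) (auto simp: C_def Q_def)
    also have "a * (C * Q ^ k) + C * Q ^ k = (a + 1) * (C * Q ^ k)" by (simp add: algebra_simps)
    also have "\<dots> \<le> Q * (C * Q ^ k)"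
      using pos(1-3) pos(4)[of 0] by (intro mult_right_mono) (auto simp: Q_def C_def)
    finally show ?case by (simp add: algebra_simps)
  qed
  define F where "F = (\<lambda>i. Abs_fps (\<lambda>k. c k i))"
  have radius: "fps_conv_radius (F i) > 0" for i
  proof (rule fps_conv_radius_pos)
    fix n
    have "norm (c n i) \<le> S n" unfolding S_def by (intro member_le_sum) auto
    then show "norm (fps_nth (F i) n) \<le> C * Q ^ n" using S_bound[of n] by (simp add: F_def)
  qed (use pos in \<open>simp add: Q_def\<close>)
  define x where "x = (\<lambda>i. eval_fps (F i))"
  have xF: "x i has_fps_expansion F i" for i
    unfolding x_def using radius by (rule eval_fps_has_fps_expansion)
  have "(\<lambda>t. (\<Sum>j\<in>UNIV. A $ i $ j * x j t) + f i t) has_fps_expansion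
      (\<Sum>j\<in>UNIV. fps_const (A $ i $ j) * F j) + fps_expansion (f i) 0" for i
    by (intro has_fps_expansion_add has_fps_expansion_sum has_fps_expansion_cmult_left xF wf)
  moreover have "(\<Sum>j\<in>UNIV. fps_const (A $ i $ j) * F j) + fps_expansion (f i) 0 = fps_deriv (F i)" for i
    by (intro fps_ext) (simp add: F_def fps_sum_nth cS w_def del: of_nat_Suc)
  ultimately have rhs: "(\<lambda>t. (\<Sum>j\<in>UNIV. A $ i $ j * x j t) + f i t) has_fps_expansion fps_deriv (F i)" for i
    by simp
  have "\<forall>\<^sub>F t in nhds 0. (x i has_field_derivative ((\<Sum>j\<in>UNIV. A $ i $ j * x j t) + f i t)) (at t)" for i
  proof -
    have "\<forall>\<^sub>F t in nhds 0. t \<in> eball 0 (fps_conv_radius (F i))"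
      using radius by (intro eventually_nhds_in_open) (auto simp: zero_ereal_def)
    moreover have "\<forall>\<^sub>F t in nhds 0. eval_fps (fps_deriv (F i)) t = (\<Sum>j\<in>UNIV. A $ i $ j * x j t) + f i t"
      using rhs[of i] by (simp add: has_fps_expansion_def)
    ultimately show ?thesis
    proof eventually_elim
      case (elim t)
      then have "norm t < fps_conv_radius (F i)" by (simp add: in_eball_iff)
      then have "(eval_fps (F i) has_field_derivative eval_fps (fps_deriv (F i)) t) (at t)"
        by (rule has_field_derivative_eval_fps)
      with elim show ?case by (simp add: x_def)
    qed
  qed
  moreover have "x i analytic_on {0}" for i
    using xF by (rule has_fps_expansion_imp_analytic_0)
  moreover have "x i 0 = x0 i" for i by (simp add: x_def eval_fps_at_0 F_def c0)
  ultimately show ?thesis by blast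
qed

section \<open>From germs to sequences of derivatives at 0\<close>

lemma eventually_eq_iff_derivs:
  assumes "f analytic_on {0}" "g analytic_on {0}"
  shows "(\<forall>\<^sub>F t in nhds 0. f t = g t) \<longleftrightarrow> (\<forall>k. (deriv ^^ k) f 0 = (deriv ^^ k) g (0 :: complex))"
proof
  assume "\<forall>\<^sub>F t in nhds 0. f t = g t"
  then show "\<forall>k. (deriv ^^ k) f 0 = (deriv ^^ k) g 0" by (auto intro: higher_deriv_cong_ev)
next
  assume *: "\<forall>k. (deriv ^^ k) f 0 = (deriv ^^ k) g 0"
  have f: "f has_fps_expansion fps_expansion f 0" and g: "g has_fps_expansion fps_expansion g 0"
    using assms by (auto intro: analytic_at_imp_has_fps_expansion_0)
  have "fps_expansion f 0 = fps_expansion g 0"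
    using * fps_nth_fps_expansion[OF f] fps_nth_fps_expansion[OF g] by (intro fps_ext) simp
  then have "\<forall>\<^sub>F t in nhds 0. eval_fps (fps_expansion f 0) t = f t" "\<forall>\<^sub>F t in nhds 0. eval_fps (fps_expansion f 0) t = g t"
    using f g by (auto simp: has_fps_expansion_def)
  then show "\<forall>\<^sub>F t in nhds 0. f t = g t" by eventually_elim simp
qed

lemma higher_deriv_cmult_0:
  assumes "f analytic_on {0}"
  shows "(deriv ^^ k) (\<lambda>t. c * f t) 0 = c * (deriv ^^ k) f (0 :: complex)"
proof -
  have f: "f has_fps_expansion fps_expansion f 0"
    using assms by (rule analytic_at_imp_has_fps_expansion_0)
  show ?thesis
    using fps_nth_fps_expansion[OF f, of k] fps_nth_fps_expansion[OF has_fps_expansion_cmult_left[OF f, of c], of k]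
    by (simp add: field_simps)
qed

lemma linear_ode_derivs:
  fixes A :: "complex^'n^'n" and f x :: "'n \<Rightarrow> complex \<Rightarrow> complex"
  assumes "\<And>i. f i analytic_on {0}" "\<And>i. x i analytic_on {0}"
    and ode: "\<And>i. \<forall>\<^sub>F t in nhds 0. (x i has_field_derivative ((\<Sum>j\<in>UNIV. A $ i $ j * x j t) + f i t)) (at t)"
  shows "(deriv ^^ Suc k) (x i) 0 = (\<Sum>j\<in>UNIV. A $ i $ j * (deriv ^^ k) (x j) 0) + (deriv ^^ k) (f i) 0"
proof -
  have f: "f i has_fps_expansion fps_expansion (f i) 0" and x: "x i has_fps_expansion fps_expansion (x i) 0" for i
    using assms(1,2) by (auto intro: analytic_at_imp_has_fps_expansion_0)
  have "\<forall>\<^sub>F t in nhds 0. deriv (x i) t = (\<Sum>j\<in>UNIV. A $ i $ j * x j t) + f i t"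
    using ode[of i] by eventually_elim (rule DERIV_imp_deriv)
  then have "(deriv ^^ k) (deriv (x i)) 0 = (deriv ^^ k) (\<lambda>t. (\<Sum>j\<in>UNIV. A $ i $ j * x j t) + f i t) 0"
    by (intro higher_deriv_cong_ev) auto
  also have "\<dots> = fact k * fps_nth ((\<Sum>j\<in>UNIV. fps_const (A $ i $ j) * fps_expansion (x j) 0) + fps_expansion (f i) 0) k"
  proof -
    have "(\<lambda>t. (\<Sum>j\<in>UNIV. A $ i $ j * x j t) + f i t) has_fps_expansion
        (\<Sum>j\<in>UNIV. fps_const (A $ i $ j) * fps_expansion (x j) 0) + fps_expansion (f i) 0"
      by (intro has_fps_expansion_add has_fps_expansion_sum has_fps_expansion_cmult_left x f)
    from fps_nth_fps_expansion[OF this, of k] show ?thesis by simp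
  qed
  also have "\<dots> = (\<Sum>j\<in>UNIV. A $ i $ j * (fact k * fps_nth (fps_expansion (x j) 0) k)) + fact k * fps_nth (fps_expansion (f i) 0) k"
    by (simp add: fps_sum_nth sum_distrib_left algebra_simps)
  also have "\<dots> = (\<Sum>j\<in>UNIV. A $ i $ j * (deriv ^^ k) (x j) 0) + (deriv ^^ k) (f i) 0"
    by (simp add: fps_nth_fps_expansion[OF x] fps_nth_fps_expansion[OF f])
  finally show ?thesis by (simp add: funpow_swap1)
qed

text \<open>The derivatives at \<open>0\<close> of a solution form a trajectory of a discrete-time system.\<close>

primrec state_seq :: "complex^'n^'n \<Rightarrow> (nat \<Rightarrow> complex^'n) \<Rightarrow> complex^'n \<Rightarrow> nat \<Rightarrow> complex^'n" where
  "state_seq A w x 0 = x"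
| "state_seq A w x (Suc k) = A *v state_seq A w x k + w k"

definition in_at :: "'n compartment_model \<Rightarrow> (nat \<Rightarrow> complex) \<Rightarrow> 'n \<Rightarrow> complex" where
  "in_at M \<mu> j = ratfun_eval (in_coeff M j) \<mu>"

definition out_at :: "'n compartment_model \<Rightarrow> (nat \<Rightarrow> complex) \<Rightarrow> 'n \<Rightarrow> complex" where
  "out_at M \<mu> i = ratfun_eval (out_coeff M i) \<mu>"

definition input_seq :: "'n :: finite compartment_model \<Rightarrow> (nat \<Rightarrow> complex) \<Rightarrow> ('n \<Rightarrow> complex \<Rightarrow> complex) \<Rightarrow> nat \<Rightarrow> complex^'n" where
  "input_seq M \<mu> u k = (\<chi> i. if i \<in> inputs M then in_at M \<mu> i * (deriv ^^ k) (u i) 0 else 0)"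

lemma system_output_derivs:
  fixes M :: "'n :: finite compartment_model"
  assumes u: "u \<in> input_tuples M"
  shows "system_output M x0 \<mu> u i analytic_on {0}"
    and "(deriv ^^ k) (system_output M x0 \<mu> u i) 0 =
      out_at M \<mu> i * state_seq (comp_at M \<mu>) (input_seq M \<mu> u) (\<chi> i. x0 i) k $ i"
proof -
  define f where "f = (\<lambda>i t. if i \<in> inputs M then in_at M \<mu> i * u i t else 0)"
  have f: "f i analytic_on {0}" for i
  proof (cases "i \<in> inputs M")
    case True
    then have "u i analytic_on {0}" using u by (auto simp: input_tuples_def analytic_at_0_def)
    then show ?thesis using True by (simp add: f_def analytic_on_mult)
  qed (simp add: f_def)
  have A: "ratfun_eval (comp_matrix M $ i $ j) \<mu> = comp_at M \<mu> $ i $ j" for i j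
    using ratval_comp by (rule ratfun_eval_eqI)
  have sol: "is_solution M x0 \<mu> u x \<longleftrightarrow> (\<forall>i. x i analytic_on {0}) \<and>
     (\<forall>i. \<forall>\<^sub>F t in nhds 0. (x i has_field_derivative ((\<Sum>j\<in>UNIV. comp_at M \<mu> $ i $ j * x j t) + f i t)) (at t)) \<and>
     (\<forall>i. x i 0 = x0 i)" for x
    by (simp add: is_solution_def analytic_at_0_def A f_def in_at_def)
  define x where "x = (SOME x. is_solution M x0 \<mu> u x)"
  have "\<exists>x. is_solution M x0 \<mu> u x"
    unfolding sol using f by (rule linear_ode_solution)
  then have "is_solution M x0 \<mu> u x" unfolding x_def by (rule someI_ex)
  then have x: "\<And>i. x i analytic_on {0}"
    "\<And>i. \<forall>\<^sub>F t in nhds 0. (x i has_field_derivative ((\<Sum>j\<in>UNIV. comp_at M \<mu> $ i $ j * x j t) + f i t)) (at t)"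
    "\<And>i. x i 0 = x0 i"
    unfolding sol by auto
  have out: "system_output M x0 \<mu> u i = (\<lambda>t. out_at M \<mu> i * x i t)"
    by (simp add: system_output_def x_def out_at_def fun_eq_iff)
  show "system_output M x0 \<mu> u i analytic_on {0}"
    unfolding out using x(1) by (intro analytic_on_mult) auto
  have "(deriv ^^ k) (x i) 0 = state_seq (comp_at M \<mu>) (input_seq M \<mu> u) (\<chi> i. x0 i) k $ i" for i
  proof (induction k arbitrary: i)
    case 0
    then show ?case by (simp add: x(3))
  next
    case (Suc k)
    have "(deriv ^^ k) (f i) 0 = input_seq M \<mu> u k $ i"
    proof (cases "i \<in> inputs M")
      case True
      then have "u i analytic_on {0}" using u by (auto simp: input_tuples_def analytic_at_0_def)
      then show ?thesis using True by (simp add: f_def input_seq_def higher_deriv_cmult_0)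
    next
      case False
      then show ?thesis using higher_deriv_cmult_0[of "\<lambda>_. 0" k 0] by (simp add: f_def input_seq_def)
    qed
    then show ?case
      using linear_ode_derivs[OF f x(1,2), of k i] by (simp add: Suc matrix_vector_mult_def del: funpow.simps)
  qed
  then show "(deriv ^^ k) (system_output M x0 \<mu> u i) 0 =
      out_at M \<mu> i * state_seq (comp_at M \<mu>) (input_seq M \<mu> u) (\<chi> i. x0 i) k $ i"
    unfolding out using x(1) by (simp add: higher_deriv_cmult_0)
qed

text \<open>After this point outputs are compared purely as sequences; solutions of the ODE no
  longer appear.\<close>

lemma same_output_iff:
  assumes "u \<in> input_tuples M"
  shows "same_output M (system_output M x \<mu> u) (system_output M x' \<mu>' u) \<longleftrightarrow>
    (\<forall>i\<in>outputs M. \<forall>k. out_at M \<mu> i * state_seq (comp_at M \<mu>) (input_seq M \<mu> u) (\<chi> i. x i) k $ i =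
       out_at M \<mu>' i * state_seq (comp_at M \<mu>') (input_seq M \<mu>' u) (\<chi> i. x' i) k $ i)"
  unfolding same_output_def
  using eventually_eq_iff_derivs[OF system_output_derivs(1)[OF assms] system_output_derivs(1)[OF assms]]
  by (simp add: system_output_derivs(2)[OF assms])

section \<open>Linear recurrences for the derivatives of inputs and outputs\<close>

text \<open>A polynomial in the shift operator, which on derivative sequences is the polynomial in
  d/dt.\<close>

definition poly_act :: "complex poly \<Rightarrow> (nat \<Rightarrow> complex) \<Rightarrow> nat \<Rightarrow> complex" where
  "poly_act p f m = (\<Sum>k\<le>degree p. coeff p k * f (m + k))"

lemma poly_act_altdef: "degree p \<le> N \<Longrightarrow> poly_act p f m = (\<Sum>k\<le>N. coeff p k * f (m + k))"
  unfolding poly_act_def by (intro sum.mono_neutral_left) (auto simp: coeff_eq_0)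

lemma poly_act_0 [simp]: "poly_act 0 f m = 0"
  by (simp add: poly_act_def)

lemma poly_act_add: "poly_act (p + q) f m = poly_act p f m + poly_act q f m"
proof -
  let ?N = "max (degree p) (degree q)"
  have "degree (p + q) \<le> ?N" by (rule degree_add_le_max)
  then show ?thesis by (simp add: poly_act_altdef[of _ ?N] sum.distrib algebra_simps)
qed

lemma poly_act_smult: "poly_act (smult c p) f m = c * poly_act p f m"
  using degree_smult_le[of c p] by (simp add: poly_act_altdef[of _ "degree p"] sum_distrib_left mult.assoc)

lemma poly_act_diff: "poly_act (p - q) f m = poly_act p f m - poly_act q f m"
  using poly_act_add[of p "- q" f m] poly_act_smult[of "-1" q f m] by simp

lemma poly_act_pCons: "poly_act (pCons a p) f m = a * f m + poly_act p f (Suc m)"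
proof -
  have "poly_act (pCons a p) f m = (\<Sum>k\<le>Suc (degree p). coeff (pCons a p) k * f (m + k))"
    by (intro poly_act_altdef degree_pCons_le)
  also have "\<dots> = a * f m + poly_act p f (Suc m)"
    by (subst sum.atMost_Suc_shift) (simp add: poly_act_def)
  finally show ?thesis .
qed

lemma poly_act_mult: "poly_act (p * q) f m = poly_act p (poly_act q f) m"
  by (induction p arbitrary: m rule: pCons_induct)
     (simp_all add: poly_act_pCons poly_act_add poly_act_smult)

lemma poly_act_sum: "poly_act (sum p I) f m = (\<Sum>i\<in>I. poly_act (p i) f m)"
  by (induction I rule: infinite_finite_induct) (auto simp: poly_act_add)

lemma poly_act_sum_right: "poly_act p (\<lambda>m. \<Sum>i\<in>I. f i m) m = (\<Sum>i\<in>I. poly_act p (f i) m)"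
  by (simp add: poly_act_def sum_distrib_left) (rule sum.swap)

lemma poly_act_mult_right: "poly_act p (\<lambda>m. c * f m) m = c * poly_act p f m"
  by (simp add: poly_act_def sum_distrib_left ac_simps)

text \<open>The input-output equation: the recursion reads (S - A) x = w with S the shift, and
  multiplying by the adjugate isolates one coordinate. The initial state disappears.\<close>

lemma char_poly_act_state_seq:
  fixes A :: "complex^'n^'n"
  shows "poly_act (char_poly A) (\<lambda>k. state_seq A w x k $ i) m =
    (\<Sum>l\<in>UNIV. poly_act (adjugate A i l) (\<lambda>k. w k $ l) m)"
proof -
  define y where "y = (\<lambda>r k. state_seq A w x k $ r)"
  have w: "w k $ l = (\<Sum>r\<in>UNIV. poly_act (char_matrix A $ l $ r) (y r) k)" for k l
  proof -
    have "poly_act (char_matrix A $ l $ r) (y r) k = (if l = r then y r (Suc k) else 0) - A $ l $ r * y r k" for r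
      by (simp add: char_matrix_def poly_act_diff poly_act_pCons)
    then have "(\<Sum>r\<in>UNIV. poly_act (char_matrix A $ l $ r) (y r) k) = y l (Suc k) - (\<Sum>r\<in>UNIV. A $ l $ r * y r k)"
      by (simp add: sum_subtractf)
    then show ?thesis by (simp add: y_def matrix_vector_mult_def)
  qed
  have "(\<Sum>l\<in>UNIV. poly_act (adjugate A i l) (\<lambda>k. w k $ l) m) =
      (\<Sum>l\<in>UNIV. \<Sum>r\<in>UNIV. poly_act (adjugate A i l * char_matrix A $ l $ r) (y r) m)"
    unfolding w poly_act_sum_right by (simp add: poly_act_mult)
  also have "\<dots> = (\<Sum>r\<in>UNIV. poly_act (\<Sum>l\<in>UNIV. adjugate A i l * char_matrix A $ l $ r) (y r) m)"
    by (subst sum.swap) (simp add: poly_act_sum)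
  also have "\<dots> = (\<Sum>r\<in>UNIV. if i = r then poly_act (char_poly A) (y r) m else 0)"
    unfolding adjugate_left by (intro sum.cong) auto
  finally show ?thesis by (simp add: y_def)
qed

section \<open>Generic inputs\<close>

text \<open>
  A Wronskian determinant at \<open>0\<close>: its row \<open>(j, k)\<close> is the sequence of derivatives of the \<open>j\<close>-th
  input, shifted by the number of \<open>k\<close>, which ranges over \<open>{..<2 * CARD('n)}\<close>.
\<close>

definition wronskian :: "('n :: finite \<Rightarrow> nat \<Rightarrow> complex) \<Rightarrow> complex" where
  "wronskian s = det (\<chi> a b. s (fst a) (index_of (snd a) + 2 * CARD('n) * index_of (fst b) + index_of (snd b))
     :: complex^('n \<times> bool \<times> 'n)^('n \<times> bool \<times> 'n))"

text \<open>The stacked coefficients of the \<open>q j\<close> form a left kernel vector of the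
  Wronskian matrix; its columns are the instances of \<open>rel\<close> for the first n 2n values of
  m.\<close>

lemma wronskian_independent:
  fixes s :: "'n :: finite \<Rightarrow> nat \<Rightarrow> complex"
  assumes W: "wronskian s \<noteq> 0"
    and deg: "\<And>j. degree (q j) < 2 * CARD('n)"
    and rel: "\<And>m. (\<Sum>j\<in>UNIV. poly_act (q j) (s j) m) = 0"
  shows "q j = 0"
proof -
  define F :: "complex^('n \<times> bool \<times> 'n)^('n \<times> bool \<times> 'n)" where
    "F = (\<chi> a b. s (fst a) (index_of (snd a) + 2 * CARD('n) * index_of (fst b) + index_of (snd b)))"
  define v :: "complex^('n \<times> bool \<times> 'n)" where "v = (\<chi> a. coeff (q (fst a)) (index_of (snd a)))"
  have bij: "bij_betw (index_of :: bool \<times> 'n \<Rightarrow> nat) UNIV {..<2 * CARD('n)}"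
    using bij_index_of[where 'n = "bool \<times> 'n"] by simp
  have "(v v* F) $ b = 0" for b
  proof -
    define m where "m = 2 * CARD('n) * index_of (fst b) + index_of (snd b)"
    have "(v v* F) $ b = (\<Sum>(j, k)\<in>(UNIV :: ('n \<times> bool \<times> 'n) set). coeff (q j) (index_of k) * s j (m + index_of k))"
      by (simp add: vector_matrix_mult_def v_def F_def m_def case_prod_beta ac_simps)
    also have "\<dots> = (\<Sum>j\<in>UNIV. \<Sum>k\<in>(UNIV :: (bool \<times> 'n) set). coeff (q j) (index_of k) * s j (m + index_of k))"
      by (subst sum.cartesian_product) simp
    also have "\<dots> = (\<Sum>j\<in>UNIV. \<Sum>k<2 * CARD('n). coeff (q j) k * s j (m + k))"
      by (intro sum.cong refl sum.reindex_bij_betw[OF bij])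
    also have "\<dots> = (\<Sum>j\<in>UNIV. poly_act (q j) (s j) m)"
    proof (intro sum.cong refl)
      fix j
      have "{..<2 * CARD('n)} = {..2 * CARD('n) - 1}" using deg[of j] by auto
      moreover have "degree (q j) \<le> 2 * CARD('n) - 1" using deg[of j] by simp
      ultimately show "(\<Sum>k<2 * CARD('n). coeff (q j) k * s j (m + k)) = poly_act (q j) (s j) m"
        by (simp add: poly_act_altdef)
    qed
    finally show ?thesis using rel by simp
  qed
  then have "v v* F = 0" by (simp add: vec_eq_iff)
  moreover have "det F \<noteq> 0" using W by (simp add: wronskian_def F_def)
  ultimately have "v = 0" by (rule det_nonzero_left_kernel[rotated])
  have "coeff (q j) (index_of k) = 0" for k :: "bool \<times> 'n"
  proof -
    have "coeff (q j) (index_of k) = v $ (j, k)" by (simp add: v_def)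
    also have "\<dots> = 0" using \<open>v = 0\<close> by simp
    finally show ?thesis .
  qed
  moreover have "\<exists>k :: bool \<times> 'n. index_of k = degree (q j)"
    using index_of_surj[where 'n = "bool \<times> 'n"] deg[of j] by simp
  ultimately have "lead_coeff (q j) = 0" by metis
  then show ?thesis by simp
qed

text \<open>The last position of block \<open>j\<close>. With a single 1 there, the Wronskian matrix
  becomes a permutation matrix: the entry in row (j, k) and column (j', k') is 1 exactly if j' = j
  and the numbers of k and k' add up to 2n - 1.\<close>

definition special_exponent :: "'n :: finite \<Rightarrow> nat" where
  "special_exponent j = 2 * CARD('n) * index_of j + (2 * CARD('n) - 1)"

definition special_seq :: "'n :: finite \<Rightarrow> nat \<Rightarrow> complex" where
  "special_seq j m = (if m = special_exponent j then 1 else 0)"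

lemma wronskian_special_seq: "wronskian (special_seq :: 'n :: finite \<Rightarrow> nat \<Rightarrow> complex) \<noteq> 0"
  unfolding wronskian_def
proof (rule det_nonzeroI_left_kernel)
  let ?N = "2 * CARD('n)"
  fix v :: "complex^('n \<times> bool \<times> 'n)"
  assume v: "v v* (\<chi> a b. special_seq (fst a) (index_of (snd a) + ?N * index_of (fst b) + index_of (snd b))
    :: complex^('n \<times> bool \<times> 'n)^('n \<times> bool \<times> 'n)) = 0"
  have less: "index_of k < ?N" for k :: "bool \<times> 'n"
    using index_of_less[of k] by simp
  have "v $ a = 0" for a
  proof -
    obtain j0 k0 where a: "a = (j0, k0)" by (cases a)
    obtain k' :: "bool \<times> 'n" where k': "index_of k' = ?N - 1 - index_of k0"
      using index_of_surj[where 'n = "bool \<times> 'n", of "?N - 1 - index_of k0"] by auto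
    have iff: "index_of k + ?N * index_of j0 + index_of k' = special_exponent j \<longleftrightarrow> j = j0 \<and> k = k0" for j k
    proof
      assume "index_of k + ?N * index_of j0 + index_of k' = special_exponent j"
      then have *: "index_of k + ?N * index_of j0 = index_of k0 + ?N * index_of j"
        using less[of k0] k' by (simp add: special_exponent_def)
      have "(index_of k + ?N * index_of j0) div ?N = index_of j0"
        "(index_of k0 + ?N * index_of j) div ?N = index_of j"
        using less[of k] less[of k0] by simp_all
      with * have "index_of j0 = index_of j" by simp
      moreover from this * have "index_of k = index_of k0" by simp
      ultimately show "j = j0 \<and> k = k0" by (simp add: index_of_inj)
    next
      assume "j = j0 \<and> k = k0"
      then show "index_of k + ?N * index_of j0 + index_of k' = special_exponent j"
        using less[of k0] k' by (simp add: special_exponent_def)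
    qed
    have "0 = (\<Sum>b\<in>UNIV. v $ b * special_seq (fst b) (index_of (snd b) + ?N * index_of j0 + index_of k'))"
      using arg_cong[OF v, of "\<lambda>w. w $ (j0, k')"] by (simp add: vector_matrix_mult_def)
    also have "\<dots> = (\<Sum>b\<in>UNIV. if b = a then v $ b else 0)"
      by (intro sum.cong refl) (auto simp: special_seq_def iff a)
    finally show ?thesis by simp
  qed
  then show "v = 0" by (simp add: vec_eq_iff)
qed

text \<open>Vertices without input are padded with \<open>special_seq\<close>, so the Wronskian is
  indexed by the whole type; the numerators at these vertices are set to 0.\<close>

definition deriv_seq :: "'n compartment_model \<Rightarrow> ('n :: finite \<Rightarrow> complex \<Rightarrow> complex) \<Rightarrow> 'n \<Rightarrow> nat \<Rightarrow> complex" where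
  "deriv_seq M u j m = (if j \<in> inputs M then (deriv ^^ m) (u j) 0 else special_seq j m)"

definition generic_inputs :: "'n :: finite compartment_model \<Rightarrow> ('n \<Rightarrow> complex \<Rightarrow> complex) set" where
  "generic_inputs M = {u \<in> input_tuples M. wronskian (deriv_seq M u) \<noteq> 0}"

lemma zariski_open_generic_inputs: "zariski_open_inputs M (generic_inputs M)"
proof -
  define S where "S = (\<lambda>(z :: 'a \<times> nat \<Rightarrow> complex) j m. if j \<in> inputs M then z (j, m) else special_seq j m)"
  have "polyfun (inputs M \<times> UNIV) (\<lambda>z. S z j m)" for j m
    by (cases "j \<in> inputs M") (auto simp: S_def intro: polyfun_var polyfun_const)
  then have "polyfun (inputs M \<times> UNIV) (\<lambda>z. wronskian (S z))"
    unfolding wronskian_def by (intro polyfun_det) simp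
  then obtain P where P: "P \<in> polys_in (inputs M \<times> UNIV)" "\<And>z. poly_eval z P = wronskian (S z)"
    unfolding polyfun_def by blast
  have "S (\<lambda>(i, k). (deriv ^^ k) (u i) 0) = deriv_seq M u" for u
    by (auto simp: S_def deriv_seq_def fun_eq_iff)
  then show ?thesis
    unfolding zariski_open_inputs_def generic_inputs_def using P by (intro bexI[of _ P]) auto
qed

lemma generic_inputs_nonempty: "generic_inputs M \<noteq> {}"
proof -
  define u where "u = restrict (\<lambda>j t. 1 / fact (special_exponent j) * t ^ special_exponent j :: complex) (inputs M)"
  have "u \<in> input_tuples M"
    by (auto simp: u_def input_tuples_def analytic_at_0_def intro!: analytic_intros)
  moreover have "deriv_seq M u = special_seq"
  proof (intro ext)
    fix j m
    show "deriv_seq M u j m = special_seq j m"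
    proof (cases "j \<in> inputs M")
      case True
      then have eq: "u j = (\<lambda>t. 1 / fact (special_exponent j) * t ^ special_exponent j)"
        by (simp add: u_def)
      have "u j has_fps_expansion fps_const (1 / fact (special_exponent j)) * fps_X ^ special_exponent j"
        unfolding eq by (intro has_fps_expansion_cmult_left has_fps_expansion_fps_X_power)
      from fps_nth_fps_expansion[OF this, of m]
      have "(deriv ^^ m) (u j) 0 = special_seq j m"
        by (auto simp: special_seq_def fps_X_power_nth field_simps split: if_splits)
      then show ?thesis using True by (simp add: deriv_seq_def)
    qed (simp add: deriv_seq_def)
  qed
  ultimately have "u \<in> generic_inputs M" using wronskian_special_seq by (simp add: generic_inputs_def)
  then show ?thesis by blast
qed

definition transfer_num_at :: "'n :: finite compartment_model \<Rightarrow> (nat \<Rightarrow> complex) \<Rightarrow> 'n \<Rightarrow> 'n \<Rightarrow> complex poly" where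
  "transfer_num_at M \<mu> i j = smult (out_at M \<mu> i * in_at M \<mu> j) (adjugate (comp_at M \<mu>) i j)"

text \<open>
  With \<open>\<chi>\<close>, \<open>N\<close> and \<open>\<chi>'\<close>, \<open>N'\<close> the denominators and numerators of the transfer functions at the two
  points, the input-output equations \<open>\<chi> y = N u\<close> and \<open>\<chi>' y = N' u\<close> combine to
  \<open>(\<chi>' N - \<chi> N') u = 0\<close>, whose coefficients vanish for generic inputs.
\<close>

lemma same_output_imp_same_transfer:
  fixes M :: "'n :: finite compartment_model"
  assumes u: "u \<in> generic_inputs M"
    and same: "same_output M (system_output M x \<mu> u) (system_output M x' \<mu>' u)"
    and i0: "i0 \<in> outputs M" and j0: "j0 \<in> inputs M"
    and nz: "out_at M \<mu> i0 \<noteq> 0" "in_at M \<mu> j0 \<noteq> 0"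
    and coprime: "coprime (adjugate (comp_at M \<mu>) i0 j0) (char_poly (comp_at M \<mu>))"
  shows "char_poly (comp_at M \<mu>) = char_poly (comp_at M \<mu>')"
    and "\<And>i j. i \<in> outputs M \<Longrightarrow> j \<in> inputs M \<Longrightarrow>
      transfer_num_at M \<mu> i j = transfer_num_at M \<mu>' i j"
proof -
  define N where "N = (\<lambda>\<mu> i j. if j \<in> inputs M then transfer_num_at M \<mu> i j else 0)"
  let ?\<chi> = "\<lambda>\<mu>. char_poly (comp_at M \<mu>)"
  let ?s = "deriv_seq M u"
  have u': "u \<in> input_tuples M" using u by (simp add: generic_inputs_def)
  have io: "poly_act (?\<chi> \<mu>) (\<lambda>k. out_at M \<mu> i * state_seq (comp_at M \<mu>) (input_seq M \<mu> u) x k $ i) m =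
      (\<Sum>j\<in>UNIV. poly_act (N \<mu> i j) (?s j) m)" for \<mu> x i m
  proof -
    have "out_at M \<mu> i * poly_act (adjugate (comp_at M \<mu>) i j) (\<lambda>k. input_seq M \<mu> u k $ j) m =
        poly_act (N \<mu> i j) (?s j) m" for j
    proof (cases "j \<in> inputs M")
      case True
      then have "(\<lambda>k. input_seq M \<mu> u k $ j) = (\<lambda>k. in_at M \<mu> j * ?s j k)"
        by (simp add: input_seq_def deriv_seq_def)
      then show ?thesis using True by (simp add: N_def transfer_num_at_def poly_act_smult poly_act_mult_right)
    next
      case False
      then show ?thesis by (simp add: N_def input_seq_def poly_act_def)
    qed
    then show ?thesis by (simp add: poly_act_mult_right char_poly_act_state_seq sum_distrib_left)
  qed
  have cross: "?\<chi> \<mu>' * N \<mu> i j = ?\<chi> \<mu> * N \<mu>' i j" if i: "i \<in> outputs M" for i j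
  proof -
    define y where "y = (\<lambda>k. out_at M \<mu> i * state_seq (comp_at M \<mu>) (input_seq M \<mu> u) (\<chi> i. x i) k $ i)"
    have y': "y = (\<lambda>k. out_at M \<mu>' i * state_seq (comp_at M \<mu>') (input_seq M \<mu>' u) (\<chi> i. x' i) k $ i)"
      using same i unfolding same_output_iff[OF u'] y_def by blast
    have 1: "poly_act (?\<chi> \<mu>) y = (\<lambda>m. \<Sum>j\<in>UNIV. poly_act (N \<mu> i j) (?s j) m)"
      unfolding y_def io by simp
    have 2: "poly_act (?\<chi> \<mu>') y = (\<lambda>m. \<Sum>j\<in>UNIV. poly_act (N \<mu>' i j) (?s j) m)"
      unfolding y' io by simp
    have "(\<Sum>j\<in>UNIV. poly_act (?\<chi> \<mu>' * N \<mu> i j - ?\<chi> \<mu> * N \<mu>' i j) (?s j) m) = 0" for m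
    proof -
      have "(\<Sum>j\<in>UNIV. poly_act (?\<chi> \<mu>' * N \<mu> i j) (?s j) m) = poly_act (?\<chi> \<mu>') (poly_act (?\<chi> \<mu>) y) m"
        unfolding 1 poly_act_sum_right by (simp add: poly_act_mult)
      also have "\<dots> = poly_act (?\<chi> \<mu>) (poly_act (?\<chi> \<mu>') y) m"
        unfolding poly_act_mult[symmetric] by (simp add: mult.commute)
      also have "\<dots> = (\<Sum>j\<in>UNIV. poly_act (?\<chi> \<mu> * N \<mu>' i j) (?s j) m)"
        unfolding 2 poly_act_sum_right by (simp add: poly_act_mult)
      finally show ?thesis by (simp add: poly_act_diff sum_subtractf)
    qed
    \<comment> \<open>Degree n for \<chi> plus less than n for a numerator: the reason for the size
      2n of the blocks of the Wronskian.\<close>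
    moreover have "degree (?\<chi> \<mu>' * N \<mu> i j - ?\<chi> \<mu> * N \<mu>' i j) < 2 * CARD('n)" for j
    proof -
      have "degree (N \<nu> i j) < CARD('n)" for \<nu>
        using degree_adjugate_less[of "comp_at M \<nu>" i j] by (simp add: N_def transfer_num_at_def)
      then have "degree (?\<chi> \<nu>' * N \<nu> i j) < 2 * CARD('n)" for \<nu> \<nu>'
        using degree_mult_le[of "?\<chi> \<nu>'" "N \<nu> i j"] unfolding degree_char_poly
        by (smt (verit) add_less_mono1 mult_2 nat_add_left_cancel_less order.strict_trans1)
      then show ?thesis by (intro degree_diff_less)
    qed
    moreover have "wronskian ?s \<noteq> 0" using u by (simp add: generic_inputs_def)
    ultimately have "?\<chi> \<mu>' * N \<mu> i j - ?\<chi> \<mu> * N \<mu>' i j = 0" for j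
      by (intro wronskian_independent[where q = "\<lambda>j. ?\<chi> \<mu>' * N \<mu> i j - ?\<chi> \<mu> * N \<mu>' i j"])
    then show ?thesis by simp
  qed
  \<comment> \<open>One regular entry at \<mu> suffices: \<chi> is coprime to its own numerator,
    hence divides \<chi>', and both are monic of degree n. Nothing generic is assumed at
    \<mu>'.\<close>
  have "?\<chi> \<mu> dvd smult (out_at M \<mu> i0 * in_at M \<mu> j0) (adjugate (comp_at M \<mu>) i0 j0 * ?\<chi> \<mu>')"
    using cross[OF i0, of j0] j0 by (simp add: N_def transfer_num_at_def mult.commute dvd_smult)
  then have "?\<chi> \<mu> dvd adjugate (comp_at M \<mu>) i0 j0 * ?\<chi> \<mu>'"
    using nz by (simp add: dvd_smult_iff)
  then have "?\<chi> \<mu> dvd ?\<chi> \<mu>'"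
    using coprime coprime_poly_dvd_mult coprime_commute by metis
  then show eq: "?\<chi> \<mu> = ?\<chi> \<mu>'"
    by (rule monic_dvd_antisym[OF _ _ lead_coeff_char_poly lead_coeff_char_poly]) (simp add: degree_char_poly)
  fix i j assume ij: "i \<in> outputs M" "j \<in> inputs M"
  have "N \<mu> i j = N \<mu>' i j"
    using cross[OF ij(1), of j] eq char_poly_nonzero[of "comp_at M \<mu>'"] by simp
  then show "transfer_num_at M \<mu> i j = transfer_num_at M \<mu>' i j"
    using ij by (simp add: N_def)
qed

text \<open>
  Equal transfer functions have equal Markov parameters. Writing the initial state as a combination
  of the vectors \<open>A\<^sup>k e\<^sub>j b\<^sub>j\<close>, the matching initial state at the other point is the combination of
  the corresponding vectors there with the same coefficients.
\<close>

lemma same_transfer_imp_same_output: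
  fixes M :: "'n :: finite compartment_model"
  assumes u: "u \<in> input_tuples M"
    and j0: "j0 \<in> inputs M" "in_at M \<mu> j0 \<noteq> 0"
    and ctr: "det (obs_matrix (transpose (comp_at M \<mu>)) j0) \<noteq> 0"
    and \<chi>: "char_poly (comp_at M \<mu>) = char_poly (comp_at M \<mu>')"
    and N: "\<And>i j. i \<in> outputs M \<Longrightarrow> j \<in> inputs M \<Longrightarrow>
      transfer_num_at M \<mu> i j = transfer_num_at M \<mu>' i j"
  shows "\<exists>x'. same_output M (system_output M x \<mu> u) (system_output M x' \<mu>' u)"
proof -
  let ?A = "comp_at M \<mu>" and ?A' = "comp_at M \<mu>'"
  have markov: "out_at M \<mu> i * in_at M \<mu> j * row_iter ?A (axis i 1) m $ j =
      out_at M \<mu>' i * in_at M \<mu>' j * row_iter ?A' (axis i 1) m $ j"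
    if "i \<in> outputs M" "j \<in> inputs M" for i j m
    using markov_determined[OF \<chi> N[OF that, unfolded transfer_num_at_def]] .
  define x0 :: "complex^'n" where "x0 = (\<chi> i. x i)"
  obtain d where d: "d v* obs_matrix (transpose ?A) j0 = x0"
    using det_nonzero_left_surj[OF ctr] by blast
  \<comment> \<open>Rows of \<open>obs_matrix\<close> lack the factor b_j, so it is divided out here
    and put back with each point's own value.\<close>
  define e where "e = (\<lambda>k. d $ k / in_at M \<mu> j0)"
  define x1 :: "complex^'n" where
    "x1 = (\<chi> l. \<Sum>k\<in>UNIV. e k * in_at M \<mu>' j0 * row_iter (transpose ?A') (axis j0 1) (index_of k) $ l)"
  have x0: "x0 $ l = (\<Sum>k\<in>UNIV. e k * in_at M \<mu> j0 * row_iter (transpose ?A) (axis j0 1) (index_of k) $ l)" for l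
    using j0(2) by (simp add: d[symmetric] vector_matrix_mult_def obs_matrix_def e_def mult.commute)
  have shift: "(\<Sum>l\<in>UNIV. row_iter B (axis i 1) m $ l * (\<Sum>k\<in>UNIV. f k * row_iter (transpose B) (axis j0 1) (index_of k) $ l)) =
      (\<Sum>k\<in>UNIV. f k * row_iter B (axis i 1) (m + index_of k) $ j0)"
    for B :: "complex^'n^'n" and f :: "'n \<Rightarrow> complex" and i m
  proof -
    have "(\<Sum>l\<in>UNIV. row_iter B (axis i 1) m $ l * (\<Sum>k\<in>UNIV. f k * row_iter (transpose B) (axis j0 1) (index_of k) $ l)) =
      (\<Sum>k\<in>UNIV. f k * (\<Sum>l\<in>UNIV. row_iter B (axis i 1) m $ l * row_iter (transpose B) (axis j0 1) (index_of k) $ l))"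
      unfolding sum_distrib_left by (subst sum.swap) (simp add: ac_simps)
    then show ?thesis by (simp add: row_iter_transpose[symmetric] row_iter_add)
  qed
  define X where "X = state_seq ?A (input_seq M \<mu> u) x0"
  define X' where "X' = state_seq ?A' (input_seq M \<mu>' u) x1"
  have step: "(\<Sum>l\<in>UNIV. row_iter B (axis i 1) m $ l * (B *v z + w) $ l) =
      (\<Sum>l\<in>UNIV. row_iter B (axis i 1) (Suc m) $ l * z $ l) + (\<Sum>l\<in>UNIV. row_iter B (axis i 1) m $ l * w $ l)"
    for B :: "complex^'n^'n" and z w i m
  proof -
    have "(\<Sum>l\<in>UNIV. row_iter B (axis i 1) m $ l * (B *v z) $ l) =
        (\<Sum>l\<in>UNIV. row_iter B (axis i 1) (Suc m) $ l * z $ l)"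
      unfolding row_iter_Suc
      by (simp add: matrix_vector_mult_def vector_matrix_mult_def sum_distrib_left sum_distrib_right mult.assoc)
         (rule sum.swap)
    then show ?thesis by (simp add: distrib_left sum.distrib)
  qed
  \<comment> \<open>All observations e_i^T A^m are compared at once, since a step of the recursion
    raises m.\<close>
  have all: "out_at M \<mu> i * (\<Sum>l\<in>UNIV. row_iter ?A (axis i 1) m $ l * X k $ l) =
      out_at M \<mu>' i * (\<Sum>l\<in>UNIV. row_iter ?A' (axis i 1) m $ l * X' k $ l)"
    if i: "i \<in> outputs M" for i m k
  proof (induction k arbitrary: m)
    case 0
    have "out_at M \<mu> i * (\<Sum>l\<in>UNIV. row_iter ?A (axis i 1) m $ l * X 0 $ l) =
        (\<Sum>k\<in>UNIV. e k * (out_at M \<mu> i * in_at M \<mu> j0 * row_iter ?A (axis i 1) (m + index_of k) $ j0))"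
      unfolding X_def state_seq.simps x0 shift by (simp add: sum_distrib_left ac_simps)
    also have "\<dots> = (\<Sum>k\<in>UNIV. e k * (out_at M \<mu>' i * in_at M \<mu>' j0 * row_iter ?A' (axis i 1) (m + index_of k) $ j0))"
      by (simp only: markov[OF i j0(1)])
    also have "\<dots> = out_at M \<mu>' i * (\<Sum>l\<in>UNIV. row_iter ?A' (axis i 1) m $ l * X' 0 $ l)"
      unfolding X'_def state_seq.simps x1_def vec_lambda_beta shift by (simp add: sum_distrib_left ac_simps)
    finally show ?case .
  next
    case (Suc k)
    have "out_at M \<nu> i * (\<Sum>l\<in>UNIV. row_iter (comp_at M \<nu>) (axis i 1) m $ l * input_seq M \<nu> u k $ l) =
        (\<Sum>l\<in>UNIV. if l \<in> inputs M then out_at M \<nu> i * in_at M \<nu> l * row_iter (comp_at M \<nu>) (axis i 1) m $ l * (deriv ^^ k) (u l) 0 else 0)" for \<nu>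
      unfolding sum_distrib_left by (intro sum.cong) (auto simp: input_seq_def)
    then have "out_at M \<mu> i * (\<Sum>l\<in>UNIV. row_iter ?A (axis i 1) m $ l * input_seq M \<mu> u k $ l) =
        out_at M \<mu>' i * (\<Sum>l\<in>UNIV. row_iter ?A' (axis i 1) m $ l * input_seq M \<mu>' u k $ l)"
      using markov[OF i] by (simp cong: if_cong)
    then show ?case
      using Suc[of "Suc m"] unfolding X_def X'_def state_seq.simps step by (simp only: distrib_left)
  qed
  have "out_at M \<mu> i * X k $ i = out_at M \<mu>' i * X' k $ i" if "i \<in> outputs M" for i k
    using all[OF that, of 0 k] by (simp add: sum_axis)
  then have "same_output M (system_output M x \<mu> u) (system_output M (\<lambda>i. x1 $ i) \<mu>' u)"
    unfolding same_output_iff[OF u] by (simp add: X_def X'_def x0_def)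
  then show ?thesis by blast
qed

section \<open>The coefficients of the transfer function matrix\<close>

definition transfer_num :: "'n :: finite compartment_model \<Rightarrow> 'n \<Rightarrow> 'n \<Rightarrow> ratfun poly" where
  "transfer_num M i j = smult (out_coeff M i * in_coeff M j) (adjugate (comp_matrix M) i j)"

lemma transfer_matrix_entry:
  assumes "i \<in> outputs M" "j \<in> inputs M"
  shows "transfer_matrix M $ i $ j = Fract (transfer_num M i j) (char_poly (comp_matrix M))"
proof -
  let ?A = "comp_matrix M"
  define F where "F = (\<chi> i j. to_fract (char_matrix ?A $ i $ j))"
  have F: "mat (to_fract [:0, 1:]) - const_in_s ?A = F"
    by (simp add: F_def vec_eq_iff mat_def const_in_s_def char_matrix_def)
  define R where "R = matrix_inv F"
  have "\<exists>R. F ** R = mat 1 \<and> R ** F = mat 1"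
    using char_matrix_invertible[of ?A] unfolding invertible_def F_def by blast
  then have "F ** R = mat 1 \<and> R ** F = mat 1"
    unfolding R_def matrix_inv_def by (rule someI_ex)
  then have "to_fract (adjugate ?A i j) = R $ i $ j * to_fract (char_poly ?A)"
    unfolding F_def by (intro resolvent_entries) simp
  then have R: "R $ i $ j = to_fract (adjugate ?A i j) / to_fract (char_poly ?A)"
    using char_poly_nonzero[of ?A] by (simp add: field_simps)
  have left: "(const_in_s (out_matrix M) ** R) $ i $ l = to_fract [:out_coeff M i:] * R $ i $ l" for l
  proof -
    have "(const_in_s (out_matrix M) ** R) $ i $ l = (\<Sum>k\<in>UNIV. if k = i then to_fract [:out_coeff M i:] * R $ k $ l else 0)"
      unfolding matrix_matrix_mult_def vec_lambda_beta
      using assms by (intro sum.cong) (auto simp: const_in_s_def out_matrix_def)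
    then show ?thesis by simp
  qed
  have "transfer_matrix M $ i $ j = (\<Sum>l\<in>UNIV. if l = j then to_fract [:out_coeff M i:] * R $ i $ l * to_fract [:in_coeff M j:] else 0)"
    unfolding transfer_matrix_def F R_def[symmetric] matrix_matrix_mult_def[of _ "const_in_s (in_matrix M)"] vec_lambda_beta left
    using assms by (intro sum.cong) (auto simp: const_in_s_def in_matrix_def)
  also have "\<dots> = to_fract ([:out_coeff M i:] * [:in_coeff M j:] * adjugate ?A i j) / to_fract (char_poly ?A)"
    by (simp only: sum.delta finite UNIV_I if_True R to_fract_mult) (simp add: ac_simps)
  also have "[:out_coeff M i:] * [:in_coeff M j:] * adjugate ?A i j = transfer_num M i j"
    by (simp add: transfer_num_def mult.commute)
  finally show ?thesis using char_poly_nonzero[of ?A] by (simp add: to_fract_def)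
qed

lemma fract_coeffs_reduced:
  fixes p q :: "'a :: field poly"
  assumes "coprime p q" "lead_coeff q = 1"
  shows "fract_coeffs (Fract p q) = set (coeffs p) \<union> set (coeffs q)"
proof -
  have "p = p' \<and> q = q'" if "Fract p q = Fract p' q'" "coprime p' q'" "lead_coeff q' = 1" for p' q'
  proof (rule monic_coprime_fraction_unique)
    have "q \<noteq> 0" "q' \<noteq> 0" using assms that by auto
    then show "p * q' = p' * q" using that by (simp add: eq_fract)
  qed (use assms that in auto)
  then show ?thesis unfolding fract_coeffs_def using assms by blast
qed

lemma coprime_smult_left:
  fixes p q :: "'a :: field poly"
  assumes "coprime p q" "c \<noteq> 0"
  shows "coprime (smult c p) q"
proof (rule coprimeI)
  fix d assume "d dvd smult c p" "d dvd q"
  then have "d dvd p" using assms(2) by (simp add: dvd_smult_iff)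
  then show "is_unit d" using assms(1) \<open>d dvd q\<close> coprime_common_divisor by blast
qed

text \<open>No cancellation occurs, so the reduced form with monic denominator is the visible
  fraction over the characteristic polynomial.\<close>

lemma transfer_coeffs_eq:
  assumes "linear_compartment_model M" "strongly_connected (edges M)"
  shows "transfer_coeffs M = (\<Union>i\<in>outputs M. \<Union>j\<in>inputs M.
    set (coeffs (transfer_num M i j)) \<union> set (coeffs (char_poly (comp_matrix M))))"
proof -
  have "fract_coeffs (transfer_matrix M $ i $ j) =
      set (coeffs (transfer_num M i j)) \<union> set (coeffs (char_poly (comp_matrix M)))"
    if "i \<in> outputs M" "j \<in> inputs M" for i j
  proof -
    have "out_coeff M i * in_coeff M j \<noteq> 0"
      using assms(1) that by (auto simp: linear_compartment_model_def)
    then have "coprime (transfer_num M i j) (char_poly (comp_matrix M))"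
      unfolding transfer_num_def
      using comp_matrix_observable[OF assms] comp_matrix_controllable[OF assms]
      by (intro coprime_smult_left coprime_adjugate_char_poly)
    then show ?thesis
      unfolding transfer_matrix_entry[OF that] by (intro fract_coeffs_reduced lead_coeff_char_poly)
  qed
  then show ?thesis by (simp add: transfer_coeffs_def)
qed

section \<open>Specialization of the transfer functions\<close>

text \<open>Coefficientwise \<open>ratval\<close>: polynomials built by ring operations specialize
  without checking definedness separately.\<close>

definition polyval :: "(nat \<Rightarrow> complex) \<Rightarrow> ratfun poly \<Rightarrow> complex poly \<Rightarrow> bool" where
  "polyval \<mu> p q \<longleftrightarrow> (\<forall>k. ratval \<mu> (coeff p k) (coeff q k))"

lemma polyval_const: "ratval \<mu> a b \<Longrightarrow> polyval \<mu> [:a:] [:b:]"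
  by (auto simp: polyval_def coeff_pCons ratval_0 split: nat.splits)

lemma polyval_0: "polyval \<mu> 0 0"
  by (simp add: polyval_def ratval_0)

lemma polyval_1: "polyval \<mu> 1 1"
  using polyval_const[OF ratval_1, of \<mu>] by (simp add: one_pCons)

lemma polyval_add: "polyval \<mu> p q \<Longrightarrow> polyval \<mu> p' q' \<Longrightarrow> polyval \<mu> (p + p') (q + q')"
  by (auto simp: polyval_def intro: ratval_add)

lemma polyval_diff: "polyval \<mu> p q \<Longrightarrow> polyval \<mu> p' q' \<Longrightarrow> polyval \<mu> (p - p') (q - q')"
  by (auto simp: polyval_def intro: ratval_diff)

lemma polyval_mult: "polyval \<mu> p q \<Longrightarrow> polyval \<mu> p' q' \<Longrightarrow> polyval \<mu> (p * p') (q * q')"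
  by (auto simp: polyval_def coeff_mult intro!: ratval_sum ratval_mult)

lemma polyval_sum: "(\<And>i. i \<in> I \<Longrightarrow> polyval \<mu> (f i) (g i)) \<Longrightarrow> polyval \<mu> (sum f I) (sum g I)"
  by (induction I rule: infinite_finite_induct) (auto intro: polyval_0 polyval_add)

lemma polyval_prod: "(\<And>i. i \<in> I \<Longrightarrow> polyval \<mu> (f i) (g i)) \<Longrightarrow> polyval \<mu> (prod f I) (prod g I)"
  by (induction I rule: infinite_finite_induct) (auto intro: polyval_1 polyval_mult)

lemma polyval_of_int: "polyval \<mu> (of_int k) (of_int k)"
  using polyval_const[OF ratval_of_int, of \<mu> k] by (simp add: of_int_poly)

lemma polyval_det:
  fixes F :: "ratfun poly^'n^'n" and G :: "complex poly^'n^'n"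
  assumes "\<And>i j. polyval \<mu> (F $ i $ j) (G $ i $ j)"
  shows "polyval \<mu> (det F) (det G)"
  unfolding det_def by (intro polyval_sum polyval_mult polyval_of_int polyval_prod assms)

lemma polyval_char_matrix: "polyval \<mu> (char_matrix (comp_matrix M) $ i $ j) (char_matrix (comp_at M \<mu>) $ i $ j)"
proof -
  have "polyval \<mu> [:0, 1:] [:0, 1:]"
    by (auto simp: polyval_def coeff_pCons ratval_0 ratval_1 split: nat.splits)
  then show ?thesis
    unfolding char_matrix_def vec_lambda_beta
    by (intro polyval_diff polyval_const ratval_comp) (simp add: polyval_0)
qed

lemma polyval_char_poly: "polyval \<mu> (char_poly (comp_matrix M)) (char_poly (comp_at M \<mu>))"
  unfolding char_poly_def by (intro polyval_det polyval_char_matrix)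

lemma polyval_adjugate: "polyval \<mu> (adjugate (comp_matrix M) i j) (adjugate (comp_at M \<mu>) i j)"
  unfolding adjugate_def
  by (intro polyval_det) (simp add: polyval_char_matrix polyval_0 polyval_1)

lemma OmegaD:
  assumes "\<mu> \<in> Omega M"
  shows "i \<in> outputs M \<Longrightarrow> ratval \<mu> (out_coeff M i) (out_at M \<mu> i)"
    and "j \<in> inputs M \<Longrightarrow> ratval \<mu> (in_coeff M j) (in_at M \<mu> j)"
  using assms by (auto simp: Omega_def out_at_def in_at_def intro: ratval_eval)

lemma polyval_transfer_num:
  assumes "\<mu> \<in> Omega M" "i \<in> outputs M" "j \<in> inputs M"
  shows "polyval \<mu> (transfer_num M i j) (transfer_num_at M \<mu> i j)"
proof -
  have "polyval \<mu> ([:out_coeff M i * in_coeff M j:] * adjugate (comp_matrix M) i j)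
      ([:out_at M \<mu> i * in_at M \<mu> j:] * adjugate (comp_at M \<mu>) i j)"
    using assms by (intro polyval_mult polyval_const ratval_mult OmegaD polyval_adjugate)
  then show ?thesis by (simp add: transfer_num_def transfer_num_at_def)
qed

lemma transfer_coeffs_values:
  assumes M: "linear_compartment_model M" "strongly_connected (edges M)"
    and \<mu>: "\<mu> \<in> Omega M" and \<mu>': "\<mu>' \<in> Omega M"
    and \<chi>: "char_poly (comp_at M \<mu>) = char_poly (comp_at M \<mu>')"
    and N: "\<And>i j. i \<in> outputs M \<Longrightarrow> j \<in> inputs M \<Longrightarrow> transfer_num_at M \<mu> i j = transfer_num_at M \<mu>' i j"
    and f: "f \<in> transfer_coeffs M"
  shows "\<exists>w. ratval \<mu> f w \<and> ratval \<mu>' f w"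
proof -
  from f obtain i j where ij: "i \<in> outputs M" "j \<in> inputs M"
    and "f \<in> set (coeffs (transfer_num M i j)) \<union> set (coeffs (char_poly (comp_matrix M)))"
    unfolding transfer_coeffs_eq[OF M] by blast
  then consider k where "f = coeff (transfer_num M i j) k" | k where "f = coeff (char_poly (comp_matrix M)) k"
    by (auto simp: coeffs_def split: if_splits)
  then show ?thesis
  proof cases
    case 1
    then show ?thesis
      using polyval_transfer_num[OF \<mu> ij] polyval_transfer_num[OF \<mu>' ij] N[OF ij] unfolding polyval_def by metis
  next
    case 2
    then show ?thesis
      using polyval_char_poly[of \<mu> M] polyval_char_poly[of \<mu>' M] \<chi> unfolding polyval_def by metis
  qed
qed

lemma transfer_eq_if_coeffs_eq:
  assumes M: "linear_compartment_model M" "strongly_connected (edges M)"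
    and \<mu>: "\<mu> \<in> Omega M" and \<mu>': "\<mu>' \<in> Omega M"
    and vals: "\<And>f. f \<in> transfer_coeffs M \<Longrightarrow> \<exists>w. ratval \<mu> f w \<and> ratval \<mu>' f w"
    and ij: "i \<in> outputs M" "j \<in> inputs M"
  shows "char_poly (comp_at M \<mu>) = char_poly (comp_at M \<mu>')" "transfer_num_at M \<mu> i j = transfer_num_at M \<mu>' i j"
proof -
  have *: "q = q'" if "polyval \<mu> p q" "polyval \<mu>' p q'" "set (coeffs p) \<subseteq> transfer_coeffs M" for p q q'
  proof (rule poly_eqI)
    fix k
    have "\<exists>w. ratval \<mu> (coeff p k) w \<and> ratval \<mu>' (coeff p k) w"
    proof (cases "k \<le> degree p \<and> p \<noteq> 0")
      case True
      then have "coeff p k \<in> set (coeffs p)" by (simp add: coeff_in_coeffs)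
      then show ?thesis using that(3) vals by blast
    next
      case False
      then have "coeff p k = 0" by (auto simp: coeff_eq_0)
      then show ?thesis using ratval_0 by metis
    qed
    then show "coeff q k = coeff q' k" using that(1,2) ratval_unique unfolding polyval_def by metis
  qed
  show "char_poly (comp_at M \<mu>) = char_poly (comp_at M \<mu>')"
    \<comment> \<open>An output and an input must exist here, as otherwise the coefficients of the
      characteristic polynomial would not be transfer coefficients.\<close>
    using ij by (intro *[OF polyval_char_poly polyval_char_poly]) (auto simp: transfer_coeffs_eq[OF M])
  show "transfer_num_at M \<mu> i j = transfer_num_at M \<mu>' i j"
    using ij by (intro *[OF polyval_transfer_num[OF \<mu> ij] polyval_transfer_num[OF \<mu>' ij]])
      (auto simp: transfer_coeffs_eq[OF M])
qed

lemma det_in_subfield: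
  fixes F :: "'a :: field^'n^'n"
  assumes "is_subfield K" "\<And>i j. F $ i $ j \<in> K"
  shows "det F \<in> K"
  unfolding det_def
  by (intro subfield_sum subfield_mult subfield_of_int subfield_prod assms)

lemma det_in_poly_over:
  fixes F :: "'a :: field poly^'n^'n"
  assumes K: "is_subfield K" and F: "\<And>i j. F $ i $ j \<in> poly_over K"
  shows "det F \<in> poly_over K"
proof -
  have s: "sum f I \<in> poly_over K" if "\<And>i. i \<in> I \<Longrightarrow> f i \<in> poly_over K" for f :: "('n \<Rightarrow> 'n) \<Rightarrow> 'a poly" and I
    using that by (induction I rule: infinite_finite_induct) (auto intro: poly_over_0[OF K] poly_over_add[OF K])
  have p: "prod f I \<in> poly_over K" if "\<And>i. i \<in> I \<Longrightarrow> f i \<in> poly_over K" for f :: "'n \<Rightarrow> 'a poly" and I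
    using that poly_over_const[OF K subfield_1[OF K]]
    by (induction I rule: infinite_finite_induct) (auto intro: poly_over_mult[OF K] simp: one_pCons)
  have i: "of_int k \<in> poly_over K" for k
    unfolding of_int_poly by (intro poly_over_const subfield_of_int K)
  show ?thesis unfolding det_def by (intro s poly_over_mult[OF K] i p F)
qed

lemma comp_matrix_in_ratfuns:
  assumes "linear_compartment_model M"
  shows "comp_matrix M $ i $ j \<in> ratfuns (num_pars M)"
proof -
  note K = is_subfield_ratfuns[of "num_pars M"]
  have e: "par (edge_par M e) \<in> ratfuns (num_pars M)" if "e \<in> edges M" for e
    using assms that by (intro ratfuns_par) (auto simp: linear_compartment_model_def)
  have l: "par (leak_par M i) \<in> ratfuns (num_pars M)" if "i \<in> leaks M" for i
    using assms that by (intro ratfuns_par) (auto simp: linear_compartment_model_def)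
  have "(if i \<in> leaks M then - par (leak_par M i) else 0) - (\<Sum>k | (i, k) \<in> edges M. par (edge_par M (i, k))) \<in> ratfuns (num_pars M)"
    using l e by (intro subfield_diff[OF K] subfield_sum[OF K]) (auto intro: subfield_uminus[OF K] subfield_0[OF K])
  then show ?thesis using e subfield_0[OF K] by (auto simp: comp_matrix_def)
qed

lemma obs_det_in_subfield:
  fixes F :: "'a :: field^'n^'n"
  assumes K: "is_subfield K" and F: "\<And>i j. F $ i $ j \<in> K"
  shows "det (obs_matrix F i) \<in> K"
proof (rule det_in_subfield[OF K])
  have "row_iter F (axis i 1) m $ j \<in> K" for m j
  proof (induction m arbitrary: j)
    case 0 then show ?case using subfield_0[OF K] subfield_1[OF K] by (simp add: axis_def)
  next
    case (Suc m) then show ?case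
      unfolding row_iter_Suc vector_matrix_mult_def vec_lambda_beta by (intro subfield_sum[OF K] subfield_mult[OF K] F)
  qed
  then show "obs_matrix F i $ k $ j \<in> K" for k j by (simp add: obs_matrix_def)
qed

lemma transfer_coeffs_in_ratfuns:
  assumes M: "linear_compartment_model M" "strongly_connected (edges M)"
  shows "transfer_coeffs M \<subseteq> ratfuns (num_pars M)"
proof -
  let ?K = "ratfuns (num_pars M)"
  note K = is_subfield_ratfuns[of "num_pars M"]
  have lin: "[:0, 1:] \<in> poly_over ?K"
    by (intro poly_over_pCons poly_over_0[OF K] subfield_0[OF K] subfield_1[OF K])
  have F: "char_matrix (comp_matrix M) $ i $ j \<in> poly_over ?K" for i j
  proof -
    have c: "- [:comp_matrix M $ i $ j:] \<in> poly_over ?K"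
      by (intro poly_over_uminus[OF K] poly_over_const[OF K] comp_matrix_in_ratfuns M)
    have "char_matrix (comp_matrix M) $ i $ j = (if i = j then [:0, 1:] else 0) + - [:comp_matrix M $ i $ j:]"
      by (simp add: char_matrix_def)
    also have "\<dots> \<in> poly_over ?K"
      by (intro poly_over_add[OF K _ c]) (simp add: lin poly_over_0[OF K])
    finally show ?thesis .
  qed
  have "char_poly (comp_matrix M) \<in> poly_over ?K"
    unfolding char_poly_def by (intro det_in_poly_over[OF K] F)
  moreover have "transfer_num M i j \<in> poly_over ?K" if ij: "i \<in> outputs M" "j \<in> inputs M" for i j
  proof -
    have "adjugate (comp_matrix M) i j \<in> poly_over ?K"
      unfolding adjugate_def
      using F poly_over_0[OF K] poly_over_const[OF K subfield_1[OF K]]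
      by (intro det_in_poly_over[OF K]) (auto simp: one_pCons)
    moreover have "out_coeff M i * in_coeff M j \<in> ?K"
      using M(1) ij by (intro subfield_mult[OF K]) (auto simp: linear_compartment_model_def)
    ultimately have "[:out_coeff M i * in_coeff M j:] * adjugate (comp_matrix M) i j \<in> poly_over ?K"
      by (intro poly_over_mult[OF K] poly_over_const[OF K])
    then show ?thesis by (simp add: transfer_num_def)
  qed
  ultimately show ?thesis
    unfolding transfer_coeffs_eq[OF M] by (fastforce simp: poly_over_def coeffs_def split: if_splits)
qed

lemma finite_transfer_coeffs:
  assumes "linear_compartment_model M" "strongly_connected (edges M)"
  shows "finite (transfer_coeffs M)"
  unfolding transfer_coeffs_eq[OF assms] by auto

section \<open>The field generated by the transfer coefficients is identifiable\<close>

text \<open>One function whose nonvanishing at a point ensures that input and output coefficients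
  are nonzero and that observability and controllability hold there.\<close>

definition regularity :: "'n :: finite compartment_model \<Rightarrow> 'n \<Rightarrow> 'n \<Rightarrow> ratfun" where
  "regularity M i j = out_coeff M i * in_coeff M j *
     (det (obs_matrix (comp_matrix M) i) * det (obs_matrix (transpose (comp_matrix M)) j))"

definition regularity_at :: "'n :: finite compartment_model \<Rightarrow> (nat \<Rightarrow> complex) \<Rightarrow> 'n \<Rightarrow> 'n \<Rightarrow> complex" where
  "regularity_at M \<mu> i j = out_at M \<mu> i * in_at M \<mu> j *
     (det (obs_matrix (comp_at M \<mu>) i) * det (obs_matrix (transpose (comp_at M \<mu>)) j))"

lemma regularity_nonzero:
  assumes "linear_compartment_model M" "strongly_connected (edges M)" "i \<in> outputs M" "j \<in> inputs M"
  shows "regularity M i j \<noteq> 0"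
  using assms comp_matrix_observable[OF assms(1,2)] comp_matrix_controllable[OF assms(1,2)]
  by (auto simp: regularity_def linear_compartment_model_def)

lemma regularity_in_ratfuns:
  assumes "linear_compartment_model M" "i \<in> outputs M" "j \<in> inputs M"
  shows "regularity M i j \<in> ratfuns (num_pars M)"
  unfolding regularity_def
  using assms comp_matrix_in_ratfuns[OF assms(1)]
  by (intro subfield_mult[OF is_subfield_ratfuns] obs_det_in_subfield[OF is_subfield_ratfuns])
     (auto simp: linear_compartment_model_def transpose_def)

lemma ratval_regularity:
  assumes "\<mu> \<in> Omega M" "i \<in> outputs M" "j \<in> inputs M"
  shows "ratval \<mu> (regularity M i j) (regularity_at M \<mu> i j)"
  unfolding regularity_def regularity_at_def
  using assms by (intro ratval_mult OmegaD ratval_det_obs) (simp_all add: transpose_def ratval_comp)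

lemma zariski_open_pointsI:
  assumes "q \<in> polys_in {..<num_pars M}"
  shows "zariski_open_points M {(x, \<mu>) \<in> UNIV \<times> points M. poly_eval \<mu> q \<noteq> 0}"
proof -
  have "polyfun (UNIV <+> {..<num_pars M}) (\<lambda>z :: 'a + nat \<Rightarrow> complex. poly_eval (\<lambda>k. z (Inr k)) q)"
    using assms by (intro polyfun_subst[OF assms] polyfun_var) auto
  then obtain P where "P \<in> polys_in (UNIV <+> {..<num_pars M})"
    "\<And>z :: 'a + nat \<Rightarrow> complex. poly_eval z P = poly_eval (\<lambda>k. z (Inr k)) q"
    unfolding polyfun_def by blast
  then show ?thesis unfolding zariski_open_points_def by (intro bexI[of _ P]) auto
qed

lemma nonvanishing_point_in_points:
  assumes "q \<in> polys_in {..<num_pars M}" "q \<noteq> 0"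
  shows "\<exists>\<mu>\<in>points M. poly_eval \<mu> q \<noteq> 0"
  using generic_point[of "{q}" "num_pars M"] assms by (auto simp: points_def)

lemma generated_imp_identifiable:
  assumes M: "linear_compartment_model M" "strongly_connected (edges M)" and ne: "inputs M \<noteq> {}"
    and h: "h \<in> field_generated_over_complex (transfer_coeffs M)"
  shows "h \<in> identifiable_functions M"
proof -
  let ?K = "ratfuns (num_pars M)"
  note K = is_subfield_ratfuns[of "num_pars M"]
  obtain i0 j0 where i0: "i0 \<in> outputs M" and j0: "j0 \<in> inputs M"
    using M ne by (auto simp: linear_compartment_model_def)
  obtain p0 q0 where pq0: "regularity M i0 j0 = Fract p0 q0" "p0 \<in> polys_in {..<num_pars M}" "q0 \<noteq> 0"
    using regularity_in_ratfuns[OF M(1) i0 j0] by (auto elim: ratfunsE)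
  have "p0 \<noteq> 0" using regularity_nonzero[OF M i0 j0] pq0 by (auto simp: fract_collapse)
  \<comment> \<open>Pairs of indistinguishable points for some generic input and some initial
    states; regularity is required of the first point only.\<close>
  define good where "good = (\<lambda>\<mu> \<mu>'. \<mu> \<in> Omega M \<and> \<mu>' \<in> Omega M \<and> poly_eval \<mu> p0 \<noteq> 0 \<and>
    (\<exists>x x' u. u \<in> generic_inputs M \<and> same_output M (system_output M x \<mu> u) (system_output M x' \<mu>' u)))"
  \<comment> \<open>A ring of functions defined and equal at both points of every good pair.
    Inverses need not be defined at all such points, so its fractions \<open>Q\<close> are used to
    capture the generated field.\<close>
  define R where "R = {g \<in> ?K. \<forall>\<mu> \<mu>'. good \<mu> \<mu>' \<longrightarrow> (\<exists>w. ratval \<mu> g w \<and> ratval \<mu>' g w)}"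
  have coeffs_R: "transfer_coeffs M \<subseteq> R"
  proof
    fix f assume f: "f \<in> transfer_coeffs M"
    have "\<exists>w. ratval \<mu> f w \<and> ratval \<mu>' f w" if good: "good \<mu> \<mu>'" for \<mu> \<mu>'
    proof -
      obtain x x' u where *: "\<mu> \<in> Omega M" "\<mu>' \<in> Omega M" "poly_eval \<mu> p0 \<noteq> 0" "u \<in> generic_inputs M"
        "same_output M (system_output M x \<mu> u) (system_output M x' \<mu>' u)"
        using good unfolding good_def by blast
      have nz: "regularity_at M \<mu> i0 j0 \<noteq> 0"
        using ratval_Fract_nonzero[OF pq0(1,3) *(3) ratval_regularity[OF *(1) i0 j0]] .
      then have "coprime (adjugate (comp_at M \<mu>) i0 j0) (char_poly (comp_at M \<mu>))"
        by (intro coprime_adjugate_char_poly) (auto simp: regularity_at_def)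
      from same_output_imp_same_transfer[OF *(4,5) i0 j0 _ _ this] nz
      show ?thesis
        by (intro transfer_coeffs_values[OF M *(1,2) _ _ f]) (auto simp: regularity_at_def)
    qed
    then show "f \<in> R" using f transfer_coeffs_in_ratfuns[OF M] by (auto simp: R_def)
  qed
  have const_R: "to_fract (poly_const a) \<in> R" for a
    using ratfuns_const ratval_const unfolding R_def by blast
  have R_add: "f + g \<in> R" and R_mult: "f * g \<in> R" if "f \<in> R" "g \<in> R" for f g
    using that unfolding R_def
    by (auto intro: subfield_add[OF K] subfield_mult[OF K]) (meson ratval_add, meson ratval_mult)
  have R_uminus: "- f \<in> R" if "f \<in> R" for f
    using that unfolding R_def by (auto intro: subfield_uminus[OF K]) (meson ratval_uminus)
  have R_1: "1 \<in> R" and R_0: "0 \<in> R"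
    unfolding R_def using subfield_0[OF K] subfield_1[OF K] ratval_0 ratval_1 by auto
  define Q where "Q = {a / b | a b. a \<in> R \<and> b \<in> R \<and> b \<noteq> 0}"
  have QI: "a / b \<in> Q" if "a \<in> R" "b \<in> R" "b \<noteq> 0" for a b
    using that unfolding Q_def by blast
  have QE: "\<exists>a b. f = a / b \<and> a \<in> R \<and> b \<in> R \<and> b \<noteq> 0" if "f \<in> Q" for f
    using that unfolding Q_def by blast
  have "is_subfield Q"
    unfolding is_subfield_def
  proof (intro conjI ballI)
    show "0 \<in> Q" "1 \<in> Q" using QI[OF R_0 R_1] QI[OF R_1 R_1] by simp_all
    fix f assume "f \<in> Q"
    then obtain a b where f: "f = a / b" "a \<in> R" "b \<in> R" "b \<noteq> 0" using QE by blast
    show "- f \<in> Q" using QI[OF R_uminus[OF f(2)] f(3,4)] f(1) by simp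
    show "inverse f \<in> Q"
    proof (cases "a = 0")
      case True
      then show ?thesis using f \<open>0 \<in> Q\<close> by simp
    next
      case False
      then show ?thesis using QI[OF f(3,2)] f(1) by simp
    qed
    fix g assume "g \<in> Q"
    then obtain c d where g: "g = c / d" "c \<in> R" "d \<in> R" "d \<noteq> 0" using QE by blast
    have "f + g = (a * d + c * b) / (b * d)" "f * g = (a * c) / (b * d)"
      using f g by (simp_all add: add_frac_eq)
    moreover have "(a * d + c * b) / (b * d) \<in> Q" "(a * c) / (b * d) \<in> Q"
      using f g by (auto intro!: QI R_add R_mult simp del: times_divide_eq_left times_divide_eq_right)
    ultimately show "f + g \<in> Q" "f * g \<in> Q" by simp_all
  qed
  moreover have "R \<subseteq> Q" using QI[OF _ R_1] by auto
  ultimately have "field_generated_over_complex (transfer_coeffs M) \<subseteq> Q"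
    unfolding field_generated_over_complex_def using coeffs_R const_R by (intro hull_minimal) auto
  with h obtain a b where ab: "h = a / b" "a \<in> R" "b \<in> R" "b \<noteq> 0" using QE by blast
  then have hK: "h \<in> ?K" by (auto simp: R_def intro: subfield_divide[OF K])
  obtain pb qb where pqb: "b = Fract pb qb" "pb \<in> polys_in {..<num_pars M}" "qb \<noteq> 0"
    using ab by (auto simp: R_def elim: ratfunsE)
  have "pb \<noteq> 0" using ab pqb by (auto simp: fract_collapse)
  \<comment> \<open>\<open>p0\<close> makes the first point regular; \<open>pb\<close> makes the
    denominator b of h = a / b nonzero there, hence also at the second point, where b has the same
    value.\<close>
  define T where "T = {(x, \<mu>) \<in> (UNIV :: ('a \<Rightarrow> complex) set) \<times> points M. poly_eval \<mu> (p0 * pb) \<noteq> 0}"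
  have "zariski_open_points M T"
    unfolding T_def using pq0 pqb by (intro zariski_open_pointsI polys_in_mult)
  moreover have "T \<noteq> {}"
    using nonvanishing_point_in_points[of "p0 * pb" M] pq0 pqb \<open>p0 \<noteq> 0\<close> \<open>pb \<noteq> 0\<close>
    by (auto simp: T_def intro: polys_in_mult)
  moreover have "card (values_with_same_output M h x \<mu> u) = 1"
    if *: "(x, \<mu>) \<in> T" "u \<in> generic_inputs M" "(x, \<mu>, u) \<in> Omega_of M h" for x \<mu> u
  proof -
    have "ratfun_eval h \<mu>' = ratfun_eval h \<mu>"
      if **: "(x', \<mu>', u) \<in> Omega_of M h" "same_output M (system_output M x \<mu> u) (system_output M x' \<mu>' u)" for x' \<mu>'
    proof -
      have "good \<mu> \<mu>'" using * ** unfolding good_def T_def Omega_of_def by auto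
      then obtain v w where v: "ratval \<mu> a v" "ratval \<mu>' a v" and w: "ratval \<mu> b w" "ratval \<mu>' b w"
        using ab unfolding R_def by blast
      have "w \<noteq> 0" using ratval_Fract_nonzero[OF pqb(1,3) _ w(1)] *(1) by (auto simp: T_def)
      have "ratfun_eval h \<nu> = v / w" if "ratval \<nu> a v" "ratval \<nu> b w" "ratfun_defined_at h \<nu>" for \<nu>
      proof -
        have "ratval \<nu> (h * b) (ratfun_eval h \<nu> * w)" using that by (intro ratval_mult ratval_eval)
        moreover have "h * b = a" using ab by simp
        ultimately have "ratfun_eval h \<nu> * w = v" using that ratval_unique by metis
        then show ?thesis using \<open>w \<noteq> 0\<close> by (simp add: field_simps)
      qed
      then show ?thesis using v w * ** by (simp add: Omega_of_def)
    qed
    moreover have "same_output M (system_output M x \<mu> u) (system_output M x \<mu> u)" by (simp add: same_output_def)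
    ultimately have "values_with_same_output M h x \<mu> u = {ratfun_eval h \<mu>}"
      unfolding values_with_same_output_def using *(3) by blast
    then show ?thesis by simp
  qed
  ultimately have "identifiable M h"
    unfolding identifiable_def using zariski_open_generic_inputs generic_inputs_nonempty by metis
  then show ?thesis using hK by (simp add: identifiable_functions_def)
qed

section \<open>Identifiable functions are generated by the transfer coefficients\<close>

text \<open>An embedding that fixes the coefficients of \<open>p\<close> acts on it as evaluation at
  the images of the parameters; this is how an embedding becomes a parameter point.\<close>

lemma embedding_poly_eval:
  assumes emb: "embedding_on K \<tau>"
    and const: "\<And>m. m \<in> Poly_Mapping.keys p \<Longrightarrow> to_fract (poly_const (Poly_Mapping.lookup p m)) \<in> K \<and>
      \<tau> (to_fract (poly_const (Poly_Mapping.lookup p m))) = Poly_Mapping.lookup p m"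
    and par: "\<And>k. k < l \<Longrightarrow> par k \<in> K" and p: "p \<in> polys_in {..<l}"
  shows "to_fract p \<in> K" "\<tau> (to_fract p) = poly_eval (\<lambda>k. \<tau> (par k)) p"
proof -
  have K: "is_subfield K" using emb by (rule emb_subfield)
  show "to_fract p \<in> K"
    by (rule poly_in_subfield[OF K _ par p]) (use const in auto)
  have pow: "\<tau> (x ^ n) = \<tau> x ^ n" if "x \<in> K" for x n
    using that by (induction n) (auto simp: emb_1[OF emb] emb_mult[OF emb] subfield_power[OF K])
  have prod: "\<tau> (\<Prod>v\<in>V. par v ^ m v) = (\<Prod>v\<in>V. \<tau> (par v) ^ m v)" if "V \<subseteq> {..<l}" for V m
    using that
  proof (induction V rule: infinite_finite_induct)
    case (insert v V)
    have "(\<Prod>v\<in>V. par v ^ m v) \<in> K"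
      using insert.prems par by (intro subfield_prod[OF K] subfield_power[OF K]) auto
    then show ?case
      using insert par by (simp add: emb_mult[OF emb] subfield_power[OF K] pow)
  qed (simp_all add: emb_1[OF emb])
  have in_K: "(\<Prod>v\<in>Poly_Mapping.keys m. par v ^ Poly_Mapping.lookup m v) \<in> K" if "m \<in> Poly_Mapping.keys p" for m
    using that p par by (intro subfield_prod[OF K] subfield_power[OF K]) (auto simp: polys_in_def)
  have "\<tau> (to_fract p) = (\<Sum>m\<in>Poly_Mapping.keys p. \<tau> (to_fract (poly_const (Poly_Mapping.lookup p m)) *
      (\<Prod>v\<in>Poly_Mapping.keys m. par v ^ Poly_Mapping.lookup m v)))"
    unfolding to_fract_expansion[of p] using const in_K
    by (intro emb_sum[OF emb] subfield_mult[OF K]) auto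
  also have "\<dots> = poly_eval (\<lambda>k. \<tau> (par k)) p"
    unfolding poly_eval_def using const in_K p
    by (intro sum.cong refl) (auto simp: emb_mult[OF emb] polys_in_def intro!: prod)
  finally show "\<tau> (to_fract p) = poly_eval (\<lambda>k. \<tau> (par k)) p" .
qed

lemma identifiable_imp_generated:
  assumes M: "linear_compartment_model M" "strongly_connected (edges M)" and ne: "inputs M \<noteq> {}"
    and h: "h \<in> identifiable_functions M"
  shows "h \<in> field_generated_over_complex (transfer_coeffs M)"
proof (rule ccontr)
  let ?l = "num_pars M"
  let ?G = "field_generated_over_complex (transfer_coeffs M)"
  assume notin: "h \<notin> ?G"
  have hK: "h \<in> ratfuns ?l" using h by (simp add: identifiable_functions_def)
  obtain T U where T: "zariski_open_points M T" "T \<noteq> {}" and U: "zariski_open_inputs M U" "U \<noteq> {}"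
    and one: "\<And>x \<mu> u. (x, \<mu>) \<in> T \<Longrightarrow> u \<in> U \<Longrightarrow> (x, \<mu>, u) \<in> Omega_of M h \<Longrightarrow>
      card (values_with_same_output M h x \<mu> u) = 1"
    using h unfolding identifiable_functions_def identifiable_def by blast
  obtain u where u: "u \<in> U" "u \<in> input_tuples M"
    using U unfolding zariski_open_inputs_def by auto
  obtain P where P: "P \<in> polys_in (UNIV <+> {..<?l})"
    "T = {(x, \<mu>) \<in> UNIV \<times> points M. poly_eval (case_sum x \<mu>) P \<noteq> 0}"
    using T(1) unfolding zariski_open_points_def by blast
  obtain x \<mu>0 where x: "poly_eval (case_sum x \<mu>0) P \<noteq> 0" using T(2) P(2) by auto
  \<comment> \<open>The initial state is frozen, which turns membership in \<open>T\<close> into a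
    polynomial condition \<open>t\<close> on \<mu> alone.\<close>
  have "polyfun {..<?l} (\<lambda>\<mu>. poly_eval (case_sum x \<mu>) P)"
    by (rule polyfun_subst[OF P(1)]) (auto intro: polyfun_const polyfun_var)
  then obtain t where t: "t \<in> polys_in {..<?l}" "\<And>\<mu>. poly_eval \<mu> t = poly_eval (case_sum x \<mu>) P"
    unfolding polyfun_def by blast
  then have "t \<noteq> 0" using x[folded t(2)] by auto
  obtain i0 j0 where i0: "i0 \<in> outputs M" and j0: "j0 \<in> inputs M"
    using M ne by (auto simp: linear_compartment_model_def)
  define S where "S = insert h (insert (regularity M i0 j0)
    (in_coeff M ` inputs M \<union> out_coeff M ` outputs M \<union> transfer_coeffs M))"
  have "finite S" using finite_transfer_coeffs[OF M] by (simp add: S_def)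
  have S_K: "S \<subseteq> ratfuns ?l"
    using M(1) hK regularity_in_ratfuns[OF M(1) i0 j0] transfer_coeffs_in_ratfuns[OF M]
    by (auto simp: S_def linear_compartment_model_def)
  have "\<exists>p q. f = Fract p q \<and> p \<in> polys_in {..<?l} \<and> q \<in> polys_in {..<?l} \<and> q \<noteq> 0" if "f \<in> ratfuns ?l" for f
    using that unfolding ratfuns_def by blast
  then obtain num den where rep: "\<And>f. f \<in> ratfuns ?l \<Longrightarrow> f = Fract (num f) (den f) \<and>
      num f \<in> polys_in {..<?l} \<and> den f \<in> polys_in {..<?l} \<and> den f \<noteq> 0" by metis
  \<comment> \<open>The constants that the embedding has to fix so that the chosen numerators and
    denominators evaluate correctly at the second point. Being finitely many, they keep
    \<open>L\<close> countable.\<close>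
  define C where "C = (\<Union>p\<in>num ` S \<union> den ` S. (\<lambda>m. to_fract (poly_const (Poly_Mapping.lookup p m)) :: ratfun) ` Poly_Mapping.keys p)"
  define L where "L = is_subfield hull (C \<union> transfer_coeffs M)"
  have L: "is_subfield L" unfolding L_def by (rule is_subfield_hull)
  have "countable L"
    unfolding L_def C_def using \<open>finite S\<close> finite_transfer_coeffs[OF M]
    by (intro countable_subfield_hull countable_finite) auto
  have L_sub: "C \<union> transfer_coeffs M \<subseteq> L" unfolding L_def by (rule hull_subset)
  have "L \<subseteq> ?G" unfolding L_def field_generated_over_complex_def by (intro hull_mono) (auto simp: C_def)
  then have "h \<notin> L" using notin by blast
  have L_K: "L \<subseteq> ratfuns ?l"
    unfolding L_def using transfer_coeffs_in_ratfuns[OF M] ratfuns_const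
    by (intro hull_minimal is_subfield_ratfuns) (auto simp: C_def)
  \<comment> \<open>Nonvanishing of \<open>t\<close> puts the point into \<open>T\<close>, that of
    the regularity numerator gives controllability, and that of the denominators makes evaluation at
    \<mu> a homomorphism on all of \<open>L\<close>.\<close>
  define Z where "Z = insert t (insert (num (regularity M i0 j0)) (den ` (L \<union> S)))"
  have "num (regularity M i0 j0) \<noteq> 0"
    using rep[of "regularity M i0 j0"] S_K regularity_nonzero[OF M i0 j0] by (auto simp: S_def fract_collapse)
  then have "0 \<notin> Z" "Z \<subseteq> polys_in {..<?l}"
    using rep L_K S_K t(1) \<open>t \<noteq> 0\<close> by (auto simp: Z_def S_def)
  moreover have "countable Z"
    using \<open>countable L\<close> countable_finite[OF \<open>finite S\<close>] by (simp add: Z_def)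
  ultimately obtain \<mu> where \<mu>: "\<mu> \<in> points M" "\<And>q. q \<in> Z \<Longrightarrow> poly_eval \<mu> q \<noteq> 0"
    using generic_point[of Z ?l] unfolding points_def by blast
  have val: "ratval \<mu> f (ratfun_eval f \<mu>)" if "f \<in> L \<union> S" for f
  proof (rule ratval_eval)
    have "poly_eval \<mu> (den f) \<noteq> 0" using \<mu>(2) that by (auto simp: Z_def)
    then show "ratfun_defined_at f \<mu>"
      using rep[of f] that L_K S_K unfolding ratfun_defined_at_def by blast
  qed
  have \<mu>\<Omega>: "\<mu> \<in> Omega M"
    using \<mu>(1) val by (auto simp: Omega_def ratfun_defined_at_iff S_def)
  define \<tau>0 where "\<tau>0 = (\<lambda>f. ratfun_eval f \<mu>)"
  have emb0: "embedding_on L \<tau>0"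
    unfolding embedding_on_def \<tau>0_def
    using L val by (auto intro!: ratfun_eval_eqI ratval_add ratval_mult ratval_0 ratval_1)
  \<comment> \<open>First \<open>h\<close> is moved off its value at \<mu>; only then are the
    parameters adjoined, keeping the image of \<open>h\<close>.\<close>
  obtain L1 \<tau>1 where 1: "embedding_on L1 \<tau>1" "countable L1" "L \<subseteq> L1" "h \<in> L1" "\<forall>f\<in>L. \<tau>1 f = \<tau>0 f"
    "\<tau>1 h \<noteq> ratfun_eval h \<mu>"
    using extend_embedding_moving[OF emb0 \<open>countable L\<close> \<open>h \<notin> L\<close>] by metis
  obtain L2 \<tau> where 2: "embedding_on L2 \<tau>" "L1 \<subseteq> L2" "par ` {..<?l} \<subseteq> L2" "\<forall>f\<in>L1. \<tau> f = \<tau>1 f"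
    using extend_embedding[OF _ 1(1,2), of "par ` {..<?l}"] by auto
  have \<tau>_L: "\<tau> f = ratfun_eval f \<mu>" if "f \<in> L" for f
    using 1 2 that unfolding \<tau>0_def by auto
  define \<mu>' where "\<mu>' = restrict (\<lambda>k. \<tau> (par k)) {..<?l}"
  have poly: "to_fract p \<in> L2 \<and> \<tau> (to_fract p) = poly_eval \<mu>' p" if p: "p \<in> num ` S \<union> den ` S" for p
  proof -
    have pK: "p \<in> polys_in {..<?l}" using p rep S_K by auto
    have const: "to_fract (poly_const (Poly_Mapping.lookup p m)) \<in> L" if "m \<in> Poly_Mapping.keys p" for m
      using L_sub p that unfolding C_def by blast
    have "to_fract p \<in> L2" "\<tau> (to_fract p) = poly_eval (\<lambda>k. \<tau> (par k)) p"
      using embedding_poly_eval[OF 2(1) _ _ pK] const 1(3) 2(2,3) \<tau>_L ratfun_eval_eqI[OF ratval_const]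
      by (auto simp: subset_iff image_subset_iff)
    moreover have "poly_eval (\<lambda>k. \<tau> (par k)) p = poly_eval \<mu>' p"
      using pK by (rule poly_eval_cong) (simp add: \<mu>'_def)
    ultimately show ?thesis by simp
  qed
  have val': "ratval \<mu>' f (\<tau> f)" if f: "f \<in> S" for f
  proof -
    have n: "to_fract (num f) \<in> L2" "\<tau> (to_fract (num f)) = poly_eval \<mu>' (num f)"
      and d: "to_fract (den f) \<in> L2" "\<tau> (to_fract (den f)) = poly_eval \<mu>' (den f)"
      using poly f by auto
    have rf: "f = Fract (num f) (den f)" "den f \<noteq> 0" using rep S_K f by auto
    \<comment> \<open>Embeddings are injective, so nonzero denominators stay nonzero at \<mu>'; this
      puts \<mu>' in \<open>Omega M\<close> and makes \<open>h\<close> defined there.\<close>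
    then have d0: "poly_eval \<mu>' (den f) \<noteq> 0"
      using emb_eq_0[OF 2(1) d(1)] d(2) by simp
    have "f = to_fract (num f) * inverse (to_fract (den f))"
      using rf by (simp add: to_fract_def)
    then have "\<tau> f = \<tau> (to_fract (num f) * inverse (to_fract (den f)))" by simp
    also have "\<dots> = poly_eval \<mu>' (num f) / poly_eval \<mu>' (den f)"
      using n d subfield_inverse[OF emb_subfield[OF 2(1)]]
      by (simp add: emb_mult[OF 2(1)] emb_inverse[OF 2(1)] divide_inverse)
    finally show ?thesis using ratvalI[OF d0, of "num f"] rf(1) by simp
  qed
  have \<mu>'\<Omega>: "\<mu>' \<in> Omega M"
    using val' by (auto simp: Omega_def points_def \<mu>'_def ratfun_defined_at_iff S_def)
  have vals: "\<exists>w. ratval \<mu> f w \<and> ratval \<mu>' f w" if "f \<in> transfer_coeffs M" for f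
  proof -
    have "f \<in> L" "f \<in> S" using L_sub that by (auto simp: S_def)
    then show ?thesis using val[of f] val'[of f] \<tau>_L[of f] by auto
  qed
  have same: "char_poly (comp_at M \<mu>) = char_poly (comp_at M \<mu>')"
    "\<And>i j. i \<in> outputs M \<Longrightarrow> j \<in> inputs M \<Longrightarrow> transfer_num_at M \<mu> i j = transfer_num_at M \<mu>' i j"
    using transfer_eq_if_coeffs_eq[OF M \<mu>\<Omega> \<mu>'\<Omega>] vals i0 j0 by blast+
  have nz: "regularity_at M \<mu> i0 j0 \<noteq> 0"
  proof (rule ratval_Fract_nonzero)
    show "ratval \<mu> (regularity M i0 j0) (regularity_at M \<mu> i0 j0)"
      by (rule ratval_regularity[OF \<mu>\<Omega> i0 j0])
    show "poly_eval \<mu> (num (regularity M i0 j0)) \<noteq> 0" using \<mu>(2) by (simp add: Z_def)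
  qed (use rep[of "regularity M i0 j0"] S_K in \<open>auto simp: S_def\<close>)
  obtain x' where x': "same_output M (system_output M x \<mu> u) (system_output M x' \<mu>' u)"
    using same_transfer_imp_same_output[OF u(2) j0 _ _ same(1), of x] same(2) nz
    by (auto simp: regularity_at_def)
  have in_\<Omega>: "(x, \<mu>, u) \<in> Omega_of M h" "(x', \<mu>', u) \<in> Omega_of M h"
    using \<mu>\<Omega> \<mu>'\<Omega> u(2) val[of h] val'[of h] by (auto simp: Omega_of_def ratfun_defined_at_iff S_def)
  have "same_output M (system_output M x \<mu> u) (system_output M x \<mu> u)" by (simp add: same_output_def)
  then have "ratfun_eval h \<mu> \<in> values_with_same_output M h x \<mu> u"
    using in_\<Omega>(1) unfolding values_with_same_output_def by blast
  moreover have "ratfun_eval h \<mu>' \<in> values_with_same_output M h x \<mu> u"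
    using in_\<Omega>(2) x' unfolding values_with_same_output_def by blast
  moreover have "ratfun_eval h \<mu>' \<noteq> ratfun_eval h \<mu>"
    using ratfun_eval_eqI[OF val'[of h]] 1(4,6) 2(4) by (simp add: S_def)
  moreover have "card (values_with_same_output M h x \<mu> u) = 1"
  proof (rule one[OF _ u(1) in_\<Omega>(1)])
    show "(x, \<mu>) \<in> T" using \<mu>(1) \<mu>(2)[of t] t(2)[of \<mu>] by (simp add: P(2) Z_def)
  qed
  ultimately show False by (auto simp: card_1_singleton_iff)
qed

theorem corollary3:
  fixes M :: "'n :: finite compartment_model"
  assumes "linear_compartment_model M"
    and "inputs M \<noteq> {}"
    and "strongly_connected (edges M)"
  shows "identifiable_functions M = field_generated_over_complex (transfer_coeffs M)"
  using assms identifiable_imp_generated generated_imp_identifiable by blast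

end
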